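(* Let $L$ be a simple planar lattice with poset $P$ of join-irreducible elements, and let $C_1\cup C_2$ be a canonical chain decomposition of $P$. Then the following conditions are equivalent: (a) $L$ is pseudo-Gorenstein; (b) $L$ is regular and the chains $C_1$ and $C_2$ have the same length.
   Context: $L$ is a finite distributive lattice and $P$ is its subposet of join-irreducible elements ($\alpha\in L$ is join-irreducible if $\alpha\ne\min L$ and $\alpha=\beta\vee\gamma$ implies $\alpha=\beta$ or $\alpha=\gamma$); $L$ is isomorphic to the lattice of poset ideals (down-sets) of $P$. The length of a chain $C$ is $\ell(C)=|C|-1$. For a finite poset $Q$ and $x\in Q$, $\operatorname{height}_Q(x)$ is the maximal length of a chain in $Q$ descending from $x$. $L$ is hyper-planar if $P$, as a set, is the disjoint union of chains $C_1,\dots,C_d$ each of which is a maximal (with respect to inclusion) chain of $P$; such a decomposition is called canonical. The simple planar lattices are exactly the hyper-planar lattices with $d=2$. (Simple means that no element of $P$ is comparable with all elements of $P$.) A hyper-planar lattice is regular if for every canonical chain decomposition $C_1\cup\cdots\cup C_d$ of $P$ and all $x<y$ with $x\in C_i$, $y\in C_j$, one has $\operatorname{height}_{C_i}(x)<\operatorname{height}_{C_j}(y)$. Hibi ring: for a field $K$, $K[L]$ is the $K$-algebra generated by the elements $\alpha\in L$ with defining relations $\alpha\beta=(\alpha\wedge\beta)(\alpha\vee\beta)$; it is a standard graded Cohen–Macaulay domain. A Cohen–Macaulay standard graded $K$-algebra $R$ with graded canonical module $\omega_R$ is pseudo-Gorenstein if $\dim_K(\omega_R)_a=1$ for $a=\min\{i:(\omega_R)_i\ne0\}$;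 equivalently, writing the Hilbert series as $P(t)/(1-t)^{\dim R}$, the leading coefficient of the numerator $P(t)$ is $1$. $L$ is called pseudo-Gorenstein if $K[L]$ is (independent of $K$). Known combinatorial description: let $\hat P=P\cup\{-\infty,\infty\}$ with $-\infty<x<\infty$ for $x\in P$, let $\operatorname{rank}\hat P$ be the maximal length of a chain in $\hat P$, and let $\mathcal T(\hat P)$ be the set of maps $v:\hat P\to\mathbb Z_{\ge0}$ with $v(\infty)=0$ and $v(x)<v(y)$ whenever $x>y$. The monomials $s^{v(-\infty)}\prod_{x\in P}t_x^{v(x)}$, $v\in\mathcal T(\hat P)$, of degree $v(-\infty)$, form a $K$-basis of $\omega_{K[L]}$, and $\min\{v(-\infty):v\in\mathcal T(\hat P)\}=\operatorname{rank}\hat P$. So $L$ is pseudo-Gorenstein if and only if exactly one $v\in\mathcal T(\hat P)$ has $v(-\infty)=\operatorname{rank}\hat P$. *)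

theory Defs
  imports Complex_Main "HOL-Library.Poly_Mapping" "HOL-Library.Disjoint_Sets"
    "HOL-Library.FuncSet" "HOL-Library.Function_Algebras"
begin

section \<open>Chains and join-irreducible elements\<close>

text \<open>
  The distributive lattice \<open>L\<close> is the universe of a type of sort
  \<open>{finite, distrib_lattice}\<close>; the condition \<open>\<exists>\<beta>. \<not> \<alpha> \<le> \<beta>\<close> says that \<open>\<alpha>\<close> is not \<open>min L\<close>.
\<close>

definition join_irreducible :: "'a::lattice \<Rightarrow> bool" where
  "join_irreducible \<alpha> \<longleftrightarrow>
     (\<exists>\<beta>. \<not> \<alpha> \<le> \<beta>) \<and> (\<forall>\<beta> \<gamma>. \<alpha> = sup \<beta> \<gamma> \<longrightarrow> \<alpha> = \<beta> \<or> \<alpha> = \<gamma>)"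

definition join_irreducibles :: "'a::lattice set" where
  "join_irreducibles = {\<alpha>. join_irreducible \<alpha>}"

text \<open>Only used for nonempty finite \<open>C\<close>; truncated subtraction makes the empty chain length 0.\<close>

definition chain_length :: "'a set \<Rightarrow> nat" where
  "chain_length C = card C - 1"

definition height_in :: "'a::order set \<Rightarrow> 'a \<Rightarrow> nat" where
  "height_in Q x =
     Max {chain_length D | D. pred_on.chain Q (<) D \<and> x \<in> D \<and> (\<forall>y\<in>D. y \<le> x)}"

section \<open>Hyper-planar, simple planar and regular lattices\<close>

text \<open>
  A decomposition \<open>P = C\<^sub>1 \<union> \<dots> \<union> C\<^sub>d\<close> is recorded as the set \<open>{C\<^sub>1, \<dots>, C\<^sub>d}\<close>;
  by the definition of \<^const>\<open>partition_on\<close> the chains are nonempty and pairwise disjoint.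
\<close>

definition canonical_decomposition :: "'a::lattice set set \<Rightarrow> bool" where
  "canonical_decomposition \<C> \<longleftrightarrow>
     partition_on join_irreducibles \<C> \<and>
     (\<forall>C\<in>\<C>. pred_on.maxchain join_irreducibles (<) C)"

definition hyper_planar :: "'a::lattice itself \<Rightarrow> bool" where
  "hyper_planar _ \<longleftrightarrow> (\<exists>\<C> :: 'a set set. canonical_decomposition \<C>)"

definition simple_lattice :: "'a::lattice itself \<Rightarrow> bool" where
  "simple_lattice _ \<longleftrightarrow>
     \<not> (\<exists>x\<in>join_irreducibles :: 'a set. \<forall>y\<in>join_irreducibles. x \<le> y \<or> y \<le> x)"

text \<open>
  The simple planar distributive lattices are the hyper-planar ones with \<open>d = 2\<close>.
  Simplicity already follows from the second conjunct, by maximality of the two chains.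
\<close>

definition simple_planar :: "'a::lattice itself \<Rightarrow> bool" where
  "simple_planar _ \<longleftrightarrow>
     simple_lattice TYPE('a) \<and>
     (\<exists>\<C> :: 'a set set. canonical_decomposition \<C> \<and> card \<C> = 2)"

definition regular_lattice :: "'a::lattice itself \<Rightarrow> bool" where
  "regular_lattice _ \<longleftrightarrow>
     hyper_planar TYPE('a) \<and>
     (\<forall>\<C> :: 'a set set. canonical_decomposition \<C> \<longrightarrow>
        (\<forall>C\<in>\<C>. \<forall>D\<in>\<C>. \<forall>x\<in>C. \<forall>y\<in>D. x < y \<longrightarrow> height_in C x < height_in D y))"

section \<open>Graded canonical modules and pseudo-Gorenstein algebras\<close>

text \<open>
  A graded \<open>K\<close>-algebra is given by a commutative ring type \<open>'r\<close>, its scalar multiplication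
  \<open>scale\<close> by the field \<open>K = 'k\<close>, and its homogeneous components \<open>R i\<close>, \<open>i :: int\<close>.
  Polynomials in countably many variables are elements of \<open>(nat \<Rightarrow>\<^sub>0 nat) \<Rightarrow>\<^sub>0 'k\<close>.
\<close>

definition poly_eval ::
  "('k::field \<Rightarrow> 'r::comm_ring_1 \<Rightarrow> 'r) \<Rightarrow> (nat \<Rightarrow> 'r) \<Rightarrow> ((nat \<Rightarrow>\<^sub>0 nat) \<Rightarrow>\<^sub>0 'k) \<Rightarrow> 'r" where
  "poly_eval scale \<theta> p =
     (\<Sum>m\<in>Poly_Mapping.keys p.
        scale (Poly_Mapping.lookup p m)
          (\<Prod>i\<in>Poly_Mapping.keys m. \<theta> i ^ Poly_Mapping.lookup m i))"

definition polys_in :: "nat \<Rightarrow> ((nat \<Rightarrow>\<^sub>0 nat) \<Rightarrow>\<^sub>0 'k::field) set" where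
  "polys_in d = {p. \<forall>m\<in>Poly_Mapping.keys p. Poly_Mapping.keys m \<subseteq> {..<d}}"

definition subalgebra_gen ::
  "('k::field \<Rightarrow> 'r::comm_ring_1 \<Rightarrow> 'r) \<Rightarrow> nat \<Rightarrow> (nat \<Rightarrow> 'r) \<Rightarrow> 'r set" where
  "subalgebra_gen scale d \<theta> = poly_eval scale \<theta> ` polys_in d"

definition algebraically_independent ::
  "('k::field \<Rightarrow> 'r::comm_ring_1 \<Rightarrow> 'r) \<Rightarrow> nat \<Rightarrow> (nat \<Rightarrow> 'r) \<Rightarrow> bool" where
  "algebraically_independent scale d \<theta> \<longleftrightarrow> inj_on (poly_eval scale \<theta>) (polys_in d)"

text \<open>\<open>R\<close> is a finite graded free module over the subring \<open>A\<close>.\<close>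

definition graded_finite_free :: "(int \<Rightarrow> 'r::comm_ring_1 set) \<Rightarrow> 'r set \<Rightarrow> bool" where
  "graded_finite_free R A \<longleftrightarrow>
     (\<exists>B. finite B \<and> (\<forall>b\<in>B. \<exists>n. b \<in> R n) \<and>
          (\<forall>r. \<exists>!c. c \<in> B \<rightarrow>\<^sub>E A \<and> r = (\<Sum>b\<in>B. c b * b)))"

text \<open>
  \<open>K[\<theta>\<^sub>0, \<dots>, \<theta>\<^sub>d\<^sub>-\<^sub>1]\<close>, with \<open>\<theta>\<^sub>i\<close> homogeneous of degree \<open>e\<^sub>i > 0\<close>, is a graded Noether
  normalization over which \<open>R\<close> is free. A graded algebra is Cohen--Macaulay if and only if it
  has such a normalization, equivalently if it is free over each of its graded Noether
  normalizations.
\<close>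

definition CM_normalization ::
  "('k::field \<Rightarrow> 'r::comm_ring_1 \<Rightarrow> 'r) \<Rightarrow> (int \<Rightarrow> 'r set) \<Rightarrow> nat \<Rightarrow> (nat \<Rightarrow> nat) \<Rightarrow> (nat \<Rightarrow> 'r) \<Rightarrow> bool"
  where
  "CM_normalization scale R d e \<theta> \<longleftrightarrow>
     (\<forall>i<d. 0 < e i \<and> \<theta> i \<in> R (int (e i))) \<and>
     algebraically_independent scale d \<theta> \<and>
     graded_finite_free R (subalgebra_gen scale d \<theta>)"

text \<open>
  For \<open>A = K[\<theta>\<^sub>0, \<dots>, \<theta>\<^sub>d\<^sub>-\<^sub>1]\<close> as above and \<open>s = e\<^sub>0 + \<dots> + e\<^sub>d\<^sub>-\<^sub>1\<close>, the canonical module of the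
  polynomial ring \<open>A\<close> is \<open>A(-s)\<close>, and that of \<open>R\<close> is \<open>\<omega>\<^sub>R = Hom\<^sub>A(R, A(-s))\<close>. Its component of
  degree \<open>i\<close> consists of the \<open>A\<close>-linear maps taking \<open>R\<^sub>n\<close> to \<open>A(-s)\<^sub>n\<^sub>+\<^sub>i = A\<^sub>n\<^sub>+\<^sub>i\<^sub>-\<^sub>s\<close>. Up to
  graded isomorphism \<open>\<omega>\<^sub>R\<close> does not depend on the choice of the \<open>\<theta>\<^sub>i\<close>.
\<close>

definition canonical_component ::
  "('k::field \<Rightarrow> 'r::comm_ring_1 \<Rightarrow> 'r) \<Rightarrow> (int \<Rightarrow> 'r set) \<Rightarrow> nat \<Rightarrow> (nat \<Rightarrow> nat) \<Rightarrow> (nat \<Rightarrow> 'r) \<Rightarrow>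
   int \<Rightarrow> ('r \<Rightarrow> 'r) set" where
  "canonical_component scale R d e \<theta> i =
     (let A = subalgebra_gen scale d \<theta>; s = int (\<Sum>j<d. e j) in
      {\<phi>. (\<forall>x y. \<phi> (x + y) = \<phi> x + \<phi> y) \<and> (\<forall>a\<in>A. \<forall>x. \<phi> (a * x) = a * \<phi> x) \<and>
          (\<forall>n. \<phi> ` R n \<subseteq> A \<inter> R (n + i - s))})"

definition pseudo_Gorenstein ::
  "('k::field \<Rightarrow> 'r::comm_ring_1 \<Rightarrow> 'r) \<Rightarrow> (int \<Rightarrow> 'r set) \<Rightarrow> bool" where
  "pseudo_Gorenstein scale R \<longleftrightarrow>
     (\<exists>d e \<theta>. CM_normalization scale R d e \<theta> \<and>
        (let \<omega> = canonical_component scale R d e \<theta> in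
         \<exists>a. \<omega> a \<noteq> {\<lambda>_. 0} \<and> (\<forall>i<a. \<omega> i = {\<lambda>_. 0}) \<and>
             vector_space.dim (\<lambda>c \<phi> x. scale c (\<phi> x)) (\<omega> a) = 1))"

section \<open>Hibi rings\<close>

text \<open>
  The polynomial ring with one variable for each element of \<open>L\<close> is \<open>('a \<Rightarrow>\<^sub>0 nat) \<Rightarrow>\<^sub>0 'k\<close>;
  the ideal generated by a set is its span as a submodule of the ring.
\<close>

definition hibi_var :: "'a \<Rightarrow> ('a \<Rightarrow>\<^sub>0 nat) \<Rightarrow>\<^sub>0 'k::field" where
  "hibi_var \<alpha> = Poly_Mapping.single (Poly_Mapping.single \<alpha> 1) 1"

definition hibi_ideal :: "(('a::lattice \<Rightarrow>\<^sub>0 nat) \<Rightarrow>\<^sub>0 'k::field) set" where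
  "hibi_ideal =
     module.span (*)
       {hibi_var \<alpha> * hibi_var \<beta> - hibi_var (inf \<alpha> \<beta>) * hibi_var (sup \<alpha> \<beta>) | \<alpha> \<beta>. True}"

lemma module_times: "module ((*) :: 'r::comm_ring_1 \<Rightarrow> 'r \<Rightarrow> 'r)"
  by unfold_locales (simp_all add: algebra_simps)

lemma hibi_ideal_zero: "0 \<in> hibi_ideal"
  unfolding hibi_ideal_def by (rule module.span_zero[OF module_times])

lemma hibi_ideal_add: "p \<in> hibi_ideal \<Longrightarrow> q \<in> hibi_ideal \<Longrightarrow> p + q \<in> hibi_ideal"
  unfolding hibi_ideal_def by (rule module.span_add[OF module_times])

lemma hibi_ideal_diff: "p \<in> hibi_ideal \<Longrightarrow> q \<in> hibi_ideal \<Longrightarrow> p - q \<in> hibi_ideal"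
  unfolding hibi_ideal_def by (rule module.span_diff[OF module_times])

lemma hibi_ideal_mult: "q \<in> hibi_ideal \<Longrightarrow> p * q \<in> hibi_ideal"
  unfolding hibi_ideal_def by (rule module.span_scale[OF module_times])

lemma const_coeff_mult_zero:
  fixes p q :: "('a \<Rightarrow>\<^sub>0 nat) \<Rightarrow>\<^sub>0 'k::field"
  assumes "Poly_Mapping.lookup q 0 = 0"
  shows "Poly_Mapping.lookup (p * q) 0 = 0"
proof (rule ccontr)
  assume "Poly_Mapping.lookup (p * q) 0 \<noteq> 0"
  then have "0 \<in> Poly_Mapping.keys (p * q)"
    by (simp add: in_keys_iff)
  then obtain a b where ab: "a \<in> Poly_Mapping.keys p" "b \<in> Poly_Mapping.keys q" "a + b = 0"
    using keys_mult[of p q] by force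
  have "Poly_Mapping.lookup b x = 0" for x
    using arg_cong[OF ab(3), of "\<lambda>m. Poly_Mapping.lookup m x"] by (simp add: lookup_add)
  then have "b = 0"
    by (intro poly_mapping_eqI) simp
  with ab(2) assms show False
    by (simp add: in_keys_iff)
qed

lemma const_coeff_hibi_var:
  "Poly_Mapping.lookup (hibi_var \<alpha> :: ('a \<Rightarrow>\<^sub>0 nat) \<Rightarrow>\<^sub>0 'k::field) 0 = 0"
proof -
  have "Poly_Mapping.single \<alpha> (1::nat) \<noteq> 0"
    by (metis lookup_single_eq lookup_zero zero_neq_one)
  then show ?thesis
    by (simp add: hibi_var_def lookup_single when_def)
qed

lemma one_notin_hibi_ideal: "1 \<notin> (hibi_ideal :: (('a::lattice \<Rightarrow>\<^sub>0 nat) \<Rightarrow>\<^sub>0 'k::field) set)"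
proof -
  have "Poly_Mapping.lookup p 0 = 0"
    if "p \<in> hibi_ideal" for p :: "('a \<Rightarrow>\<^sub>0 nat) \<Rightarrow>\<^sub>0 'k"
    using that unfolding hibi_ideal_def
  proof (induction p rule: module.span_induct_alt[OF module_times, consumes 1, case_names zero step])
    case zero
    then show ?case by simp
  next
    case (step c x y)
    have "Poly_Mapping.lookup x 0 = 0"
      using step(1) by (auto simp: lookup_minus const_coeff_mult_zero const_coeff_hibi_var)
    with step show ?case
      by (simp add: lookup_add const_coeff_mult_zero)
  qed
  moreover have "Poly_Mapping.lookup (1 :: ('a \<Rightarrow>\<^sub>0 nat) \<Rightarrow>\<^sub>0 'k) 0 = 1"
    by (simp add: lookup_one)
  ultimately show ?thesis
    by force
qed

text \<open>The ring \<open>K[L]\<close> for the field \<open>K = 'k\<close> and the lattice \<open>L = 'a\<close>.\<close>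

quotient_type (overloaded) ('a, 'k) hibi_ring = "('a::lattice \<Rightarrow>\<^sub>0 nat) \<Rightarrow>\<^sub>0 'k::field"
  / "\<lambda>p q. p - q \<in> hibi_ideal"
proof (rule equivpI)
  show "reflp (\<lambda>p q :: ('a \<Rightarrow>\<^sub>0 nat) \<Rightarrow>\<^sub>0 'k. p - q \<in> hibi_ideal)"
    by (simp add: reflp_def hibi_ideal_zero)
  show "symp (\<lambda>p q :: ('a \<Rightarrow>\<^sub>0 nat) \<Rightarrow>\<^sub>0 'k. p - q \<in> hibi_ideal)"
  proof (rule sympI)
    fix p q :: "('a \<Rightarrow>\<^sub>0 nat) \<Rightarrow>\<^sub>0 'k"
    assume "p - q \<in> hibi_ideal"
    from hibi_ideal_diff[OF hibi_ideal_zero this] show "q - p \<in> hibi_ideal"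
      by simp
  qed
  show "transp (\<lambda>p q :: ('a \<Rightarrow>\<^sub>0 nat) \<Rightarrow>\<^sub>0 'k. p - q \<in> hibi_ideal)"
  proof (rule transpI)
    fix p q r :: "('a \<Rightarrow>\<^sub>0 nat) \<Rightarrow>\<^sub>0 'k"
    assume "p - q \<in> hibi_ideal" "q - r \<in> hibi_ideal"
    from hibi_ideal_add[OF this] show "p - r \<in> hibi_ideal"
      by simp
  qed
qed

instantiation hibi_ring :: (lattice, field) comm_ring_1
begin

lift_definition zero_hibi_ring :: "('a, 'b) hibi_ring" is 0 .

lift_definition one_hibi_ring :: "('a, 'b) hibi_ring" is 1 .

lift_definition plus_hibi_ring ::
  "('a, 'b) hibi_ring \<Rightarrow> ('a, 'b) hibi_ring \<Rightarrow> ('a, 'b) hibi_ring" is "(+)"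
proof -
  fix p p' q q' :: "('a \<Rightarrow>\<^sub>0 nat) \<Rightarrow>\<^sub>0 'b"
  assume "p - p' \<in> hibi_ideal" "q - q' \<in> hibi_ideal"
  then have "(p - p') + (q - q') \<in> hibi_ideal"
    by (rule hibi_ideal_add)
  then show "p + q - (p' + q') \<in> hibi_ideal"
    by (simp add: algebra_simps)
qed

lift_definition uminus_hibi_ring :: "('a, 'b) hibi_ring \<Rightarrow> ('a, 'b) hibi_ring" is uminus
proof -
  fix p p' :: "('a \<Rightarrow>\<^sub>0 nat) \<Rightarrow>\<^sub>0 'b"
  assume "p - p' \<in> hibi_ideal"
  from hibi_ideal_diff[OF hibi_ideal_zero this] show "- p - - p' \<in> hibi_ideal"
    by simp
qed

lift_definition minus_hibi_ring ::
  "('a, 'b) hibi_ring \<Rightarrow> ('a, 'b) hibi_ring \<Rightarrow> ('a, 'b) hibi_ring" is "(-)"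
proof -
  fix p p' q q' :: "('a \<Rightarrow>\<^sub>0 nat) \<Rightarrow>\<^sub>0 'b"
  assume "p - p' \<in> hibi_ideal" "q - q' \<in> hibi_ideal"
  then have "(p - p') - (q - q') \<in> hibi_ideal"
    by (rule hibi_ideal_diff)
  then show "p - q - (p' - q') \<in> hibi_ideal"
    by (simp add: algebra_simps)
qed

lift_definition times_hibi_ring ::
  "('a, 'b) hibi_ring \<Rightarrow> ('a, 'b) hibi_ring \<Rightarrow> ('a, 'b) hibi_ring" is "(*)"
proof -
  fix p p' q q' :: "('a \<Rightarrow>\<^sub>0 nat) \<Rightarrow>\<^sub>0 'b"
  assume "p - p' \<in> hibi_ideal" "q - q' \<in> hibi_ideal"
  then have "q * (p - p') + p' * (q - q') \<in> hibi_ideal"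
    by (intro hibi_ideal_add hibi_ideal_mult)
  then show "p * q - p' * q' \<in> hibi_ideal"
    by (simp add: algebra_simps)
qed

instance
proof
  fix a b c :: "('a, 'b) hibi_ring"
  show "a + b + c = a + (b + c)" "a + b = b + a" "0 + a = a" "- a + a = 0"
    "a - b = a + - b" "a * b * c = a * (b * c)" "a * b = b * a" "1 * a = a"
    "(a + b) * c = a * c + b * c"
    by (transfer, simp add: algebra_simps hibi_ideal_zero)+
  show "(0 :: ('a, 'b) hibi_ring) \<noteq> 1"
  proof (transfer, rule notI)
    assume "(0 :: ('a \<Rightarrow>\<^sub>0 nat) \<Rightarrow>\<^sub>0 'b) - 1 \<in> hibi_ideal"
    from hibi_ideal_diff[OF hibi_ideal_zero this] show False
      by (simp add: one_notin_hibi_ideal)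
  qed
qed

end

text \<open>The residue class of \<open>p\<close> in \<open>K[L]\<close> is \<open>abs_hibi_ring p\<close>.\<close>

definition hibi_scale :: "'k::field \<Rightarrow> ('a::lattice, 'k) hibi_ring \<Rightarrow> ('a, 'k) hibi_ring" where
  "hibi_scale c r = abs_hibi_ring (Poly_Mapping.single 0 c) * r"

text \<open>For \<open>n < 0\<close> the condition forces \<open>p = 0\<close>, so that the component is zero.\<close>

definition hibi_component :: "int \<Rightarrow> ('a::lattice, 'k::field) hibi_ring set" where
  "hibi_component n =
     {abs_hibi_ring p | p. \<forall>m\<in>Poly_Mapping.keys p.
        int (\<Sum>\<alpha>\<in>Poly_Mapping.keys m. Poly_Mapping.lookup m \<alpha>) = n}"

end

theory Submission
  imports Defs "HOL-Library.Multiset" "HOL-Computational_Algebra.Polynomial_FPS"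
begin

text \<open>
  A free basis of a graded algebra over a Noether normalization determines its Hilbert series
  \<open>Q(t) / \<Prod>(1 - t^e\<^sub>i)\<close>, where \<open>Q\<close> counts basis elements by degree; hence the leading coefficient
  of \<open>Q\<close> does not depend on the normalization up to sign, and it is the dimension of the initial
  component of the canonical module.

  The coordinates \<open>(|C\<^sub>1 \<inter> {..\<alpha>}|, |C\<^sub>2 \<inter> {..\<alpha>}|)\<close> embed the lattice into the plane. As in Garsia's
  basis for Stanley--Reisner rings, the Hibi ring is free over the polynomial ring in the sums
  of all elements of a given rank, with one basis element for each maximal chain (lattice path), the
  product of the corners at which the path can be flipped downwards. This follows from unitriangularity
  with respect to the monomial basis, since straightening a product which is not a chain spreads
  the ranks, and among chains the leading one is lowest.

  Such sets of corners correspond to sets of incomparable pairs in \<open>C\<^sub>1 \<times> C\<^sub>2\<close> which increase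
  strictly in both components. By maximality of the two chains, an exchange argument shows that a
  unique set of maximal size must match \<open>C\<^sub>1\<close> with \<open>C\<^sub>2\<close> level by level, and this is
  regularity with equal lengths.
\<close>

section \<open>Graded algebras that are free over a Noether normalization\<close>

text \<open>Straightening an incomparable product keeps the sum of the two ranks, since both
  coordinates are modular, but strictly increases the sum of their squares. For a monomial,
  \<open>nesting\<close> computes the sum of squared ranks of its straightened form from the weight
  alone, without following the rewriting. All terms of a product of rank sums and corners have the
  same prescribed ranks, so \<open>nesting\<close> is smallest exactly on the terms that are already
  chains. These are compared by \<open>yc_weight\<close>: all of them contain the corners of the
  path, and a path whose corners are comparable with \<sigma> does not pass above \<sigma> at its
  rank. The fixed corners thus make the path the leading term and allow it to be recovered from that
  term. Pseudo-Gorensteinness is stated with an existentially chosen normalization, so one explicit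
  basis settles only one direction; the Hilbert series supplies the other. Similarly, regularity
  speaks of every canonical decomposition. It is derived from a level function that is read off from
  a matching of \<open>C1\<close> with \<open>C2\<close> and does not refer to the decomposition
  under consideration.\<close>

abbreviation lookup where "lookup \<equiv> Poly_Mapping.lookup"
abbreviation keys where "keys \<equiv> Poly_Mapping.keys"
abbreviation single where "single \<equiv> Poly_Mapping.single"

section \<open>Monomials in the parameters and their generating function\<close>

definition expvecs :: "nat \<Rightarrow> (nat \<Rightarrow>\<^sub>0 nat) set" where
  "expvecs d = {u. keys u \<subseteq> {..<d}}"

definition power_product :: "(nat \<Rightarrow> 'r::comm_ring_1) \<Rightarrow> (nat \<Rightarrow>\<^sub>0 nat) \<Rightarrow> 'r" where
  "power_product \<theta> u = (\<Prod>i\<in>keys u. \<theta> i ^ lookup u i)"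

definition wdeg :: "(nat \<Rightarrow> nat) \<Rightarrow> (nat \<Rightarrow>\<^sub>0 nat) \<Rightarrow> nat" where
  "wdeg e u = (\<Sum>i\<in>keys u. e i * lookup u i)"

lemma power_product_superset:
  assumes "finite S" "keys u \<subseteq> S"
  shows "power_product \<theta> u = (\<Prod>i\<in>S. \<theta> i ^ lookup u i)"
  unfolding power_product_def
  by (rule prod.mono_neutral_left) (use assms in \<open>auto simp: in_keys_iff\<close>)

lemma wdeg_superset:
  assumes "finite S" "keys u \<subseteq> S"
  shows "wdeg e u = (\<Sum>i\<in>S. e i * lookup u i)"
  unfolding wdeg_def
  by (rule sum.mono_neutral_left) (use assms in \<open>auto simp: in_keys_iff\<close>)

lemma expvecs_add: "u \<in> expvecs d \<Longrightarrow> w \<in> expvecs d \<Longrightarrow> u + w \<in> expvecs d"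
  unfolding expvecs_def using keys_add[of u w] by blast

lemma power_product_add: "power_product \<theta> (u + w) = power_product \<theta> u * power_product \<theta> w"
proof -
  let ?S = "keys u \<union> keys w"
  have "power_product \<theta> (u + w) = (\<Prod>i\<in>?S. \<theta> i ^ lookup (u + w) i)"
    by (rule power_product_superset) (auto simp: keys_add)
  also have "\<dots> = (\<Prod>i\<in>?S. \<theta> i ^ lookup u i) * (\<Prod>i\<in>?S. \<theta> i ^ lookup w i)"
    by (simp add: lookup_add power_add prod.distrib)
  also have "\<dots> = power_product \<theta> u * power_product \<theta> w"
    by (simp add: power_product_superset[of ?S])
  finally show ?thesis .
qed

lemma wdeg_add: "wdeg e (u + w) = wdeg e u + wdeg e w"
proof -
  let ?S = "keys u \<union> keys w"
  have "wdeg e (u + w) = (\<Sum>i\<in>?S. e i * lookup (u + w) i)"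
    by (rule wdeg_superset) (auto simp: keys_add)
  also have "\<dots> = wdeg e u + wdeg e w"
    by (simp add: lookup_add algebra_simps sum.distrib wdeg_superset[of ?S])
  finally show ?thesis .
qed

lemma power_product_zero [simp]: "power_product \<theta> 0 = 1"
  by (simp add: power_product_def)

lemma wdeg_zero [simp]: "wdeg e 0 = 0"
  by (simp add: wdeg_def)

lemma zero_in_expvecs [simp]: "0 \<in> expvecs d"
  by (simp add: expvecs_def)

lemma lookup_sum_single:
  assumes "finite V"
  shows "lookup (\<Sum>u\<in>V. single u (a u)) w = (if w \<in> V then a w else 0)"
  using assms by (simp add: lookup_sum lookup_single when_def sum.delta)

text \<open>Positive weights bound every exponent by the weighted degree, so an exponent vector of
  degree \<open>n\<close> amounts to a function from \<open>{..<d}\<close> to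
  \<open>{..n}\<close>.\<close>

lemma finite_expvecs_wdeg:
  assumes "\<And>i. i < d \<Longrightarrow> 0 < e i"
  shows "finite {u \<in> expvecs d. wdeg e u = n}"
proof (rule inj_on_finite)
  show "inj_on (\<lambda>u. \<lambda>i\<in>{..<d}. lookup u i) {u \<in> expvecs d. wdeg e u = n}"
  proof (rule inj_onI, rule poly_mapping_eqI)
    fix u w i
    assume *: "u \<in> {u \<in> expvecs d. wdeg e u = n}" "w \<in> {u \<in> expvecs d. wdeg e u = n}"
      "(\<lambda>i\<in>{..<d}. lookup u i) = (\<lambda>i\<in>{..<d}. lookup w i)"
    show "lookup u i = lookup w i"
    proof (cases "i < d")
      case True
      then show ?thesis using fun_cong[OF *(3), of i] by simp
    next
      case False
      then have "i \<notin> keys u" "i \<notin> keys w"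
        using *(1,2) by (auto simp: expvecs_def)
      then show ?thesis by (simp add: in_keys_iff)
    qed
  qed
  show "(\<lambda>u. \<lambda>i\<in>{..<d}. lookup u i) ` {u \<in> expvecs d. wdeg e u = n} \<subseteq> {..<d} \<rightarrow>\<^sub>E {..n}"
  proof -
    have "lookup u i \<le> wdeg e u" if u: "u \<in> expvecs d" "i < d" for u i
    proof -
      have "lookup u i \<le> e i * lookup u i"
        using assms[OF u(2)] by simp
      also have "\<dots> \<le> (\<Sum>i<d. e i * lookup u i)"
        using u(2) by (intro member_le_sum) auto
      also have "\<dots> = wdeg e u"
        using u(1) by (simp add: wdeg_superset[of "{..<d}"] expvecs_def)
      finally show ?thesis .
    qed
    then show ?thesis by (auto simp: PiE_def extensional_def)
  qed
qed (auto intro: finite_PiE)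

text \<open>The Hilbert series of the polynomial ring in \<open>d\<close> variables of degrees
  \<open>e 0, ..., e (d - 1)\<close>.\<close>

definition expvec_fps :: "nat \<Rightarrow> (nat \<Rightarrow> nat) \<Rightarrow> int fps" where
  "expvec_fps d e = Abs_fps (\<lambda>n. int (card {u \<in> expvecs d. wdeg e u = n}))"

text \<open>Multiplication by the last variable is a bijection from all monomials onto those
  divisible by it; the factor \<open>1 - fps_X ^ e d\<close> cancels these and leaves the monomials
  free of that variable.\<close>

lemma expvec_fps_Suc:
  assumes "\<And>i. i < Suc d \<Longrightarrow> 0 < e i"
  shows "expvec_fps (Suc d) e * (1 - fps_X ^ e d) = expvec_fps d e"
proof (rule fps_ext)
  fix n
  let ?U = "\<lambda>d n. {u \<in> expvecs d. wdeg e u = n}"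
  let ?s = "single d (1::nat)"
  have fin: "finite (?U (Suc d) k)" "finite (?U d k)" for k
    by (intro finite_expvecs_wdeg; use assms in auto)+
  have wd: "wdeg e ?s = e d" by (simp add: wdeg_def)
  have sub: "u \<in> expvecs d \<longleftrightarrow> lookup u d = 0" if "u \<in> expvecs (Suc d)" for u
    using that unfolding expvecs_def by (auto simp: in_keys_iff lessThan_Suc)
  have split: "?U (Suc d) n = ?U d n \<union> (\<lambda>u. u + ?s) ` {u \<in> expvecs (Suc d). wdeg e u + e d = n}"
    (is "_ = _ \<union> ?f ` ?V")
  proof (intro equalityI subsetI)
    fix u assume u: "u \<in> ?U (Suc d) n"
    show "u \<in> ?U d n \<union> ?f ` ?V"
    proof (cases "lookup u d = 0")
      case True
      with u sub show ?thesis by auto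
    next
      case False
      define w where "w = u - ?s"
      have uw: "u = w + ?s"
        by (rule poly_mapping_eqI) (use False in \<open>auto simp: w_def lookup_add lookup_minus lookup_single when_def\<close>)
      have "keys w \<subseteq> keys u"
        by (auto simp: w_def in_keys_iff lookup_minus)
      with u have "w \<in> expvecs (Suc d)" by (auto simp: expvecs_def)
      moreover have "wdeg e w + e d = n" using u wd by (simp add: uw wdeg_add)
      ultimately show ?thesis using uw by blast
    qed
  next
    fix u assume "u \<in> ?U d n \<union> ?f ` ?V"
    then show "u \<in> ?U (Suc d) n"
    proof
      assume "u \<in> ?U d n"
      then show ?thesis by (force simp: expvecs_def)
    next
      assume "u \<in> ?f ` ?V"
      then obtain w where w: "u = w + ?s" "w \<in> expvecs (Suc d)" "wdeg e w + e d = n" by blast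
      have "?s \<in> expvecs (Suc d)" by (simp add: expvecs_def)
      with w(2) have "w + ?s \<in> expvecs (Suc d)" by (rule expvecs_add)
      moreover have "wdeg e (w + ?s) = n" using w(3) wd by (simp only: wdeg_add)
      ultimately show ?thesis using w(1) by blast
    qed
  qed
  have disj: "?U d n \<inter> ?f ` ?V = {}"
  proof -
    have "lookup (?f w) d \<noteq> 0" for w by (simp add: lookup_add)
    moreover have "lookup u d = 0" if "u \<in> expvecs d" for u
      using that by (auto simp: expvecs_def in_keys_iff)
    ultimately show ?thesis by blast
  qed
  have finV: "finite ?V" by (rule finite_subset[OF _ fin(1)[of "n - e d"]]) auto
  have "card (?U (Suc d) n) = card (?U d n) + card ?V"
    unfolding split by (subst card_Un_disjoint[OF _ _ disj]) (auto simp: fin finV card_image)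
  moreover have "?V = (if e d \<le> n then ?U (Suc d) (n - e d) else {})" by auto
  ultimately show "fps_nth (expvec_fps (Suc d) e * (1 - fps_X ^ e d)) n = fps_nth (expvec_fps d e) n"
    by (auto simp: expvec_fps_def right_diff_distrib fps_X_power_mult_right_nth)
qed

lemma expvec_fps_prod:
  assumes "\<And>i. i < d \<Longrightarrow> 0 < e i"
  shows "expvec_fps d e * (\<Prod>i<d. 1 - fps_X ^ e i) = 1"
  using assms
proof (induction d)
  case 0
  have "{u \<in> expvecs 0. wdeg e u = n} = (if n = 0 then {0} else {})" for n
    by (auto simp: expvecs_def)
  then show ?case
    by (intro fps_ext) (simp add: expvec_fps_def)
next
  case (Suc d)
  have "expvec_fps (Suc d) e * (\<Prod>i<Suc d. 1 - fps_X ^ e i)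
      = (expvec_fps (Suc d) e * (1 - fps_X ^ e d)) * (\<Prod>i<d. 1 - fps_X ^ e i)"
    by (simp add: mult_ac)
  also have "\<dots> = 1" using Suc by (simp add: expvec_fps_Suc)
  finally show ?case .
qed

section \<open>Linear independence of indexed families\<close>

locale linear_families = vector_space scale
  for scale :: "'k::field \<Rightarrow> 'b::ab_group_add \<Rightarrow> 'b"
begin

text \<open>Stated for a family and not for its image, because products such as
  \<open>pp u * b\<close> are not known in advance to be distinct; injectivity is a
  consequence.\<close>

definition independent_family :: "('i \<Rightarrow> 'b) \<Rightarrow> 'i set \<Rightarrow> bool" where
  "independent_family f I \<longleftrightarrow>
     (\<forall>F c. finite F \<longrightarrow> F \<subseteq> I \<longrightarrow> (\<Sum>i\<in>F. scale (c i) (f i)) = 0 \<longrightarrow> (\<forall>i\<in>F. c i = 0))"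

lemma independent_familyD:
  fixes f :: "'i \<Rightarrow> 'b" and c :: "'i \<Rightarrow> 'k"
  assumes "independent_family f I" "finite F" "F \<subseteq> I" "(\<Sum>i\<in>F. scale (c i) (f i)) = 0" "i \<in> F"
  shows "c i = 0"
  using assms unfolding independent_family_def by blast

lemma independent_family_inj_on:
  assumes "independent_family f I"
  shows "inj_on f I"
proof (rule inj_onI, rule ccontr)
  fix i j assume *: "i \<in> I" "j \<in> I" "f i = f j" "i \<noteq> j"
  have "(\<Sum>k\<in>{i, j}. scale (if k = i then 1 else - 1) (f k)) = 0"
    using * by simp
  from independent_familyD[OF assms _ _ this, of i] * show False by auto
qed

lemma dim_independent_family:
  assumes "independent_family f I" "finite I" "f ` I \<subseteq> V" "V \<subseteq> span (f ` I)"
  shows "dim V = card I"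
proof (rule dim_unique[of "f ` I"])
  have inj: "inj_on f I" by (rule independent_family_inj_on[OF assms(1)])
  show "card (f ` I) = card I" by (rule card_image[OF inj])
  show "independent (f ` I)"
  proof (rule independent_if_scalars_zero)
    fix c x assume *: "(\<Sum>x\<in>f ` I. scale (c x) x) = 0" "x \<in> f ` I"
    then have "(\<Sum>i\<in>I. scale (c (f i)) (f i)) = 0" by (simp add: sum.reindex[OF inj])
    from independent_familyD[OF assms(1) assms(2) order_refl this] *(2) show "c x = 0" by auto
  qed (use assms in auto)
qed (use assms in auto)

end

section \<open>Graded algebras whose degree-zero part is the field\<close>

locale graded_algebra = linear_families scale
  for scale :: "'k::field \<Rightarrow> 'r::comm_ring_1 \<Rightarrow> 'r" +
  fixes R :: "int \<Rightarrow> 'r set"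
  assumes scale_mult: "scale c x * y = scale c (x * y)"
    and component_subspace: "subspace (R n)"
    and component_mult: "x \<in> R m \<Longrightarrow> y \<in> R n \<Longrightarrow> x * y \<in> R (m + n)"
    and component_neg: "n < 0 \<Longrightarrow> R n = {0}"
    and component_zero: "R 0 = range (\<lambda>c. scale c 1)"
    and component_direct:
      "finite S \<Longrightarrow> (\<And>n. n \<in> S \<Longrightarrow> r n \<in> R n) \<Longrightarrow> (\<Sum>n\<in>S. r n) = 0 \<Longrightarrow> m \<in> S \<Longrightarrow> r m = 0"
begin

lemma mult_scale: "x * scale c y = scale c (x * y)"
  by (metis mult.commute scale_mult)

lemma one_in_component: "1 \<in> R 0"
  unfolding component_zero by (metis rangeI scale_one)

lemma power_in_component: "x \<in> R m \<Longrightarrow> x ^ k \<in> R (int k * m)"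
proof (induction k)
  case (Suc k)
  from component_mult[OF Suc(2) Suc(1)[OF Suc(2)]] show ?case by (simp add: algebra_simps)
qed (simp add: one_in_component)

lemma prod_in_component:
  "(\<And>i. i \<in> S \<Longrightarrow> f i \<in> R (g i)) \<Longrightarrow> finite S \<Longrightarrow> (\<Prod>i\<in>S. f i) \<in> R (\<Sum>i\<in>S. g i)"
  by (induction S rule: infinite_finite_induct) (auto simp: one_in_component component_mult)

lemma power_product_in_component:
  assumes "\<And>i. i < d \<Longrightarrow> \<theta> i \<in> R (int (e i))" "u \<in> expvecs d"
  shows "power_product \<theta> u \<in> R (int (wdeg e u))"
proof -
  have "(\<Prod>i\<in>keys u. \<theta> i ^ lookup u i)
    \<in> R (\<Sum>i\<in>keys u. int (lookup u i) * int (e i))"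
    by (intro prod_in_component power_in_component) (use assms in \<open>auto simp: expvecs_def\<close>)
  then show ?thesis by (simp add: power_product_def wdeg_def mult.commute)
qed

text \<open>Grouping the summands by degree and subtracting \<open>r\<close> in degree
  \<open>n\<close> yields homogeneous elements with sum zero, and directness makes each of them
  vanish.\<close>

lemma homogeneous_part:
  assumes "finite T" "\<And>t. t \<in> T \<Longrightarrow> g t \<in> R (dg t)" "r = (\<Sum>t\<in>T. g t)" "r \<in> R n"
  shows "r = (\<Sum>t | t \<in> T \<and> dg t = n. g t)"
proof -
  \<comment> \<open>The degree \<open>n\<close> is inserted because possibly no summand has it, in
    which case \<open>r\<close> turns out to be zero.\<close>
  define S where "S = insert n (dg ` T)"
  define h where "h m = (\<Sum>t | t \<in> T \<and> dg t = m. g t) - (if m = n then r else 0)" for m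
  have "h m \<in> R m" if "m \<in> S" for m
    unfolding h_def using assms(2,4)
    by (intro subspace_diff component_subspace subspace_sum) (auto intro: subspace_0 component_subspace)
  moreover have "(\<Sum>m\<in>S. h m) = 0"
  proof -
    have "(\<Sum>m\<in>S. \<Sum>t | t \<in> T \<and> dg t = m. g t) = (\<Sum>t\<in>T. g t)"
      by (rule sum.group) (use assms(1) in \<open>auto simp: S_def\<close>)
    then show ?thesis
      using assms(1,3) by (simp add: h_def sum_subtractf sum.delta S_def)
  qed
  ultimately have "h n = 0"
    using component_direct[of S h n] assms(1) by (simp add: S_def)
  then show ?thesis by (simp add: h_def)
qed

end

section \<open>The subalgebra generated by homogeneous parameters\<close>

locale parametrized_algebra = graded_algebra scale R
  for scale :: "'k::field \<Rightarrow> 'r::comm_ring_1 \<Rightarrow> 'r" and R +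
  fixes d :: nat and e :: "nat \<Rightarrow> nat" and \<theta> :: "nat \<Rightarrow> 'r"
  assumes e_pos: "i < d \<Longrightarrow> 0 < e i"
    and theta_component: "i < d \<Longrightarrow> \<theta> i \<in> R (int (e i))"
begin

abbreviation A where "A \<equiv> subalgebra_gen scale d \<theta>"
abbreviation pp where "pp \<equiv> power_product \<theta>"
abbreviation comb where "comb V a \<equiv> \<Sum>u\<in>V. scale (a u) (pp u)"

lemma poly_eval_alt: "poly_eval scale \<theta> p = (\<Sum>u\<in>keys p. scale (lookup p u) (pp u))"
  by (simp add: poly_eval_def power_product_def)

lemma poly_eval_superset:
  assumes "finite V" "keys p \<subseteq> V"
  shows "poly_eval scale \<theta> p = (\<Sum>u\<in>V. scale (lookup p u) (pp u))"
  unfolding poly_eval_alt using assms by (intro sum.mono_neutral_left) (auto simp: in_keys_iff)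

lemma poly_eval_sum_single:
  assumes "finite V"
  shows "poly_eval scale \<theta> (\<Sum>u\<in>V. single u (a u)) = comb V a"
proof -
  let ?p = "\<Sum>u\<in>V. single u (a u)"
  have "keys ?p \<subseteq> V"
    using assms by (auto simp: in_keys_iff lookup_sum_single split: if_splits)
  then have "poly_eval scale \<theta> ?p = (\<Sum>u\<in>V. scale (lookup ?p u) (pp u))"
    using assms by (rule poly_eval_superset[rotated])
  then show ?thesis using assms by (simp add: lookup_sum_single)
qed

lemma sum_single_in_polys_in:
  "finite V \<Longrightarrow> V \<subseteq> expvecs d \<Longrightarrow> (\<Sum>u\<in>V. single u (a u)) \<in> polys_in d"
  unfolding polys_in_def expvecs_def
  by (auto simp: in_keys_iff lookup_sum_single split: if_splits)

text \<open>In this form closure of \<open>A\<close> under linear operations is inherited from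
  spans, and closure under products can be checked on monomials.\<close>

lemma A_eq_span: "A = span (pp ` expvecs d)"
proof (intro equalityI subsetI)
  fix x assume "x \<in> A"
  then obtain p where p: "p \<in> polys_in d" "x = poly_eval scale \<theta> p"
    by (auto simp: subalgebra_gen_def)
  show "x \<in> span (pp ` expvecs d)"
    unfolding p(2) poly_eval_alt using p(1)
    by (intro span_sum span_scale span_base) (auto simp: polys_in_def expvecs_def)
next
  fix x assume "x \<in> span (pp ` expvecs d)"
  then obtain V a where V: "finite V" "V \<subseteq> pp ` expvecs d" "x = (\<Sum>v\<in>V. scale (a v) v)"
    unfolding span_explicit by blast
  from V(1,2) obtain W where W: "W \<subseteq> expvecs d" "finite W" "V = pp ` W" "inj_on pp W"
    by (metis subset_image_inj finite_image_iff)
  have "x = (\<Sum>u\<in>W. scale (a (pp u)) (pp u))"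
    using V(3) W by (simp add: sum.reindex)
  with W show "x \<in> A"
    unfolding subalgebra_gen_def
    by (intro image_eqI[of _ _ "\<Sum>u\<in>W. single u (a (pp u))"])
       (auto simp: poly_eval_sum_single sum_single_in_polys_in)
qed

lemma A_subspace: "subspace A"
  unfolding A_eq_span by (rule subspace_span)

lemma pp_in_A: "u \<in> expvecs d \<Longrightarrow> pp u \<in> A"
  unfolding A_eq_span by (intro span_base) auto

lemma scalar_in_A: "scale c 1 \<in> A"
  using subspace_scale[OF A_subspace pp_in_A[of 0]] by simp

lemma A_mult: "x \<in> A \<Longrightarrow> y \<in> A \<Longrightarrow> x * y \<in> A"
proof -
  assume x: "x \<in> A" and y: "y \<in> A"
  have 1: "pp u * y \<in> A" if u: "u \<in> expvecs d" for u
    using y unfolding A_eq_span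
  proof (induction rule: span_induct)
    case base
    show ?case by (auto simp: subspace_def distrib_left span_add mult_scale span_scale span_zero)
  next
    case (step y)
    then show ?case using u
      by (auto simp flip: power_product_add intro!: span_base expvecs_add)
  qed
  show "x * y \<in> A"
    using x 1 unfolding A_eq_span
  proof (induction rule: span_induct)
    case base
    show ?case by (auto simp: subspace_def distrib_right span_add scale_mult span_scale span_zero)
  next
    case (step x)
    then show ?case by auto
  qed
qed

text \<open>One finite set \<open>V\<close> of exponent vectors serves all coefficients at once, so
  that double sums over \<open>B\<close> and \<open>V\<close> can be interchanged.\<close>

lemma A_expand:
  assumes finite_B: "finite B" and c: "\<And>b. b \<in> B \<Longrightarrow> c b \<in> A"
  obtains V a where "finite V" "V \<subseteq> expvecs d" "\<And>b. b \<in> B \<Longrightarrow> c b = comb V (a b)"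
proof -
  have "\<forall>b\<in>B. \<exists>p\<in>polys_in d. c b = poly_eval scale \<theta> p"
    using c by (auto simp: subalgebra_gen_def)
  then obtain p where p: "\<And>b. b \<in> B \<Longrightarrow> p b \<in> polys_in d" "\<And>b. b \<in> B \<Longrightarrow> c b = poly_eval scale \<theta> (p b)"
    by metis
  let ?V = "\<Union>b\<in>B. keys (p b)"
  have "c b = (\<Sum>u\<in>?V. scale (lookup (p b) u) (pp u))" if "b \<in> B" for b
    unfolding p(2)[OF that] poly_eval_alt
    using finite_B that by (intro sum.mono_neutral_left) (auto simp: in_keys_iff)
  moreover have "?V \<subseteq> expvecs d" using p(1) by (auto simp: polys_in_def expvecs_def)
  ultimately show thesis using finite_B by (intro that[of ?V]) auto
qed

end

section \<open>Coordinates with respect to a basis over a Noether normalization\<close>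

locale normalized_algebra = parametrized_algebra scale R d e \<theta>
  for scale :: "'k::field \<Rightarrow> 'r::comm_ring_1 \<Rightarrow> 'r" and R d e \<theta> +
  fixes B :: "'r set" and deg :: "'r \<Rightarrow> int"
  assumes alg_indep: "algebraically_independent scale d \<theta>"
    and finite_B: "finite B"
    and deg_B: "b \<in> B \<Longrightarrow> b \<in> R (deg b)"
    and free: "\<exists>!c. c \<in> B \<rightarrow>\<^sub>E subalgebra_gen scale d \<theta> \<and> r = (\<Sum>b\<in>B. c b * b)"
begin

definition coord :: "'r \<Rightarrow> 'r \<Rightarrow> 'r" where
  "coord r = (THE c. c \<in> B \<rightarrow>\<^sub>E A \<and> r = (\<Sum>b\<in>B. c b * b))"

lemma coord: "coord r \<in> B \<rightarrow>\<^sub>E A" "r = (\<Sum>b\<in>B. coord r b * b)"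
  using theI'[OF free[of r]] unfolding coord_def by blast+

lemma coord_in_A: "b \<in> B \<Longrightarrow> coord r b \<in> A"
  using coord(1)[of r] by auto

lemma coord_unique:
  assumes "\<And>b. b \<in> B \<Longrightarrow> c b \<in> A" "r = (\<Sum>b\<in>B. c b * b)" "b \<in> B"
  shows "coord r b = c b"
proof -
  have "restrict c B \<in> B \<rightarrow>\<^sub>E A \<and> r = (\<Sum>b\<in>B. restrict c B b * b)"
    using assms by (auto intro!: sum.cong)
  then have "restrict c B = coord r"
    using free[of r] coord[of r] by blast
  then show ?thesis using assms(3) by (metis restrict_apply)
qed

lemma coord_basis: "b \<in> B \<Longrightarrow> b' \<in> B \<Longrightarrow> coord b b' = (if b' = b then 1 else 0)"
proof (rule coord_unique)
  assume "b \<in> B"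
  then show "b = (\<Sum>b'\<in>B. (if b' = b then 1 else 0) * b')"
    using finite_B by (simp add: if_distrib[of "\<lambda>x. x * _"] cong: if_cong)
  show "(if x = b then 1 else 0) \<in> A" for x
    using scalar_in_A[of 1] subspace_0[OF A_subspace] by auto
qed

lemma coord_add: "b \<in> B \<Longrightarrow> coord (x + y) b = coord x b + coord y b"
  by (rule coord_unique)
     (use coord(2)[of x] coord(2)[of y] in \<open>auto simp: distrib_right sum.distrib coord_in_A subspace_add[OF A_subspace]\<close>)

lemma coord_mult: "a \<in> A \<Longrightarrow> b \<in> B \<Longrightarrow> coord (a * x) b = a * coord x b"
  by (rule coord_unique)
     (use coord(2)[of x] in \<open>auto simp: mult.assoc coord_in_A A_mult simp flip: sum_distrib_left\<close>)

lemma B_nonzero: "b \<in> B \<Longrightarrow> b \<noteq> 0"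
proof
  assume b: "b \<in> B" "b = 0"
  have "coord 0 b = 0" by (rule coord_unique) (use b subspace_0[OF A_subspace] in auto)
  with coord_basis[OF b(1) b(1)] b(2) show False by simp
qed

lemma deg_nonneg: "b \<in> B \<Longrightarrow> 0 \<le> deg b"
  using B_nonzero deg_B component_neg by (metis not_le singletonD)

lemma B_nonempty: "B \<noteq> {}"
  using coord(2)[of 1] by auto

text \<open>A relation is grouped by basis elements. Freeness over \<open>A\<close> makes the
  coefficient of each basis element vanish in the ring, and algebraic independence then makes its
  scalars vanish.\<close>

lemma independent_monomials: "independent_family (\<lambda>(u, b). pp u * b) (expvecs d \<times> B)"
  unfolding independent_family_def
proof (intro allI impI ballI)
  fix F c t
  assume F: "finite F" "F \<subseteq> expvecs d \<times> B"
    and 0: "(\<Sum>i\<in>F. scale (c i) (case i of (u, b) \<Rightarrow> pp u * b)) = 0" and t: "t \<in> F"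
  define V where "V = fst ` F"
  \<comment> \<open>Extending the coefficients by zero from \<open>F\<close> to a full rectangle
    allows the sum to be grouped by \<open>b\<close>.\<close>
  define a where "a b u = (if (u, b) \<in> F then c (u, b) else 0)" for b u
  have V: "finite V" "V \<subseteq> expvecs d" using F by (auto simp: V_def)
  have "(\<Sum>i\<in>F. scale (c i) (case i of (u, b) \<Rightarrow> pp u * b))
      = (\<Sum>i\<in>V \<times> B. case i of (u, b) \<Rightarrow> scale (a b u) (pp u * b))"
    by (rule sum.mono_neutral_cong_left)
       (use F V finite_B in \<open>auto simp: a_def V_def intro: rev_image_eqI split: if_splits\<close>)
  also have "\<dots> = (\<Sum>b\<in>B. comb V (a b) * b)"
    unfolding sum.cartesian_product[symmetric] by (subst sum.swap) (simp add: sum_distrib_right scale_mult)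
  finally have s0: "0 = (\<Sum>b\<in>B. comb V (a b) * b)" using 0 by simp
  obtain u b where ub: "t = (u, b)" by (cases t)
  then have b: "b \<in> B" and u: "u \<in> V" using t F by (auto simp: V_def intro: rev_image_eqI)
  have "coord 0 b = comb V (a b)"
    by (rule coord_unique[OF _ s0 b])
       (use V in \<open>auto intro!: subspace_sum[OF A_subspace] subspace_scale[OF A_subspace] pp_in_A\<close>)
  moreover have "coord 0 b = 0" by (rule coord_unique) (use b subspace_0[OF A_subspace] in auto)
  ultimately have "poly_eval scale \<theta> (\<Sum>u\<in>V. single u (a b u)) = poly_eval scale \<theta> 0"
    using V by (simp add: poly_eval_sum_single) (simp add: poly_eval_def)
  then have "(\<Sum>u\<in>V. single u (a b u)) = 0"
    using alg_indep sum_single_in_polys_in[OF V, of "a b"]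
    by (auto simp: algebraically_independent_def polys_in_def dest!: inj_onD)
  from arg_cong[OF this, of "\<lambda>p. lookup p u"] have "a b u = 0"
    using V u by (simp add: lookup_sum_single)
  then show "c t = 0" using t ub by (simp add: a_def)
qed

lemma component_expand:
  assumes "r \<in> R n"
  obtains V a where "finite V" "V \<subseteq> expvecs d"
    "r = (\<Sum>b\<in>B. comb {u \<in> V. int (wdeg e u) + deg b = n} (a b) * b)"
proof -
  obtain V a where V: "finite V" "V \<subseteq> expvecs d" and
    c: "\<And>b. b \<in> B \<Longrightarrow> coord r b = comb V (a b)"
    using A_expand[OF finite_B, of "coord r"] coord_in_A by blast
  let ?g = "\<lambda>(b, u). scale (a b u) (pp u) * b" and ?dg = "\<lambda>(b, u). int (wdeg e u) + deg b"
  have "r = (\<Sum>b\<in>B. comb V (a b) * b)"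
    using coord(2)[of r] c by simp
  also have "\<dots> = (\<Sum>t\<in>B \<times> V. ?g t)"
    by (simp add: sum_distrib_right sum.cartesian_product)
  finally have "r = (\<Sum>t | t \<in> B \<times> V \<and> ?dg t = n. ?g t)"
  proof (intro homogeneous_part[where dg = ?dg])
    fix t assume "t \<in> B \<times> V"
    then obtain b u where t: "t = (b, u)" "b \<in> B" "u \<in> V" by blast
    then have "pp u \<in> R (int (wdeg e u))"
      using V by (intro power_product_in_component[OF theta_component]) auto
    then show "?g t \<in> R (?dg t)"
      using t by (auto intro!: component_mult subspace_scale[OF component_subspace] deg_B)
  qed (use V finite_B assms in auto)
  also have "{t. t \<in> B \<times> V \<and> ?dg t = n} = (SIGMA b:B. {u. u \<in> V \<and> int (wdeg e u) + deg b = n})"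
    by auto
  also have "(\<Sum>t\<in>\<dots>. ?g t) = (\<Sum>b\<in>B. comb {u \<in> V. int (wdeg e u) + deg b = n} (a b) * b)"
    using V finite_B by (simp add: sum.Sigma[symmetric] sum_distrib_right)
  finally show thesis using V that by blast
qed

lemma coord_homogeneous:
  assumes "r \<in> R n" "b \<in> B"
  shows "coord r b \<in> R (n - deg b)"
proof -
  obtain V a where V: "finite V" "V \<subseteq> expvecs d" and
    r: "r = (\<Sum>b\<in>B. comb {u \<in> V. int (wdeg e u) + deg b = n} (a b) * b)"
    using component_expand[OF assms(1)] .
  have "coord r b = comb {u \<in> V. int (wdeg e u) + deg b = n} (a b)"
    by (rule coord_unique[OF _ r assms(2)])
       (use V in \<open>auto intro!: subspace_sum[OF A_subspace] subspace_scale[OF A_subspace] pp_in_A\<close>)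
  also have "\<dots> \<in> R (n - deg b)"
  proof (intro subspace_sum[OF component_subspace] subspace_scale[OF component_subspace])
    fix u assume "u \<in> {u. u \<in> V \<and> int (wdeg e u) + deg b = n}"
    then have "u \<in> expvecs d" "n - deg b = int (wdeg e u)" using V by auto
    with power_product_in_component[of d \<theta> e u] theta_component show "pp u \<in> R (n - deg b)" by simp
  qed
  finally show ?thesis .
qed

section \<open>The initial component of the canonical module\<close>

definition "topdeg = Max (deg ` B)"
definition "Btop = {b \<in> B. deg b = topdeg}"

lemma deg_le_topdeg: "b \<in> B \<Longrightarrow> deg b \<le> topdeg"
  unfolding topdeg_def using finite_B by simp

lemma Btop_nonempty: "Btop \<noteq> {}"
proof -
  have "topdeg \<in> deg ` B"
    unfolding topdeg_def using finite_B B_nonempty by (intro Max_in) auto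
  then show ?thesis by (auto simp: Btop_def)
qed

abbreviation "\<omega> \<equiv> canonical_component scale R d e \<theta>"
definition "weight_sum = int (\<Sum>j<d. e j)"

lemma canonical_component_iff:
  "\<phi> \<in> \<omega> i \<longleftrightarrow> (\<forall>x y. \<phi> (x + y) = \<phi> x + \<phi> y) \<and> (\<forall>a\<in>A. \<forall>x. \<phi> (a * x) = a * \<phi> x) \<and>
          (\<forall>n. \<forall>x\<in>R n. \<phi> x \<in> A \<and> \<phi> x \<in> R (n + i - weight_sum))"
  unfolding canonical_component_def weight_sum_def Let_def by (auto simp: image_subset_iff)

text \<open>The coordinates lie in \<open>A\<close>, so they can be pulled out of \<phi>; elements
  of the canonical module are thus determined by their values on \<open>B\<close>.\<close>

lemma canonical_component_expand:
  assumes "\<phi> \<in> \<omega> i"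
  shows "\<phi> r = (\<Sum>b\<in>B. coord r b * \<phi> b)"
proof -
  have add: "\<phi> (x + y) = \<phi> x + \<phi> y" for x y using assms by (simp add: canonical_component_iff)
  have mult: "\<phi> (a * x) = a * \<phi> x" if "a \<in> A" for a x using assms that by (simp add: canonical_component_iff)
  have "\<phi> 0 = 0" using add[of 0 0] by simp
  then have "\<phi> (\<Sum>b\<in>S. f b) = (\<Sum>b\<in>S. \<phi> (f b))" for S and f :: "'r \<Rightarrow> 'r"
    by (induction S rule: infinite_finite_induct) (auto simp: add)
  then have "\<phi> (\<Sum>b\<in>B. coord r b * b) = (\<Sum>b\<in>B. coord r b * \<phi> b)"
    by (simp add: mult coord_in_A)
  then show ?thesis by (simp add: coord(2)[symmetric])
qed

lemma zero_canonical: "(\<lambda>_. 0) \<in> \<omega> i"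
  by (simp add: canonical_component_iff subspace_0[OF A_subspace] subspace_0[OF component_subspace])

text \<open>Every basis element would be sent to a component of negative degree, which is
  zero.\<close>

lemma canonical_component_low:
  assumes "i < weight_sum - topdeg"
  shows "\<omega> i = {\<lambda>_. 0}"
proof -
  have "\<phi> = (\<lambda>_. 0)" if \<phi>: "\<phi> \<in> \<omega> i" for \<phi>
  proof
    fix r
    have "\<phi> b = 0" if "b \<in> B" for b
      using \<phi> deg_B[OF that] deg_le_topdeg[OF that] assms component_neg[of "deg b + i - weight_sum"]
      by (force simp: canonical_component_iff)
    then show "\<phi> r = 0" by (subst canonical_component_expand[OF \<phi>]) simp
  qed
  then show ?thesis using zero_canonical by blast
qed

lemma coord_in_canonical:
  assumes "b \<in> Btop"
  shows "(\<lambda>r. coord r b) \<in> \<omega> (weight_sum - topdeg)"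
  using assms coord_homogeneous[of _ _ b]
  by (auto simp: canonical_component_iff Btop_def coord_add coord_mult coord_in_A)

lemma vector_space_fun: "vector_space (\<lambda>c (\<phi> :: 'r \<Rightarrow> 'r) x. scale c (\<phi> x))"
  by unfold_locales (auto simp: fun_eq_iff scale_right_distrib scale_left_distrib)

text \<open>In this degree, basis elements below \<open>topdeg\<close> are still sent to zero, while
  those of degree \<open>topdeg\<close> go to \<open>R 0\<close>, that is, to scalars. Hence the
  coordinate functions belonging to \<open>Btop\<close> form a basis.\<close>

lemma canonical_component_dim:
  "vector_space.dim (\<lambda>c \<phi> x. scale c (\<phi> x)) (\<omega> (weight_sum - topdeg)) = card Btop"
proof -
  interpret F: linear_families "\<lambda>c (\<phi> :: 'r \<Rightarrow> 'r) x. scale c (\<phi> x)"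
    by (intro linear_families.intro vector_space_fun)
  have sumF: "(\<Sum>b\<in>S. f b) r = (\<Sum>b\<in>S. f b r)" for S :: "'r set" and f :: "'r \<Rightarrow> 'r \<Rightarrow> 'r" and r
    by (induction S rule: infinite_finite_induct) auto
  let ?f = "\<lambda>b r. coord r b"
  show ?thesis
  proof (rule F.dim_independent_family[of ?f])
    show "F.independent_family ?f Btop"
      unfolding F.independent_family_def
    proof (intro allI impI ballI)
      fix F c b
      assume F: "finite F" "F \<subseteq> Btop" "(\<Sum>i\<in>F. (\<lambda>x. scale (c i) (coord x i))) = 0" "b \<in> F"
      have "(\<Sum>i\<in>F. scale (c i) (coord b i)) = 0"
        using fun_cong[OF F(3), of b] by (simp add: sumF)
      also have "(\<Sum>i\<in>F. scale (c i) (coord b i)) = (\<Sum>i\<in>F. if i = b then scale (c i) 1 else 0)"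
        by (rule sum.cong) (use F in \<open>auto simp: coord_basis Btop_def subset_iff\<close>)
      finally show "c b = 0" using F by (simp add: sum.delta)
    qed
    show "finite Btop" using finite_B by (simp add: Btop_def)
    show "?f ` Btop \<subseteq> \<omega> (weight_sum - topdeg)" using coord_in_canonical by blast
    show "\<omega> (weight_sum - topdeg) \<subseteq> F.span (?f ` Btop)"
    proof
      fix \<phi> assume \<phi>: "\<phi> \<in> \<omega> (weight_sum - topdeg)"
      have val: "\<phi> b \<in> R (deg b - topdeg)" if "b \<in> B" for b
        using \<phi> deg_B[OF that] by (force simp: canonical_component_iff)
      have low: "\<phi> b = 0" if "b \<in> B - Btop" for b
        using val[of b] that deg_le_topdeg[of b] component_neg[of "deg b - topdeg"]
        by (auto simp: Btop_def)
      have "\<exists>c. \<phi> b = scale c 1" if "b \<in> Btop" for b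
        using val[of b] that component_zero by (auto simp: Btop_def)
      then obtain c where c: "\<And>b. b \<in> Btop \<Longrightarrow> \<phi> b = scale (c b) 1" by metis
      have "\<phi> = (\<Sum>b\<in>Btop. (\<lambda>x. scale (c b) (coord x b)))"
      proof
        fix r
        have "\<phi> r = (\<Sum>b\<in>B. coord r b * \<phi> b)" by (rule canonical_component_expand[OF \<phi>])
        also have "\<dots> = (\<Sum>b\<in>Btop. coord r b * \<phi> b)"
          by (rule sum.mono_neutral_right) (use finite_B low in \<open>auto simp: Btop_def\<close>)
        also have "\<dots> = (\<Sum>b\<in>Btop. scale (c b) (coord r b))"
          by (rule sum.cong) (auto simp: c mult_scale)
        finally show "\<phi> r = (\<Sum>b\<in>Btop. (\<lambda>x. scale (c b) (coord x b))) r" by (simp add: sumF)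
      qed
      also have "\<dots> \<in> F.span (?f ` Btop)"
        by (intro F.span_sum F.span_scale) (auto intro: F.span_base)
      finally show "\<phi> \<in> F.span (?f ` Btop)" .
    qed
  qed
qed

lemma canonical_component_top: "\<omega> (weight_sum - topdeg) \<noteq> {\<lambda>_. 0}"
proof -
  obtain b where b: "b \<in> Btop" using Btop_nonempty by blast
  then have "coord b b = 1" using coord_basis by (simp add: Btop_def)
  then have "(\<lambda>r. coord r b) \<noteq> (\<lambda>_. 0)" by (metis zero_neq_one)
  then show ?thesis using coord_in_canonical[OF b] by blast
qed

text \<open>The first two conditions force \<open>a\<close> to be
  \<open>weight_sum - topdeg\<close>, since the canonical module vanishes below this degree and not
  in it.\<close>

lemma initial_degree_dim_iff:
  "(\<exists>a. \<omega> a \<noteq> {\<lambda>_. 0} \<and> (\<forall>i<a. \<omega> i = {\<lambda>_. 0}) \<and>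
        vector_space.dim (\<lambda>c \<phi> x. scale c (\<phi> x)) (\<omega> a) = 1) \<longleftrightarrow> card Btop = 1"
proof -
  have "a = weight_sum - topdeg" if "\<omega> a \<noteq> {\<lambda>_. 0}" "\<forall>i<a. \<omega> i = {\<lambda>_. 0}" for a
    using that canonical_component_low[of a] canonical_component_top by (meson linorder_neqE)
  then show ?thesis
    using canonical_component_dim canonical_component_top canonical_component_low by metis
qed

section \<open>The Hilbert series and independence of the normalization\<close>

definition numerator :: "int poly" where
  "numerator = (\<Sum>b\<in>B. monom 1 (nat (deg b)))"

lemma lead_coeff_numerator: "lead_coeff numerator = int (card Btop)"
proof -
  have coeff: "coeff numerator n = int (card {b \<in> B. nat (deg b) = n})" for n
  proof -
    have "coeff numerator n = (\<Sum>b\<in>B. if nat (deg b) = n then 1 else 0)"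
      by (simp add: numerator_def coeff_sum coeff_monom)
    then show ?thesis using finite_B by (simp add: sum.If_cases Int_def)
  qed
  have top: "{b \<in> B. nat (deg b) = nat topdeg} = Btop"
  proof -
    have "0 \<le> topdeg" using B_nonempty deg_nonneg deg_le_topdeg by force
    then show ?thesis using deg_nonneg by (auto simp: Btop_def dest: eq_nat_nat_iff[THEN iffD1, rotated -1])
  qed
  have fin: "finite Btop" using finite_B by (simp add: Btop_def)
  have "degree numerator = nat topdeg"
  proof (rule antisym)
    show "degree numerator \<le> nat topdeg"
    proof (rule degree_le, intro allI impI)
      fix n assume "nat topdeg < n"
      then have "{b \<in> B. nat (deg b) = n} = {}" using deg_le_topdeg by force
      then show "coeff numerator n = 0" by (simp add: coeff del: Collect_empty_eq)
    qed
    have "coeff numerator (nat topdeg) \<noteq> 0"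
      using Btop_nonempty fin by (simp add: coeff top)
    then show "nat topdeg \<le> degree numerator" by (rule le_degree)
  qed
  then show ?thesis by (simp add: coeff top)
qed

text \<open>The products \<open>pp u * b\<close> of total degree \<open>n\<close> form a basis of
  the component; counting them is a convolution of the generating functions of the two
  factors.\<close>

lemma component_dim:
  "int (dim (R (int n))) = fps_nth (expvec_fps d e * fps_of_poly numerator) n"
proof -
  define I where "I = (SIGMA b:B. {u \<in> expvecs d. int (wdeg e u) + deg b = int n})"
  define f where "f = (\<lambda>(b, u). pp u * b)"
  have fin: "finite {u \<in> expvecs d. int (wdeg e u) + deg b = int n}" for b
    by (rule finite_subset[OF _ finite_expvecs_wdeg[of d e "nat (int n - deg b)"]]) (auto simp: e_pos)
  have finI: "finite I" unfolding I_def using finite_B fin by (intro finite_SigmaI)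
  have "dim (R (int n)) = card I"
  proof (rule dim_independent_family[of f])
    show "independent_family f I"
      unfolding independent_family_def
    proof (intro allI impI ballI)
      fix F c t
      assume F: "finite F" "F \<subseteq> I" "(\<Sum>i\<in>F. scale (c i) (f i)) = 0" "t \<in> F"
      \<comment> \<open>\<open>I\<close> lists the basis element first and
        \<open>independent_monomials\<close> lists it second.\<close>
      have "(\<Sum>i\<in>prod.swap ` F. scale (c (prod.swap i)) ((\<lambda>(u, b). pp u * b) i)) = (\<Sum>i\<in>F. scale (c i) (f i))"
        by (subst sum.reindex) (auto simp: f_def intro!: sum.cong)
      with F have "c (prod.swap (prod.swap t)) = 0"
        by (intro independent_familyD[OF independent_monomials, of "prod.swap ` F" "\<lambda>i. c (prod.swap i)"])
           (auto simp: I_def)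
      then show "c t = 0" by simp
    qed
    show "f ` I \<subseteq> R (int n)"
      using component_mult[OF power_product_in_component[of d \<theta> e] deg_B] theta_component
      by (force simp: f_def I_def)
    show "R (int n) \<subseteq> span (f ` I)"
    proof
      fix r assume "r \<in> R (int n)"
      then obtain V a where V: "finite V" "V \<subseteq> expvecs d" and
        r: "r = (\<Sum>b\<in>B. comb {u \<in> V. int (wdeg e u) + deg b = n} (a b) * b)"
        by (rule component_expand)
      have "f (b, u) \<in> f ` I" if "b \<in> B" "u \<in> V" "int (wdeg e u) + deg b = n" for b u
        using that V by (auto simp: I_def)
      then show "r \<in> span (f ` I)"
        unfolding r sum_distrib_right scale_mult f_def
        by (intro span_sum span_scale) (auto intro: span_base)
    qed
  qed fact
  also have "int (card I) = (\<Sum>b\<in>B. int (card {u \<in> expvecs d. int (wdeg e u) + deg b = int n}))"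
    unfolding I_def using finite_B fin by simp
  also have "\<dots> = (\<Sum>b\<in>B. fps_nth (expvec_fps d e * fps_of_poly (monom 1 (nat (deg b)))) n)"
  proof (rule sum.cong[OF refl])
    fix b assume b: "b \<in> B"
    have "{u \<in> expvecs d. int (wdeg e u) + deg b = int n} =
        (if nat (deg b) \<le> n then {u \<in> expvecs d. wdeg e u = n - nat (deg b)} else {})"
      using deg_nonneg[OF b] by auto
    then show "int (card {u \<in> expvecs d. int (wdeg e u) + deg b = int n})
      = fps_nth (expvec_fps d e * fps_of_poly (monom 1 (nat (deg b)))) n"
      by (auto simp: fps_of_poly_monom fps_X_power_mult_right_nth expvec_fps_def)
  qed
  also have "\<dots> = fps_nth (expvec_fps d e * fps_of_poly numerator) n"
    by (simp add: numerator_def fps_of_poly_sum sum_distrib_left fps_sum_nth)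
  finally show ?thesis .
qed

definition denominator :: "int poly" where
  "denominator = (\<Prod>i<d. 1 - monom 1 (e i))"

text \<open>Each factor has leading coefficient \<open>-1\<close> because \<open>e i\<close> is
  positive, so only the sign depends on the number of parameters.\<close>

lemma abs_lead_coeff_denominator: "\<bar>lead_coeff denominator\<bar> = 1"
proof -
  have "lead_coeff (1 - monom 1 (e i) :: int poly) = -1" if "i < d" for i
  proof -
    have "degree (1 - monom 1 (e i) :: int poly) = e i"
      using e_pos[OF that]
      by (subst diff_conv_add_uminus, subst degree_add_eq_right) (auto simp: degree_monom_eq)
    then show ?thesis using e_pos[OF that] by simp
  qed
  then show ?thesis by (simp add: denominator_def lead_coeff_prod abs_prod del: of_nat_prod)
qed

lemma hilbert_series:
  "Abs_fps (\<lambda>n. int (dim (R (int n)))) * fps_of_poly denominator = fps_of_poly numerator"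
proof -
  have "Abs_fps (\<lambda>n. int (dim (R (int n)))) = expvec_fps d e * fps_of_poly numerator"
    by (rule fps_ext) (simp add: component_dim)
  moreover have "fps_of_poly denominator = (\<Prod>i<d. 1 - fps_X ^ e i)"
    by (simp add: denominator_def fps_of_poly_prod fps_of_poly_diff fps_of_poly_monom)
  ultimately show ?thesis
    using expvec_fps_prod[of d e] e_pos by (simp add: mult_ac)
qed

end

text \<open>Both numerators and denominators describe the same Hilbert series, so the fractions can
  be cross-multiplied as polynomials. The leading coefficients of the denominators are units, and
  absolute values remove their signs.\<close>

lemma card_Btop_independent:
  assumes "normalized_algebra scale R d e \<theta> B deg" "normalized_algebra scale R d' e' \<theta>' B' deg'"
  shows "card (normalized_algebra.Btop B deg) = card (normalized_algebra.Btop B' deg')"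
proof -
  interpret X: normalized_algebra scale R d e \<theta> B deg by fact
  interpret Y: normalized_algebra scale R d' e' \<theta>' B' deg' by fact
  have "fps_of_poly (X.numerator * Y.denominator) = fps_of_poly (Y.numerator * X.denominator)"
    by (simp add: fps_of_poly_mult mult_ac flip: X.hilbert_series Y.hilbert_series)
  then have "X.numerator * Y.denominator = Y.numerator * X.denominator" by simp
  then have "\<bar>lead_coeff X.numerator\<bar> * \<bar>lead_coeff Y.denominator\<bar> =
      \<bar>lead_coeff Y.numerator\<bar> * \<bar>lead_coeff X.denominator\<bar>"
    by (metis lead_coeff_mult abs_mult)
  then show ?thesis
    by (simp add: X.lead_coeff_numerator Y.lead_coeff_numerator
        X.abs_lead_coeff_denominator Y.abs_lead_coeff_denominator)
qed

text \<open>The definition only provides some normalization, with a basis of homogeneous elements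
  whose degrees have to be chosen; its number of top elements is then compared with
  \<open>card Btop\<close>.\<close>

lemma (in normalized_algebra) pseudo_Gorenstein_iff:
  "pseudo_Gorenstein scale R \<longleftrightarrow> card Btop = 1"
proof
  assume "pseudo_Gorenstein scale R"
  then obtain d' e' \<theta>' where CM: "CM_normalization scale R d' e' \<theta>'" and
    w: "\<exists>a. canonical_component scale R d' e' \<theta>' a \<noteq> {\<lambda>_. 0} \<and>
      (\<forall>i<a. canonical_component scale R d' e' \<theta>' i = {\<lambda>_. 0}) \<and>
      vector_space.dim (\<lambda>c \<phi> x. scale c (\<phi> x)) (canonical_component scale R d' e' \<theta>' a) = 1"
    unfolding pseudo_Gorenstein_def Let_def by blast
  from CM obtain B' where B': "finite B'" "\<forall>b\<in>B'. \<exists>n. b \<in> R n"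
    "\<forall>r. \<exists>!c. c \<in> B' \<rightarrow>\<^sub>E subalgebra_gen scale d' \<theta>' \<and> r = (\<Sum>b\<in>B'. c b * b)"
    unfolding CM_normalization_def graded_finite_free_def by blast
  from B'(2) obtain deg' where deg': "\<forall>b\<in>B'. b \<in> R (deg' b)" by metis
  note CM = CM[unfolded CM_normalization_def]
  have N: "normalized_algebra scale R d' e' \<theta>' B' deg'"
  proof unfold_locales
    show "\<exists>!c. c \<in> B' \<rightarrow>\<^sub>E subalgebra_gen scale d' \<theta>' \<and> r = (\<Sum>b\<in>B'. c b * b)" for r
      using B'(3) by (rule spec)
  qed (use CM B'(1) deg' in simp_all)
  interpret Y: normalized_algebra scale R d' e' \<theta>' B' deg' by (rule N)
  have "card Y.Btop = 1" using w Y.initial_degree_dim_iff by simp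
  then show "card Btop = 1"
    using card_Btop_independent[OF normalized_algebra_axioms N] by simp
next
  assume "card Btop = 1"
  moreover have "CM_normalization scale R d e \<theta>"
    unfolding CM_normalization_def graded_finite_free_def
    by (intro conjI exI[of _ B] allI impI ballI free)
       (use e_pos theta_component alg_indep finite_B deg_B in auto)
  ultimately show "pseudo_Gorenstein scale R"
    unfolding pseudo_Gorenstein_def Let_def using initial_degree_dim_iff by blast
qed

text \<open>Builds a normalization from linear algebra over the field alone: one basis consisting of
  products of monomials with elements of \<open>B\<close> gives algebraic independence as well as
  freeness over \<open>A\<close>.\<close>

lemma (in parametrized_algebra) normalized_algebraI:
  assumes fin: "finite B" and degB: "\<And>b. b \<in> B \<Longrightarrow> b \<in> R (deg b)"
    and indep: "independent_family (\<lambda>(u, b). pp u * b) (expvecs d \<times> B)"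
    and spn: "span ((\<lambda>(u, b). pp u * b) ` (expvecs d \<times> B)) = UNIV"
  shows "normalized_algebra scale R d e \<theta> B deg"
proof
  have zero: "a b u = 0"
    if "finite V" "V \<subseteq> expvecs d" "(\<Sum>b\<in>B. comb V (a b) * b) = 0" "b \<in> B" "u \<in> V" for V a b u
  proof -
    have "(\<Sum>i\<in>V \<times> B. scale ((\<lambda>(u, b). a b u) i) (case i of (u, b) \<Rightarrow> pp u * b))
        = (\<Sum>u\<in>V. \<Sum>b\<in>B. scale (a b u) (pp u * b))"
      by (simp add: sum.cartesian_product split_def)
    also have "\<dots> = 0"
      using that(3) by (subst sum.swap) (simp add: sum_distrib_right scale_mult)
    finally have "(\<lambda>(u, b). a b u) (u, b) = 0"
      using that fin by (intro independent_familyD[OF indep]) auto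
    then show ?thesis by simp
  qed
  have "B \<noteq> {}"
  proof
    assume "B = {}"
    then have "(1 :: 'r) \<in> span {}" using spn by simp
    then show False by simp
  qed
  then obtain b0 where b0: "b0 \<in> B" by blast
  show "algebraically_independent scale d \<theta>"
    unfolding algebraically_independent_def
  proof (rule inj_onI)
    fix p q assume pq: "p \<in> polys_in d" "q \<in> polys_in d" "poly_eval scale \<theta> p = poly_eval scale \<theta> q"
    define V where "V = keys p \<union> keys q"
    have V: "finite V" "V \<subseteq> expvecs d" using pq(1,2) by (auto simp: V_def polys_in_def expvecs_def)
    \<comment> \<open>Placing the difference of \<open>p\<close> and \<open>q\<close> on the single
      basis element \<open>b0\<close> turns a polynomial relation between the parameters into a
      linear relation between products.\<close>
    define a where "a b u = (if b = b0 then lookup p u - lookup q u else 0)" for b u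
    have "comb V (a b) = 0" for b
    proof (cases "b = b0")
      case True
      then have "comb V (a b) = poly_eval scale \<theta> p - poly_eval scale \<theta> q"
        using V by (simp add: a_def scale_left_diff_distrib sum_subtractf poly_eval_superset[of V] V_def)
      then show ?thesis using pq(3) by simp
    qed (simp add: a_def)
    then have "a b0 u = 0" if "u \<in> V" for u using zero[OF V, of a b0 u] that b0 by simp
    then have "lookup p u = lookup q u" if "u \<in> V" for u
      using that by (simp add: a_def)
    moreover have "lookup p u = lookup q u" if "u \<notin> V" for u
      using that by (simp add: V_def in_keys_iff)
    ultimately show "p = q" by (intro poly_mapping_eqI) blast
  qed
  fix r
  have "r \<in> span ((\<lambda>(u, b). pp u * b) ` (expvecs d \<times> B))" using spn by simp
  then have ex: "\<exists>c. (\<forall>b\<in>B. c b \<in> A) \<and> r = (\<Sum>b\<in>B. c b * b)"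
  proof (induction rule: span_induct_alt)
    case base
    show ?case by (auto intro!: exI[of _ "\<lambda>_. 0"] subspace_0[OF A_subspace])
  next
    case (step k x y)
    then obtain u b' c where x: "x = pp u * b'" "u \<in> expvecs d" "b' \<in> B"
      and y: "\<forall>b\<in>B. c b \<in> A" "y = (\<Sum>b\<in>B. c b * b)" by auto
    let ?g = "\<lambda>b. if b = b' then scale k (pp u) else 0"
    have "(\<Sum>b\<in>B. ?g b * b) = (\<Sum>b\<in>B. if b = b' then scale k (pp u * b) else 0)"
      by (rule sum.cong) (auto simp: scale_mult)
    also have "\<dots> = scale k x" using fin x by (simp add: sum.delta)
    finally have "scale k x + y = (\<Sum>b\<in>B. (?g b + c b) * b)"
      using y(2) by (simp only: distrib_right sum.distrib)
    moreover have "?g b + c b \<in> A" if "b \<in> B" for b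
      using that x(2) y(1)
      by (auto intro!: subspace_add[OF A_subspace] subspace_scale[OF A_subspace] pp_in_A)
    ultimately show ?case by (intro exI[of _ "\<lambda>b. ?g b + c b"]) blast
  qed
  show "\<exists>!c. c \<in> B \<rightarrow>\<^sub>E A \<and> r = (\<Sum>b\<in>B. c b * b)"
  proof (rule ex_ex1I)
    from ex obtain c where c: "\<forall>b\<in>B. c b \<in> A" "r = (\<Sum>b\<in>B. c b * b)" by blast
    then have "restrict c B \<in> B \<rightarrow>\<^sub>E A \<and> r = (\<Sum>b\<in>B. restrict c B b * b)" by auto
    then show "\<exists>c. c \<in> B \<rightarrow>\<^sub>E A \<and> r = (\<Sum>b\<in>B. c b * b)" by blast
  next
    fix c c' assume c: "c \<in> B \<rightarrow>\<^sub>E A \<and> r = (\<Sum>b\<in>B. c b * b)" "c' \<in> B \<rightarrow>\<^sub>E A \<and> r = (\<Sum>b\<in>B. c' b * b)"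
    have "c b - c' b \<in> A" if "b \<in> B" for b
      using c that by (intro subspace_diff[OF A_subspace]) auto
    then obtain V a where V: "finite V" "V \<subseteq> expvecs d"
      "\<And>b. b \<in> B \<Longrightarrow> c b - c' b = comb V (a b)"
      using A_expand[OF fin, of "\<lambda>b. c b - c' b"] by blast
    have "(\<Sum>b\<in>B. comb V (a b) * b) = (\<Sum>b\<in>B. (c b - c' b) * b)"
      by (rule sum.cong) (simp_all add: V(3))
    also have "\<dots> = 0" using c by (simp add: left_diff_distrib sum_subtractf)
    finally have "a b u = 0" if "b \<in> B" "u \<in> V" for b u using zero[OF V(1,2)] that by blast
    then have "c b = c' b" if "b \<in> B" for b using V(3)[OF that] that by simp
    then show "c = c'" using c by (intro PiE_ext[of c B "\<lambda>_. A" c']) auto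
  qed
qed (use fin degB in auto)

section \<open>The monomial basis of a Hibi ring\<close>

definition join_primes :: "'a::lattice set" where
  "join_primes = {p. \<forall>\<beta> \<gamma>. p = sup \<beta> \<gamma> \<longrightarrow> p = \<beta> \<or> p = \<gamma>}"

definition least_element :: "'a::{finite, lattice}" where
  "least_element = Inf_fin UNIV"

lemma least_element_le [simp]: "least_element \<le> (\<alpha> :: 'a::{finite, lattice})"
  unfolding least_element_def by (rule Inf_fin.coboundedI) auto

lemma join_primes_eq:
  "(join_primes :: 'a::{finite, lattice} set) = insert least_element join_irreducibles"
proof -
  have "\<exists>\<beta>. \<not> p \<le> \<beta>" if "p \<noteq> least_element" for p :: 'a
    using that least_element_le[of p] by (metis order_antisym)
  moreover have "least_element \<in> (join_primes :: 'a set)"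
  proof -
    have "\<beta> = least_element" if "least_element = sup \<beta> \<gamma>" for \<beta> \<gamma> :: 'a
      using sup_ge1[of \<beta> \<gamma>] that by (intro order_antisym least_element_le) simp
    then show ?thesis unfolding join_primes_def by blast
  qed
  ultimately have "p \<in> join_primes \<longleftrightarrow> p = least_element \<or> p \<in> join_irreducibles" for p :: 'a
    by (cases "p = least_element") (simp_all add: join_primes_def join_irreducibles_def join_irreducible_def)
  then show ?thesis by blast
qed

text \<open>Distributivity writes \<open>p\<close> as the join of its meets with \<beta> and
  \<gamma>, and irreducibility selects one of them.\<close>

lemma join_prime_le_sup:
  fixes p :: "'a::distrib_lattice"
  assumes "p \<in> join_primes"
  shows "p \<le> sup \<beta> \<gamma> \<longleftrightarrow> p \<le> \<beta> \<or> p \<le> \<gamma>"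
proof
  assume "p \<le> sup \<beta> \<gamma>"
  then have "p = sup (inf p \<beta>) (inf p \<gamma>)"
    by (metis inf.absorb1 inf_sup_distrib1)
  with assms have "p = inf p \<beta> \<or> p = inf p \<gamma>" unfolding join_primes_def by blast
  then show "p \<le> \<beta> \<or> p \<le> \<gamma>" by (metis inf.cobounded2)
qed (auto intro: le_supI1 le_supI2)

text \<open>An element outside \<open>join_primes\<close> is a join of two strictly smaller
  elements, to which induction on the size of the down-set applies.\<close>

lemma join_primes_dense:
  fixes \<alpha> \<beta> :: "'a::{finite, lattice}"
  assumes "\<And>p. p \<in> join_primes \<Longrightarrow> p \<le> \<alpha> \<Longrightarrow> p \<le> \<beta>"
  shows "\<alpha> \<le> \<beta>"
  using assms
proof (induction "card {..\<alpha>}" arbitrary: \<alpha> rule: less_induct)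
  case less
  show ?case
  proof (cases "\<alpha> \<in> join_primes")
    case False
    then obtain \<gamma> \<delta> where s: "\<alpha> = sup \<gamma> \<delta>" "\<alpha> \<noteq> \<gamma>" "\<alpha> \<noteq> \<delta>"
      unfolding join_primes_def by blast
    have *: "x \<le> \<beta>" if "x \<le> \<alpha>" "x \<noteq> \<alpha>" for x
    proof (rule less.hyps)
      have "{..x} \<subset> {..\<alpha>}" using that by auto
      then show "card {..x} < card {..\<alpha>}" by (intro psubset_card_mono) auto
    qed (use less.prems that in force)
    have "\<gamma> \<le> \<beta>" "\<delta> \<le> \<beta>" using s by (auto intro!: *)
    then show ?thesis using s by simp
  qed (use less.prems in auto)
qed

text \<open>The exponent vector of a monomial under Hibi's embedding
  \<open>\<alpha> \<mapsto> s * (\<Prod>p \<le> \<alpha>. t p)\<close>, with \<open>p\<close>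
  ranging over the join-irreducibles. The value at \<open>least_element\<close> is the exponent of
  \<open>s\<close>, that is, the degree. The default 0 lets weights be compared as
  functions.\<close>

definition hibi_weight :: "'a::lattice multiset \<Rightarrow> 'a \<Rightarrow> nat" where
  "hibi_weight Z p = (if p \<in> join_primes then size {#\<alpha> \<in># Z. p \<le> \<alpha>#} else 0)"

lemma hibi_weight_union: "hibi_weight (Z + W) = hibi_weight Z + hibi_weight W"
  by (simp add: fun_eq_iff hibi_weight_def)

lemma hibi_weight_add_mset: "hibi_weight (add_mset \<alpha> Z) = hibi_weight {#\<alpha>#} + hibi_weight Z"
  using hibi_weight_union[of "{#\<alpha>#}" Z] by simp

lemma hibi_weight_straighten:
  "hibi_weight {#\<alpha>, \<beta>#} = hibi_weight {#inf \<alpha> \<beta>, sup \<alpha> (\<beta> :: 'a::distrib_lattice)#}"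
  by (auto simp: fun_eq_iff hibi_weight_def join_prime_le_sup)

lemma hibi_weight_least [simp]: "hibi_weight Z (least_element :: 'a::{finite, lattice}) = size Z"
proof -
  have "{#\<alpha> \<in># Z. least_element \<le> \<alpha>#} = Z" by (rule filter_mset_eq_conv[THEN iffD2]) simp
  then show ?thesis unfolding hibi_weight_def by (simp only: join_primes_eq insertI1 if_True)
qed

lemma hibi_weight_pos_iff:
  "p \<in> join_primes \<Longrightarrow> 0 < hibi_weight Z p \<longleftrightarrow> (\<exists>\<alpha>\<in>#Z. p \<le> \<alpha>)"
  by (auto simp: hibi_weight_def nonempty_has_size[symmetric] filter_mset_eq_conv)

definition chain_mset :: "'a::order multiset \<Rightarrow> bool" where
  "chain_mset Z \<longleftrightarrow> (\<forall>\<alpha>\<in>#Z. \<forall>\<beta>\<in>#Z. \<alpha> \<le> \<beta> \<or> \<beta> \<le> \<alpha>)"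

lemma chain_mset_max:
  assumes "chain_mset Z" "Z \<noteq> {#}"
  obtains s where "s \<in># Z" "\<And>\<alpha>. \<alpha> \<in># Z \<Longrightarrow> \<alpha> \<le> s"
proof -
  obtain s where s: "s \<in># Z" "\<And>\<alpha>. \<alpha> \<in># Z \<Longrightarrow> s \<le> \<alpha> \<Longrightarrow> s = \<alpha>"
    using finite_has_maximal[of "set_mset Z"] assms(2) by auto
  then show thesis using assms(1) that unfolding chain_mset_def by blast
qed

text \<open>The largest entry of a chain is determined by the join-primes of positive weight.
  Removing it from both sides leaves smaller chains of equal weight.\<close>

lemma chain_mset_eqI:
  fixes Z W :: "'a::{finite, lattice} multiset"
  assumes "chain_mset Z" "chain_mset W" "hibi_weight Z = hibi_weight W"
  shows "Z = W"
  using assms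
proof (induction "size Z" arbitrary: Z W)
  case 0
  then show ?case by (metis hibi_weight_least size_eq_0_iff_empty)
next
  case (Suc n)
  have "size W = Suc n" using Suc by (metis hibi_weight_least)
  then have ne: "Z \<noteq> {#}" "W \<noteq> {#}" using Suc(2) by auto
  obtain s where s: "s \<in># Z" "\<And>\<alpha>. \<alpha> \<in># Z \<Longrightarrow> \<alpha> \<le> s"
    using chain_mset_max[OF Suc.prems(1) ne(1)] by blast
  obtain t where t: "t \<in># W" "\<And>\<alpha>. \<alpha> \<in># W \<Longrightarrow> \<alpha> \<le> t"
    using chain_mset_max[OF Suc.prems(2) ne(2)] by blast
  have "p \<le> s \<longleftrightarrow> p \<le> t" if "p \<in> join_primes" for p
  proof -
    have "p \<le> s \<longleftrightarrow> 0 < hibi_weight Z p"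
      unfolding hibi_weight_pos_iff[OF that] using s by (auto intro: order_trans)
    moreover have "p \<le> t \<longleftrightarrow> 0 < hibi_weight W p"
      unfolding hibi_weight_pos_iff[OF that] using t by (auto intro: order_trans)
    ultimately show ?thesis using Suc.prems(3) by simp
  qed
  then have "s = t" using join_primes_dense[of s t] join_primes_dense[of t s] by (simp add: order_antisym)
  moreover obtain Z' where Z': "Z = add_mset s Z'" using s(1) by (metis insert_DiffM)
  moreover obtain W' where W': "W = add_mset t W'" using t(1) by (metis insert_DiffM)
  moreover have "Z' = W'"
  proof (rule Suc.hyps)
    show "n = size Z'" using Suc(2) Z' by simp
    show "chain_mset Z'" "chain_mset W'" using Suc.prems Z' W' by (auto simp: chain_mset_def)
    show "hibi_weight Z' = hibi_weight W'"
      using Suc.prems(3) unfolding Z' W' \<open>s = t\<close>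
      by (simp add: hibi_weight_add_mset[of _ Z'] hibi_weight_add_mset[of _ W'] fun_eq_iff)
  qed
  ultimately show ?case by simp
qed

lemma abs_hibi_add: "abs_hibi_ring p + abs_hibi_ring q = abs_hibi_ring (p + q)"
  by (rule plus_hibi_ring.abs_eq)

lemma abs_hibi_mult: "abs_hibi_ring p * abs_hibi_ring q = abs_hibi_ring (p * q)"
  by (rule times_hibi_ring.abs_eq)

lemma abs_hibi_zero: "abs_hibi_ring 0 = 0"
  by (simp add: zero_hibi_ring_def)

lemma abs_hibi_one: "abs_hibi_ring 1 = 1"
  by (simp add: one_hibi_ring_def)

lemma abs_hibi_sum: "(\<Sum>i\<in>I. abs_hibi_ring (f i)) = abs_hibi_ring (\<Sum>i\<in>I. f i)"
  by (induction I rule: infinite_finite_induct) (auto simp: abs_hibi_add abs_hibi_zero)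

lemma hibi_ring_cases: obtains p where "r = abs_hibi_ring p"
  using Quotient_abs_rep[OF Quotient_hibi_ring, of r] that[of "rep_hibi_ring r"] by simp

lemma vector_space_hibi_scale: "vector_space hibi_scale"
proof
  fix a b :: 'a and x y :: "('b, 'a) hibi_ring"
  show "hibi_scale a (x + y) = hibi_scale a x + hibi_scale a y"
    by (simp add: hibi_scale_def distrib_left)
  show "hibi_scale (a + b) x = hibi_scale a x + hibi_scale b x"
    by (simp add: hibi_scale_def distrib_right single_add flip: abs_hibi_add)
  show "hibi_scale a (hibi_scale b x) = hibi_scale (a * b) x"
    by (simp add: hibi_scale_def abs_hibi_mult mult_single flip: mult.assoc)
  show "hibi_scale 1 x = x"
    by (simp add: hibi_scale_def abs_hibi_one)
qed

definition hibi_elem :: "'a::lattice \<Rightarrow> ('a, 'k::field) hibi_ring" where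
  "hibi_elem \<alpha> = abs_hibi_ring (hibi_var \<alpha>)"

definition hibi_monom :: "'a::lattice multiset \<Rightarrow> ('a, 'k::field) hibi_ring" where
  "hibi_monom Z = (\<Prod>\<alpha>\<in>#Z. hibi_elem \<alpha>)"

lemma hibi_monom_simps:
  "hibi_monom {#} = 1"
  "hibi_monom (add_mset \<alpha> Z) = hibi_elem \<alpha> * hibi_monom Z"
  "hibi_monom (Z + W) = hibi_monom Z * hibi_monom W"
  by (simp_all add: hibi_monom_def)

lemma hibi_elem_mult:
  "hibi_elem \<alpha> * hibi_elem \<beta> = hibi_elem (inf \<alpha> \<beta>) * hibi_elem (sup \<alpha> \<beta>)"
  unfolding hibi_elem_def abs_hibi_mult hibi_ring.abs_eq_iff hibi_ideal_def
  by (rule module.span_base[OF module_times]) blast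

text \<open>A new factor \<alpha> is combined with the current upper bound \<open>s\<close>: the
  Hibi relation replaces this pair by its meet and join, and the join bounds all entries seen so
  far.\<close>

lemma hibi_monom_top:
  fixes Z :: "'a::{finite, distrib_lattice} multiset"
  assumes "Z \<noteq> {#}"
  shows "\<exists>s W. (\<forall>\<alpha>\<in>#Z. \<alpha> \<le> s) \<and> hibi_weight Z = hibi_weight (add_mset s W) \<and>
    (hibi_monom Z :: ('a, 'k::field) hibi_ring) = hibi_monom (add_mset s W)"
  using assms
proof (induction Z)
  case (add \<alpha> Z)
  show ?case
  proof (cases "Z = {#}")
    case False
    with add obtain s W where IH: "\<forall>\<alpha>\<in>#Z. \<alpha> \<le> s" "hibi_weight Z = hibi_weight (add_mset s W)"
      "(hibi_monom Z :: ('a, 'k) hibi_ring) = hibi_monom (add_mset s W)" by blast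
    let ?W = "add_mset (inf \<alpha> s) W"
    have "hibi_weight (add_mset \<alpha> Z) = hibi_weight {#\<alpha>, s#} + hibi_weight W"
      by (simp only: hibi_weight_add_mset[of \<alpha> Z] hibi_weight_add_mset[of \<alpha> "{#s#}"]
          hibi_weight_add_mset[of s W] IH(2) add.assoc)
    also have "\<dots> = hibi_weight (add_mset (sup \<alpha> s) ?W)"
      unfolding hibi_weight_straighten[of \<alpha> s] hibi_weight_union[symmetric]
      by (simp add: add_mset_commute)
    finally have "hibi_weight (add_mset \<alpha> Z) = hibi_weight (add_mset (sup \<alpha> s) ?W)" .
    moreover have "(hibi_monom (add_mset \<alpha> Z) :: ('a, 'k) hibi_ring) = hibi_monom (add_mset (sup \<alpha> s) ?W)"
    proof -
      have "(hibi_monom (add_mset \<alpha> Z) :: ('a, 'k) hibi_ring) = (hibi_elem \<alpha> * hibi_elem s) * hibi_monom W"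
        by (simp only: hibi_monom_simps IH(3) mult.assoc)
      also have "\<dots> = hibi_elem (sup \<alpha> s) * (hibi_elem (inf \<alpha> s) * hibi_monom W)"
        by (subst hibi_elem_mult) (simp only: mult_ac)
      finally show ?thesis by (simp only: hibi_monom_simps)
    qed
    ultimately show ?thesis using IH(1) by (intro exI[of _ "sup \<alpha> s"] exI[of _ ?W]) (auto intro: le_supI2)
  qed auto
qed simp

lemma hibi_monom_chain:
  fixes Z :: "'a::{finite, distrib_lattice} multiset"
  shows "\<exists>W. chain_mset W \<and> hibi_weight Z = hibi_weight W \<and>
    (hibi_monom Z :: ('a, 'k::field) hibi_ring) = hibi_monom W"
proof (induction "size Z" arbitrary: Z)
  case 0
  then show ?case by (intro exI[of _ "{#}"]) (auto simp: chain_mset_def)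
next
  case (Suc n)
  then obtain s W where W: "\<forall>\<alpha>\<in>#Z. \<alpha> \<le> s" "hibi_weight Z = hibi_weight (add_mset s W)"
    "(hibi_monom Z :: ('a, 'k) hibi_ring) = hibi_monom (add_mset s W)"
    using hibi_monom_top[of Z] by force
  then have "size (add_mset s W) = size Z" by (metis hibi_weight_least)
  then obtain V where V: "chain_mset V" "hibi_weight W = hibi_weight V"
    "(hibi_monom W :: ('a, 'k) hibi_ring) = hibi_monom V"
    using Suc by (metis size_add_mset Suc_inject)
  have eq: "hibi_weight Z = hibi_weight (add_mset s V)"
    using W(2) V(2) by (simp only: hibi_weight_add_mset[of s W] hibi_weight_add_mset[of s V])
  \<comment> \<open>Straightening the remaining factors changes them, but \<open>s\<close> still
    bounds them by weight alone: a join-prime below one of them has positive weight in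
    \<open>Z\<close>, so it lies below an entry of \<open>Z\<close>.\<close>
  have "\<alpha> \<le> s" if "\<alpha> \<in># V" for \<alpha>
  proof (rule join_primes_dense)
    fix p assume p: "p \<in> join_primes" "p \<le> \<alpha>"
    with that have "0 < hibi_weight Z p"
      unfolding eq using hibi_weight_pos_iff[OF p(1), of "add_mset s V"] by auto
    with W(1) show "p \<le> s" using hibi_weight_pos_iff[OF p(1), of Z] by force
  qed
  then have "chain_mset (add_mset s V)" using V(1) by (auto simp: chain_mset_def)
  with eq W(3) V(3) show ?case by (auto simp: hibi_monom_simps)
qed

text \<open>Both monomials straighten to the same chain.\<close>

lemma hibi_monom_cong:
  fixes Z W :: "'a::{finite, distrib_lattice} multiset"
  assumes "hibi_weight Z = hibi_weight W"
  shows "(hibi_monom Z :: ('a, 'k::field) hibi_ring) = hibi_monom W"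
proof -
  obtain Z' W' where "chain_mset Z'" "hibi_weight Z = hibi_weight Z'"
    "(hibi_monom Z :: ('a, 'k) hibi_ring) = hibi_monom Z'"
    "chain_mset W'" "hibi_weight W = hibi_weight W'"
    "(hibi_monom W :: ('a, 'k) hibi_ring) = hibi_monom W'"
    using hibi_monom_chain[of Z] hibi_monom_chain[of W] by blast
  then show ?thesis using assms chain_mset_eqI[of Z' W'] by simp
qed

text \<open>Translates exponent vectors of the polynomial ring into multisets, for which weights and
  straightening are formulated.\<close>

definition exponent_mset :: "('a::finite \<Rightarrow>\<^sub>0 nat) \<Rightarrow> 'a multiset" where
  "exponent_mset m = (\<Sum>\<alpha>\<in>UNIV. replicate_mset (lookup m \<alpha>) \<alpha>)"

lemma count_exponent_mset: "count (exponent_mset m) \<alpha> = lookup m \<alpha>"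
  by (simp add: exponent_mset_def count_sum)

lemma exponent_mset_add: "exponent_mset (m + n) = exponent_mset m + exponent_mset n"
  by (rule multiset_eqI) (simp add: count_exponent_mset lookup_add)

lemma exponent_mset_single: "exponent_mset (single \<alpha> 1) = {#\<alpha>#}"
  by (rule multiset_eqI) (simp add: count_exponent_mset lookup_single when_def)

lemma exponent_mset_zero: "exponent_mset 0 = {#}"
  by (rule multiset_eqI) (simp add: count_exponent_mset)

lemma exponent_mset_eq_iff: "exponent_mset m = exponent_mset n \<longleftrightarrow> m = n"
  by (metis count_exponent_mset poly_mapping_eqI)

lemma size_exponent_mset:
  "size (exponent_mset m) = (\<Sum>\<alpha>\<in>keys m. lookup m \<alpha>)"
proof -
  have "size (exponent_mset m) = (\<Sum>\<alpha>\<in>UNIV. lookup m \<alpha>)"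
    by (simp add: exponent_mset_def)
  also have "\<dots> = (\<Sum>\<alpha>\<in>keys m. lookup m \<alpha>)"
    by (rule sum.mono_neutral_right) (auto simp: in_keys_iff)
  finally show ?thesis .
qed

lemma hibi_monom_abs:
  "\<exists>m. exponent_mset m = Z \<and>
    (hibi_monom Z :: ('a::{finite, lattice}, 'k::field) hibi_ring) = abs_hibi_ring (single m 1)"
proof (induction Z)
  case empty
  show ?case by (intro exI[of _ 0]) (simp add: exponent_mset_zero hibi_monom_simps abs_hibi_one)
next
  case (add \<alpha> Z)
  then obtain m where "exponent_mset m = Z"
    "(hibi_monom Z :: ('a, 'k) hibi_ring) = abs_hibi_ring (single m 1)" by blast
  then show ?case
    by (intro exI[of _ "single \<alpha> 1 + m"])
       (simp add: exponent_mset_add exponent_mset_single[unfolded One_nat_def] hibi_monom_simps hibi_elem_def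
         hibi_var_def abs_hibi_mult mult_single)
qed

lemma abs_hibi_single:
  "abs_hibi_ring (single m c) =
    hibi_scale c (hibi_monom (exponent_mset m) :: ('a::{finite, lattice}, 'k::field) hibi_ring)"
proof -
  have "(hibi_monom (exponent_mset m) :: ('a, 'k) hibi_ring) = abs_hibi_ring (single m 1)"
    using hibi_monom_abs[of "exponent_mset m"] by (auto simp: exponent_mset_eq_iff)
  then show ?thesis by (simp add: hibi_scale_def abs_hibi_mult mult_single)
qed

lemma poly_mapping_sum_single:
  "(\<Sum>m\<in>keys p. single m (lookup p m)) = p"
  by (rule poly_mapping_eqI) (simp add: lookup_sum_single in_keys_iff)

lemma abs_hibi_expand:
  "abs_hibi_ring p = (\<Sum>m\<in>keys p. hibi_scale (lookup p m)
     (hibi_monom (exponent_mset m) :: ('a::{finite, lattice}, 'k::field) hibi_ring))"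
  by (simp add: abs_hibi_sum poly_mapping_sum_single flip: abs_hibi_single)

section \<open>Coefficient functionals and the basis of chain monomials\<close>

text \<open>The coefficient at \<open>v\<close> of the image of \<open>p\<close> under Hibi's
  embedding, expressed without constructing the target ring.\<close>

definition poly_coeff :: "('a::{finite, lattice} \<Rightarrow> nat) \<Rightarrow> (('a \<Rightarrow>\<^sub>0 nat) \<Rightarrow>\<^sub>0 'k::field) \<Rightarrow> 'k" where
  "poly_coeff v p =
     (\<Sum>m\<in>keys p. if hibi_weight (exponent_mset m) = v then lookup p m else 0)"

lemma poly_coeff_superset:
  assumes "finite S" "keys p \<subseteq> S"
  shows "poly_coeff v p = (\<Sum>m\<in>S. if hibi_weight (exponent_mset m) = v then lookup p m else 0)"
  unfolding poly_coeff_def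
  by (rule sum.mono_neutral_left) (use assms in \<open>auto simp: in_keys_iff\<close>)

lemma poly_coeff_add: "poly_coeff v (p + q) = poly_coeff v p + poly_coeff v q"
proof -
  let ?S = "keys p \<union> keys q"
  have "keys (p + q) \<subseteq> ?S" by (rule keys_add)
  then show ?thesis
    by (simp add: poly_coeff_superset[of ?S] flip: sum.distrib) (rule sum.cong, auto simp: lookup_add)
qed

lemma poly_coeff_uminus: "poly_coeff v (- p) = - poly_coeff v p"
proof -
  have "poly_coeff v (- p) + poly_coeff v p = 0"
    by (simp flip: poly_coeff_add) (simp add: poly_coeff_def)
  then show ?thesis by (simp add: add_eq_0_iff2)
qed

lemma poly_coeff_diff: "poly_coeff v (p - q) = poly_coeff v p - poly_coeff v q"
  using poly_coeff_add[of v p "- q"] poly_coeff_uminus[of v q] by simp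

lemma poly_coeff_single:
  "poly_coeff v (single m c) = (if hibi_weight (exponent_mset m) = v then c else 0)"
  by (cases "c = 0") (auto simp: poly_coeff_def)

lemma poly_coeff_sum: "poly_coeff v (\<Sum>i\<in>I. f i) = (\<Sum>i\<in>I. poly_coeff v (f i))"
  by (induction I rule: infinite_finite_induct) (auto simp: poly_coeff_add, auto simp: poly_coeff_def)

text \<open>A monomial multiple of a generator is a difference of two monomials of equal weight,
  whose contributions cancel.\<close>

lemma poly_coeff_ideal:
  fixes p :: "('a::{finite, distrib_lattice} \<Rightarrow>\<^sub>0 nat) \<Rightarrow>\<^sub>0 'k::field"
  assumes "p \<in> hibi_ideal"
  shows "poly_coeff v p = 0"
  using assms unfolding hibi_ideal_def
proof (induction p rule: module.span_induct_alt[OF module_times, consumes 1, case_names zero step])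
  case zero
  then show ?case by (simp add: poly_coeff_def)
next
  case (step c x y)
  then obtain \<alpha> \<beta> where x: "x = hibi_var \<alpha> * hibi_var \<beta> - hibi_var (inf \<alpha> \<beta>) * hibi_var (sup \<alpha> \<beta>)"
    by blast
  have "poly_coeff v (c * x) = (\<Sum>m\<in>keys c. poly_coeff v (single m (lookup c m) * x))"
    by (subst (1) poly_mapping_sum_single[symmetric]) (simp only: sum_distrib_right poly_coeff_sum)
  also have "\<dots> = 0"
  proof (rule sum.neutral, rule ballI)
    fix m
    have *: "hibi_weight (exponent_mset (m + (single \<alpha> 1 + single \<beta> 1))) =
        hibi_weight (exponent_mset (m + (single (inf \<alpha> \<beta>) 1 + single (sup \<alpha> \<beta>) 1)))"
      unfolding exponent_mset_add exponent_mset_single hibi_weight_union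
      using hibi_weight_straighten[of \<alpha> \<beta>]
      by (simp add: hibi_weight_add_mset[of _ "{#_#}"])
    show "poly_coeff v (single m (lookup c m) * x) = 0"
      using * by (simp add: x hibi_var_def mult_single right_diff_distrib poly_coeff_diff poly_coeff_single)
  qed
  finally show ?case using step by (simp add: poly_coeff_add)
qed

text \<open>Since distinct chains have distinct weights, these functionals are dual to the chain
  monomials.\<close>

lift_definition hibi_coeff :: "('a::{finite, distrib_lattice} \<Rightarrow> nat) \<Rightarrow> ('a, 'k::field) hibi_ring \<Rightarrow> 'k"
  is poly_coeff
  using poly_coeff_ideal poly_coeff_diff by (metis eq_iff_diff_eq_0)

lemma hibi_coeff_add: "hibi_coeff v (r + s) = hibi_coeff v r + hibi_coeff v s"
  by transfer (rule poly_coeff_add)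

lemma hibi_coeff_zero [simp]: "hibi_coeff v 0 = 0"
  by transfer (simp add: poly_coeff_def)

lemma hibi_coeff_sum: "hibi_coeff v (\<Sum>i\<in>I. f i) = (\<Sum>i\<in>I. hibi_coeff v (f i))"
  by (induction I rule: infinite_finite_induct) (auto simp: hibi_coeff_add)

lemma hibi_coeff_monom:
  "hibi_coeff v (hibi_scale c (hibi_monom Z)) = (if hibi_weight Z = v then c else 0)"
proof -
  obtain m where m: "Z = exponent_mset m" using hibi_monom_abs[of Z] by metis
  show ?thesis
    unfolding m abs_hibi_single[symmetric] by (simp add: hibi_coeff.abs_eq poly_coeff_single)
qed

lemma hibi_coeff_scale: "hibi_coeff v (hibi_scale c r) = c * hibi_coeff v r"
proof -
  interpret vector_space hibi_scale by (rule vector_space_hibi_scale)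
  obtain p where p: "r = abs_hibi_ring p" by (rule hibi_ring_cases)
  show ?thesis
    unfolding p abs_hibi_expand
    by (simp add: scale_sum_right hibi_coeff_sum hibi_coeff_monom sum_distrib_left if_distrib cong: if_cong)
qed

text \<open>The monomials of a representative are grouped by the chain to which they straighten. All
  members of a group have the weight of that chain, so their coefficients add up to a value of
  \<open>hibi_coeff\<close>.\<close>

lemma hibi_expand:
  fixes r :: "('a::{finite, distrib_lattice}, 'k::field) hibi_ring"
  obtains F where "finite F" "\<And>Z. Z \<in> F \<Longrightarrow> chain_mset Z"
    "r = (\<Sum>Z\<in>F. hibi_scale (hibi_coeff (hibi_weight Z) r) (hibi_monom Z))"
proof -
  interpret vector_space "hibi_scale :: 'k \<Rightarrow> ('a, 'k) hibi_ring \<Rightarrow> _" by (rule vector_space_hibi_scale)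
  obtain p where p: "r = abs_hibi_ring p" by (rule hibi_ring_cases)
  define N where "N Z = (SOME W. chain_mset W \<and> hibi_weight Z = hibi_weight W)" for Z :: "'a multiset"
  have "\<exists>W. chain_mset W \<and> hibi_weight Z = hibi_weight W" for Z :: "'a multiset"
    using hibi_monom_chain[of Z] by blast
  from someI_ex[OF this] have N: "chain_mset (N Z)" "hibi_weight Z = hibi_weight (N Z)" for Z
    unfolding N_def by blast+
  define K where "K = keys p"
  define g where "g m = N (exponent_mset m)" for m
  have gw: "hibi_weight (exponent_mset m) = hibi_weight Z \<longleftrightarrow> g m = Z" if "chain_mset Z" for m Z
    unfolding g_def using N that by (metis chain_mset_eqI)
  have "r = (\<Sum>m\<in>K. hibi_scale (lookup p m) (hibi_monom (g m)))"
    unfolding p abs_hibi_expand K_def g_def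
    by (intro sum.cong refl arg_cong[where f = "hibi_scale _"] hibi_monom_cong N)
  also have "\<dots> = (\<Sum>Z\<in>g ` K. \<Sum>m | m \<in> K \<and> g m = Z. hibi_scale (lookup p m) (hibi_monom (g m)))"
    by (rule sum.image_gen) (simp add: K_def)
  also have "\<dots> = (\<Sum>Z\<in>g ` K. hibi_scale (hibi_coeff (hibi_weight Z) r) (hibi_monom Z))"
  proof (rule sum.cong[OF refl])
    fix Z assume "Z \<in> g ` K"
    then have Z: "chain_mset Z" using N by (auto simp: g_def)
    have "hibi_coeff (hibi_weight Z) r = (\<Sum>m\<in>K. if g m = Z then lookup p m else 0)"
      unfolding p hibi_coeff.abs_eq poly_coeff_def K_def by (simp add: gw[OF Z])
    also have "\<dots> = (\<Sum>m | m \<in> K \<and> g m = Z. lookup p m)"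
      by (rule sum.inter_filter[symmetric]) (simp add: K_def)
    finally show "(\<Sum>m | m \<in> K \<and> g m = Z. hibi_scale (lookup p m) (hibi_monom (g m))) =
        hibi_scale (hibi_coeff (hibi_weight Z) r) (hibi_monom Z)"
      by (simp add: scale_sum_left)
  qed
  finally show thesis by (intro that[of "g ` K"]) (auto simp: K_def g_def N(1))
qed

lemma hibi_eqI:
  fixes r :: "('a::{finite, distrib_lattice}, 'k::field) hibi_ring"
  assumes "\<And>v. hibi_coeff v r = 0"
  shows "r = 0"
proof -
  interpret vector_space "hibi_scale :: 'k \<Rightarrow> ('a, 'k) hibi_ring \<Rightarrow> _" by (rule vector_space_hibi_scale)
  show ?thesis by (rule hibi_expand[of r]) (simp add: assms)
qed

section \<open>The grading of the Hibi ring\<close>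

abbreviation homogeneous where
  "homogeneous n p \<equiv> \<forall>m\<in>keys p. int (size (exponent_mset m)) = n"

lemma hibi_component_alt:
  "hibi_component n = {abs_hibi_ring p | p :: ('a::{finite, lattice} \<Rightarrow>\<^sub>0 nat) \<Rightarrow>\<^sub>0 'k::field.
     homogeneous n p}"
  by (simp add: hibi_component_def size_exponent_mset)

lemma hibi_monom_component: "hibi_monom Z \<in> hibi_component (int (size (Z :: 'a::{finite, lattice} multiset)))"
  using hibi_monom_abs[of Z] unfolding hibi_component_alt by force

lemma hibi_coeff_component:
  assumes "r \<in> hibi_component n" "hibi_coeff v r \<noteq> 0"
  shows "int (v least_element) = n"
proof -
  obtain p where p: "r = abs_hibi_ring p" "homogeneous n p"
    using assms(1) unfolding hibi_component_alt by blast
  have "poly_coeff v p \<noteq> 0" using assms(2) p(1) by (simp add: hibi_coeff.abs_eq)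
  then obtain m where "m \<in> keys p" "hibi_weight (exponent_mset m) = v"
    unfolding poly_coeff_def by (auto elim!: sum.not_neutral_contains_not_neutral split: if_splits)
  then show ?thesis using p(2) by (metis hibi_weight_least)
qed

lemma graded_algebra_hibi:
  "graded_algebra (hibi_scale :: 'k::field \<Rightarrow> ('a::{finite, distrib_lattice}, 'k) hibi_ring \<Rightarrow> _) hibi_component"
proof -
  interpret vector_space "hibi_scale :: 'k \<Rightarrow> ('a, 'k) hibi_ring \<Rightarrow> _" by (rule vector_space_hibi_scale)
  show ?thesis
  proof unfold_locales
    fix c and x y :: "('a, 'k) hibi_ring"
    show "hibi_scale c x * y = hibi_scale c (x * y)" by (simp add: hibi_scale_def mult.assoc)
  next
    fix m n and x y :: "('a, 'k) hibi_ring"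
    assume "x \<in> hibi_component m" "y \<in> hibi_component n"
    then obtain p q where pq: "x = abs_hibi_ring p" "homogeneous m p"
      "y = abs_hibi_ring q" "homogeneous n q"
      unfolding hibi_component_alt by blast
    have "homogeneous (m + n) (p * q)"
    proof
      fix i assume "i \<in> keys (p * q)"
      then obtain a b where "a \<in> keys p" "b \<in> keys q" "i = a + b"
        using keys_mult[of p q] by blast
      then show "int (size (exponent_mset i)) = m + n" using pq by (simp add: exponent_mset_add)
    qed
    then show "x * y \<in> hibi_component (m + n)"
      unfolding pq abs_hibi_mult hibi_component_alt by blast
  next
    fix n
    show "subspace (hibi_component n :: ('a, 'k) hibi_ring set)"
    proof (rule subspaceI)
      show "0 \<in> (hibi_component n :: ('a, 'k) hibi_ring set)"
        unfolding hibi_component_alt by (auto intro!: exI[of _ 0] simp: abs_hibi_zero)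
    next
      fix x y :: "('a, 'k) hibi_ring"
      assume "x \<in> hibi_component n" "y \<in> hibi_component n"
      then obtain p q where pq: "x = abs_hibi_ring p" "homogeneous n p"
        "y = abs_hibi_ring q" "homogeneous n q"
        unfolding hibi_component_alt by blast
      have "homogeneous n (p + q)"
        using keys_add[of p q] pq by blast
      then show "x + y \<in> hibi_component n"
        unfolding pq abs_hibi_add hibi_component_alt by blast
    next
      fix c and x :: "('a, 'k) hibi_ring"
      assume "x \<in> hibi_component n"
      then obtain p where p: "x = abs_hibi_ring p" "homogeneous n p"
        unfolding hibi_component_alt by blast
      have "keys (single 0 c * p) \<subseteq> keys p"
        using keys_mult[of "single 0 c" p] by (auto split: if_splits)
      then have "homogeneous n (single 0 c * p)"
        using p by blast
      then show "hibi_scale c x \<in> hibi_component n"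
        unfolding p hibi_scale_def abs_hibi_mult hibi_component_alt by blast
    qed
  next
    fix n :: int assume "n < 0"
    then have "p = 0" if "homogeneous n p"
      for p :: "('a \<Rightarrow>\<^sub>0 nat) \<Rightarrow>\<^sub>0 'k"
    proof -
      have "keys p = {}" using that \<open>n < 0\<close> by force
      then show ?thesis by simp
    qed
    then have "{abs_hibi_ring p | p :: ('a \<Rightarrow>\<^sub>0 nat) \<Rightarrow>\<^sub>0 'k.
        homogeneous n p} = {abs_hibi_ring 0}"
      by force
    then show "(hibi_component n :: ('a, 'k) hibi_ring set) = {0}"
      unfolding hibi_component_alt by (simp only: abs_hibi_zero)
  next
    have const: "p = single 0 (lookup p 0)"
      if "homogeneous 0 p" for p :: "('a \<Rightarrow>\<^sub>0 nat) \<Rightarrow>\<^sub>0 'k"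
    proof (rule poly_mapping_eqI)
      fix k
      have "k = 0" if "k \<in> keys p"
      proof -
        have "exponent_mset k = exponent_mset 0"
          using that \<open>\<forall>m\<in>_. _\<close> by (simp add: exponent_mset_zero)
        then show ?thesis by (simp only: exponent_mset_eq_iff)
      qed
      then show "lookup p k = lookup (single 0 (lookup p 0)) k"
        by (cases "k = 0") (auto simp: lookup_single_not_eq in_keys_iff)
    qed
    have "x \<in> range (\<lambda>c. abs_hibi_ring (single 0 c))"
      if "x \<in> hibi_component 0" for x :: "('a, 'k) hibi_ring"
    proof -
      obtain p where p: "x = abs_hibi_ring p" "homogeneous 0 p"
        using \<open>x \<in> hibi_component 0\<close> unfolding hibi_component_alt by blast
      show ?thesis
        by (rule image_eqI[of _ _ "lookup p 0"])
           (simp_all only: p(1) const[OF p(2), symmetric] UNIV_I)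
    qed
    moreover have "abs_hibi_ring (single 0 c) \<in> (hibi_component 0 :: ('a, 'k) hibi_ring set)" for c
      unfolding hibi_component_alt
      by (auto intro!: exI[of _ "single 0 c"] simp: exponent_mset_zero split: if_splits)
    ultimately show "(hibi_component 0 :: ('a, 'k) hibi_ring set) = range (\<lambda>c. hibi_scale c 1)"
      unfolding hibi_scale_def by auto
  next
    fix S :: "int set" and r :: "int \<Rightarrow> ('a, 'k) hibi_ring" and m
    assume S: "finite S" "\<And>n. n \<in> S \<Longrightarrow> r n \<in> hibi_component n" "(\<Sum>n\<in>S. r n) = 0" "m \<in> S"
    show "r m = 0"
    proof (rule hibi_eqI, rule ccontr)
      \<comment> \<open>The weight \<open>v\<close> occurs only in degree
        \<open>v least_element\<close>, so the coefficient at \<open>v\<close> isolates the summand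
        \<open>r m\<close>.\<close>
      fix v assume v: "hibi_coeff v (r m) \<noteq> 0"
      have "hibi_coeff v (r n) = (if n = m then hibi_coeff v (r m) else 0)" if "n \<in> S" for n
      proof (cases "n = m")
        case False
        with hibi_coeff_component[OF S(2)[OF that], of v] hibi_coeff_component[OF S(2)[OF S(4)] v]
        show ?thesis by argo
      qed simp
      then have "hibi_coeff v (\<Sum>n\<in>S. r n) = (\<Sum>n\<in>S. if n = m then hibi_coeff v (r m) else 0)"
        unfolding hibi_coeff_sum by (intro sum.cong) auto
      also have "\<dots> = hibi_coeff v (r m)" using S(1,4) by (simp add: sum.delta)
      finally have "hibi_coeff v (\<Sum>n\<in>S. r n) = hibi_coeff v (r m)" .
      with v S(3) show False by simp
    qed
  qed
qed

section \<open>Lattice paths in the plane\<close>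

text \<open>Nestedness is what turns meets and joins into minima and maxima of the
  coordinates.\<close>

lemma card_chain_downsets:
  assumes "finite C" "\<And>x y. x \<in> C \<Longrightarrow> y \<in> C \<Longrightarrow> x \<le> y \<or> y \<le> (x :: 'a::order)"
  shows "{p \<in> C. p \<le> \<alpha>} \<subseteq> {p \<in> C. p \<le> \<beta>} \<or> {p \<in> C. p \<le> \<beta>} \<subseteq> {p \<in> C. p \<le> \<alpha>}"
proof (rule ccontr)
  assume "\<not> ?thesis"
  then obtain p q where "p \<in> C" "p \<le> \<alpha>" "\<not> p \<le> \<beta>" "q \<in> C" "q \<le> \<beta>" "\<not> q \<le> \<alpha>" by blast
  then show False using assms(2)[of p q] by (meson order_trans)
qed

lemma card_Int_nested: "finite A \<Longrightarrow> finite B \<Longrightarrow> A \<subseteq> B \<or> B \<subseteq> A \<Longrightarrow> card (A \<inter> B) = min (card A) (card B)"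
  by (auto simp: Int_absorb1 Int_absorb2 card_mono min_def dest: card_mono)

lemma card_Un_nested: "finite A \<Longrightarrow> finite B \<Longrightarrow> A \<subseteq> B \<or> B \<subseteq> A \<Longrightarrow> card (A \<union> B) = max (card A) (card B)"
  by (auto simp: Un_absorb1 Un_absorb2 card_mono max_def dest: card_mono)

lemma card_chain_downset_inf:
  assumes "finite C" "\<And>x y. x \<in> C \<Longrightarrow> y \<in> C \<Longrightarrow> x \<le> y \<or> y \<le> (x :: 'a::lattice)"
  shows "card {p \<in> C. p \<le> inf \<alpha> \<beta>} = min (card {p \<in> C. p \<le> \<alpha>}) (card {p \<in> C. p \<le> \<beta>})"
proof -
  have "{p \<in> C. p \<le> inf \<alpha> \<beta>} = {p \<in> C. p \<le> \<alpha>} \<inter> {p \<in> C. p \<le> \<beta>}" by auto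
  then show ?thesis using assms by (simp add: card_Int_nested card_chain_downsets)
qed

lemma card_chain_downset_sup:
  assumes "C \<subseteq> join_primes" "finite C"
    "\<And>x y. x \<in> C \<Longrightarrow> y \<in> C \<Longrightarrow> x \<le> y \<or> y \<le> (x :: 'a::distrib_lattice)"
  shows "card {p \<in> C. p \<le> sup \<alpha> \<beta>} = max (card {p \<in> C. p \<le> \<alpha>}) (card {p \<in> C. p \<le> \<beta>})"
proof -
  have "{p \<in> C. p \<le> sup \<alpha> \<beta>} = {p \<in> C. p \<le> \<alpha>} \<union> {p \<in> C. p \<le> \<beta>}"
    using assms(1) join_prime_le_sup by blast
  then show ?thesis using assms(2,3) by (simp add: card_Un_nested card_chain_downsets)
qed

text \<open>Covers every partition of the join-irreducibles into two chains, one of which may be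
  empty; maximality enters with \<open>canonical_pair\<close>.\<close>

locale two_chains =
  fixes C1 C2 :: "'a::{finite, distrib_lattice} set"
  assumes Un_chains: "C1 \<union> C2 = join_irreducibles"
    and disjoint_chains: "C1 \<inter> C2 = {}"
    and chain1: "x \<in> C1 \<Longrightarrow> y \<in> C1 \<Longrightarrow> x \<le> y \<or> y \<le> x"
    and chain2: "x \<in> C2 \<Longrightarrow> y \<in> C2 \<Longrightarrow> x \<le> y \<or> y \<le> x"
begin

definition xc :: "'a \<Rightarrow> nat" where "xc \<alpha> = card {p \<in> C1. p \<le> \<alpha>}"
definition yc :: "'a \<Rightarrow> nat" where "yc \<alpha> = card {p \<in> C2. p \<le> \<alpha>}"
definition rk :: "'a \<Rightarrow> nat" where "rk \<alpha> = xc \<alpha> + yc \<alpha>"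
definition N :: nat where "N = card (join_irreducibles :: 'a set)"

lemma rk_eq_card: "rk \<alpha> = card {p \<in> join_irreducibles. p \<le> \<alpha>}"
proof -
  have "{p \<in> join_irreducibles. p \<le> \<alpha>} = {p \<in> C1. p \<le> \<alpha>} \<union> {p \<in> C2. p \<le> \<alpha>}"
    using Un_chains by auto
  then show ?thesis
    unfolding rk_def xc_def yc_def using disjoint_chains by (simp add: card_Un_disjoint disjoint_iff)
qed

lemma join_irreducible_le_sup: "p \<in> join_irreducibles \<Longrightarrow> p \<le> sup \<alpha> \<beta> \<longleftrightarrow> p \<le> \<alpha> \<or> p \<le> (\<beta> :: 'a)"
  by (rule join_prime_le_sup) (simp add: join_primes_eq)

lemma chains_join_primes: "C1 \<subseteq> join_primes" "C2 \<subseteq> join_primes"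
  using Un_chains by (auto simp: join_primes_eq)

lemma xc_inf: "xc (inf \<alpha> \<beta>) = min (xc \<alpha>) (xc \<beta>)"
  unfolding xc_def by (rule card_chain_downset_inf) (use chain1 in auto)

lemma xc_sup: "xc (sup \<alpha> \<beta>) = max (xc \<alpha>) (xc \<beta>)"
  unfolding xc_def by (rule card_chain_downset_sup[OF chains_join_primes(1)]) (use chain1 in auto)

lemma yc_inf: "yc (inf \<alpha> \<beta>) = min (yc \<alpha>) (yc \<beta>)"
  unfolding yc_def by (rule card_chain_downset_inf) (use chain2 in auto)

lemma yc_sup: "yc (sup \<alpha> \<beta>) = max (yc \<alpha>) (yc \<beta>)"
  unfolding yc_def by (rule card_chain_downset_sup[OF chains_join_primes(2)]) (use chain2 in auto)

text \<open>In either chain the down-sets are nested and hence compared by their sizes; together the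
  two chains contain all join-irreducibles, which determine the order.\<close>

lemma le_iff_coords: "\<alpha> \<le> \<beta> \<longleftrightarrow> xc \<alpha> \<le> xc \<beta> \<and> yc \<alpha> \<le> yc \<beta>"
proof
  assume "\<alpha> \<le> \<beta>"
  then show "xc \<alpha> \<le> xc \<beta> \<and> yc \<alpha> \<le> yc \<beta>"
    unfolding xc_def yc_def by (auto intro!: card_mono intro: order_trans)
next
  assume *: "xc \<alpha> \<le> xc \<beta> \<and> yc \<alpha> \<le> yc \<beta>"
  have "{p \<in> C1. p \<le> \<alpha>} \<subseteq> {p \<in> C1. p \<le> \<beta>}"
    using card_chain_downsets[of C1 \<alpha> \<beta>] chain1 * card_seteq[of "{p \<in> C1. p \<le> \<alpha>}" "{p \<in> C1. p \<le> \<beta>}"]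
    by (auto simp: xc_def)
  moreover have "{p \<in> C2. p \<le> \<alpha>} \<subseteq> {p \<in> C2. p \<le> \<beta>}"
    using card_chain_downsets[of C2 \<alpha> \<beta>] chain2 * card_seteq[of "{p \<in> C2. p \<le> \<alpha>}" "{p \<in> C2. p \<le> \<beta>}"]
    by (auto simp: yc_def)
  ultimately have "p \<le> \<beta>" if "p \<in> join_irreducibles" "p \<le> \<alpha>" for p
    using that Un_chains by blast
  then show "\<alpha> \<le> \<beta>"
    by - (rule join_primes_dense, auto simp: join_primes_eq)
qed

lemma eq_iff_coords: "\<alpha> = \<beta> \<longleftrightarrow> xc \<alpha> = xc \<beta> \<and> yc \<alpha> = yc \<beta>"
  by (metis le_iff_coords order_antisym order_refl)

lemma rk_strict_mono: "\<alpha> < \<beta> \<Longrightarrow> rk \<alpha> < rk \<beta>"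
  using eq_iff_coords[of \<alpha> \<beta>] by (auto simp: less_le le_iff_coords rk_def)

lemma comparable_rk_le: "\<alpha> \<le> \<beta> \<or> \<beta> \<le> \<alpha> \<Longrightarrow> rk \<alpha> \<le> rk \<beta> \<Longrightarrow> \<alpha> \<le> \<beta>"
  by (metis leD le_less rk_strict_mono)

lemma rk_yc_eqI: "rk \<alpha> = rk \<beta> \<Longrightarrow> yc \<alpha> = yc \<beta> \<Longrightarrow> \<alpha> = \<beta>"
  by (simp add: eq_iff_coords rk_def)

lemma rk_le_N: "rk \<alpha> \<le> N"
  unfolding rk_eq_card N_def by (rule card_mono) auto

lemma rk_eq_N: "rk \<alpha> = N \<Longrightarrow> \<beta> \<le> \<alpha>"
proof (rule join_primes_dense)
  fix p :: 'a assume N: "rk \<alpha> = N" and p: "p \<in> join_primes"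
  have "{p \<in> join_irreducibles. p \<le> \<alpha>} = (join_irreducibles :: 'a set)"
    by (rule card_subset_eq) (use N in \<open>auto simp: rk_eq_card N_def\<close>)
  then have "p \<le> \<alpha>" if "p \<in> join_irreducibles" using that by blast
  then show "p \<le> \<alpha>" using p join_primes_eq by (cases "p = least_element") auto
qed

lemma rk_least: "rk least_element = 0"
proof -
  have "{p \<in> join_irreducibles. p \<le> least_element} = ({} :: 'a set)"
  proof (rule ccontr)
    assume "\<not> ?thesis"
    then obtain p :: 'a where "join_irreducible p" "p \<le> least_element"
      by (auto simp: join_irreducibles_def)
    then show False unfolding join_irreducible_def by (meson least_element_le order_trans)
  qed
  then show ?thesis by (simp add: rk_eq_card)
qed

lemma greatest_exists: "\<exists>\<tau> :: 'a. (\<forall>\<alpha>. \<alpha> \<le> \<tau>) \<and> rk \<tau> = N"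
proof (intro exI conjI allI)
  let ?t = "Sup_fin (UNIV :: 'a set)"
  show le: "\<alpha> \<le> ?t" for \<alpha> by (rule Sup_fin.coboundedI) auto
  show "rk ?t = N" using le by (simp add: rk_eq_card N_def)
qed

text \<open>Joining \<alpha> with a minimal join-irreducible among those below \<beta> and not below
  \<alpha> adds exactly one join-irreducible.\<close>

lemma unit_step:
  assumes "\<alpha> < \<beta>"
  obtains \<gamma> where "\<alpha> < \<gamma>" "\<gamma> \<le> \<beta>" "rk \<gamma> = Suc (rk \<alpha>)"
proof -
  let ?S = "{p \<in> join_irreducibles. p \<le> \<beta> \<and> \<not> p \<le> \<alpha>}"
  have "?S \<noteq> {}"
  proof
    assume "?S = {}"
    then have "\<beta> \<le> \<alpha>" by - (rule join_primes_dense, auto simp: join_primes_eq)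
    with assms show False by simp
  qed
  then obtain p where p: "p \<in> ?S" "\<And>q. q \<in> ?S \<Longrightarrow> q \<le> p \<Longrightarrow> p = q"
    using finite_has_minimal[of ?S] by auto
  have below: "q \<le> \<alpha>" if "q \<in> join_irreducibles" "q \<le> p" "q \<noteq> p" for q
    using p that by (metis (mono_tags, lifting) mem_Collect_eq order_trans)
  have "{q \<in> join_irreducibles. q \<le> sup \<alpha> p} = insert p {q \<in> join_irreducibles. q \<le> \<alpha>}"
    using p(1) below by (auto simp: join_irreducible_le_sup)
  then have "rk (sup \<alpha> p) = Suc (rk \<alpha>)"
    using p(1) by (simp add: rk_eq_card)
  moreover have "\<alpha> < sup \<alpha> p" using p(1) by (auto simp: less_le_not_le)
  ultimately show thesis using p(1) assms by (intro that[of "sup \<alpha> p"]) auto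
qed

section \<open>Lattice paths and their descents\<close>

text \<open>The maximal chains, listed by rank. Extensionality outside \<open>{..N}\<close> makes
  the set finite and lets paths be equal as functions.\<close>

definition lattice_paths :: "(nat \<Rightarrow> 'a) set" where
  "lattice_paths = {\<pi> \<in> {..N} \<rightarrow>\<^sub>E UNIV. (\<forall>i\<le>N. rk (\<pi> i) = i) \<and> (\<forall>i<N. \<pi> i \<le> \<pi> (Suc i))}"

text \<open>A step along \<open>C2\<close> followed by a step along \<open>C1\<close> such that the
  opposite corner \<gamma> of the square also belongs to the lattice.\<close>

definition descents :: "(nat \<Rightarrow> 'a) \<Rightarrow> nat set" where
  "descents \<pi> = {i. 0 < i \<and> i < N \<and>
     (\<exists>\<gamma>. \<pi> (i - 1) \<le> \<gamma> \<and> \<gamma> \<le> \<pi> (Suc i) \<and> rk \<gamma> = i \<and> yc \<gamma> < yc (\<pi> i))}"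

lemma finite_lattice_paths: "finite lattice_paths"
  by (rule finite_subset[of _ "{..N} \<rightarrow>\<^sub>E UNIV"]) (auto simp: lattice_paths_def intro: finite_PiE)

lemma path_rk: "\<pi> \<in> lattice_paths \<Longrightarrow> i \<le> N \<Longrightarrow> rk (\<pi> i) = i"
  by (auto simp: lattice_paths_def)

lemma path_Suc: "\<pi> \<in> lattice_paths \<Longrightarrow> i < N \<Longrightarrow> \<pi> i \<le> \<pi> (Suc i)"
  by (auto simp: lattice_paths_def)

lemma path_mono:
  assumes "\<pi> \<in> lattice_paths" "i \<le> j" "j \<le> N"
  shows "\<pi> i \<le> \<pi> j"
  using assms(2,3)
proof (induction j rule: dec_induct)
  case (step j)
  then show ?case using path_Suc[OF assms(1), of j] by (meson Suc_leD Suc_le_lessD order_trans)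
qed simp

lemma path_step:
  assumes "\<pi> \<in> lattice_paths" "i < N"
  shows "xc (\<pi> (Suc i)) = Suc (xc (\<pi> i)) \<and> yc (\<pi> (Suc i)) = yc (\<pi> i) \<or>
    xc (\<pi> (Suc i)) = xc (\<pi> i) \<and> yc (\<pi> (Suc i)) = Suc (yc (\<pi> i))"
  using path_Suc[OF assms] path_rk[OF assms(1), of i] path_rk[OF assms(1), of "Suc i"] assms(2)
  by (auto simp: le_iff_coords rk_def)

lemma path_extensionality:
  assumes "\<pi> \<in> lattice_paths" "\<rho> \<in> lattice_paths" "\<And>i. i \<le> N \<Longrightarrow> yc (\<pi> i) = yc (\<rho> i)"
  shows "\<pi> = \<rho>"
proof
  fix i
  show "\<pi> i = \<rho> i"
  proof (cases "i \<le> N")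
    case True
    then show ?thesis using assms path_rk by (intro rk_yc_eqI) auto
  next
    case False
    then show ?thesis using assms(1,2) by (auto simp: lattice_paths_def PiE_def extensional_def)
  qed
qed

text \<open>Among the steps of the path that avoid the elements comparable with \<open>\<sigma>\<close>, the last
  one along \<open>C2\<close> is followed by one along \<open>C1\<close>; the corner in between can be flipped.\<close>

lemma path_lowest:
  assumes \<pi>: "\<pi> \<in> lattice_paths" and comp: "\<And>i. i \<in> descents \<pi> \<Longrightarrow> \<sigma> \<le> \<pi> i \<or> \<pi> i \<le> \<sigma>"
  shows "yc (\<pi> (rk \<sigma>)) \<le> yc \<sigma>"
proof (rule ccontr)
  assume "\<not> ?thesis"
  then have r: "yc \<sigma> < yc (\<pi> (rk \<sigma>))" by simp
  define Q where "Q c \<longleftrightarrow> c \<le> N \<and> xc (\<pi> c) < xc \<sigma> \<and> yc \<sigma> < yc (\<pi> c)" for c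
  have Qr: "Q (rk \<sigma>)"
    using r path_rk[OF \<pi> rk_le_N, of \<sigma>] rk_le_N[of \<sigma>] by (auto simp: Q_def rk_def)
  have Q0: "\<not> Q 0" using path_rk[OF \<pi>, of 0] by (auto simp: Q_def rk_def)
  have QN: "\<not> Q N" using rk_eq_N[OF path_rk[OF \<pi> order_refl], of \<sigma>] by (auto simp: Q_def le_iff_coords)
  define V where "V = {c. 0 < c \<and> Q c \<and> yc (\<pi> (c - 1)) < yc (\<pi> c)}"
  have "finite V" by (rule finite_subset[of _ "{..N}"]) (auto simp: V_def Q_def)
  moreover have "V \<noteq> {}"
  proof -
    \<comment> \<open>The path enters the region \<open>Q\<close> by a step along \<open>C2\<close>:
      a step along \<open>C1\<close> ending in \<open>Q\<close> would also start in it.\<close>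
    define c where "c = (LEAST c. Q c)"
    have c: "Q c" unfolding c_def using Qr by (rule LeastI)
    have "0 < c" using c Q0 by (cases c) auto
    moreover have "\<not> Q (c - 1)" using \<open>0 < c\<close> not_less_Least[of "c - 1" Q] by (simp add: c_def)
    ultimately have "yc (\<pi> (c - 1)) < yc (\<pi> c)"
      using c path_mono[OF \<pi>, of "c - 1" c] by (auto simp: Q_def le_iff_coords)
    with c \<open>0 < c\<close> show ?thesis by (auto simp: V_def)
  qed
  ultimately have c: "Max V \<in> V" and max: "\<And>k. k \<in> V \<Longrightarrow> k \<le> Max V" by auto
  define c where "c = Max V"
  have cV: "0 < c" "Q c" "yc (\<pi> (c - 1)) < yc (\<pi> c)" using c by (auto simp: V_def c_def)
  have "c < N" using cV(2) QN by (cases "c = N") (auto simp: Q_def)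
  have s1: "yc (\<pi> c) = Suc (yc (\<pi> (c - 1)))" "xc (\<pi> c) = xc (\<pi> (c - 1))"
    using path_step[OF \<pi>, of "c - 1"] cV \<open>c < N\<close> by auto
  have s2: "xc (\<pi> (Suc c)) = Suc (xc (\<pi> c))" "yc (\<pi> (Suc c)) = yc (\<pi> c)"
  proof -
    have "Suc c \<notin> V" using max[of "Suc c"] by (auto simp: c_def)
    then show "xc (\<pi> (Suc c)) = Suc (xc (\<pi> c))" "yc (\<pi> (Suc c)) = yc (\<pi> c)"
      using path_step[OF \<pi> \<open>c < N\<close>] cV(2) \<open>c < N\<close> by (auto simp: V_def Q_def)
  qed
  \<comment> \<open>The meet with \<sigma> keeps the first coordinate of
    \<open>\<pi> (Suc c)\<close> and lowers the second below that of \<open>\<pi> c\<close>; the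
    join with \<open>\<pi> (c - 1)\<close> then raises the second to exactly one less than that of
    \<open>\<pi> c\<close>. This shows that the flipped corner lies in the lattice.\<close>
  let ?g = "sup (inf (\<pi> (Suc c)) \<sigma>) (\<pi> (c - 1))"
  have g: "xc ?g = Suc (xc (\<pi> c))" "Suc (yc ?g) = yc (\<pi> c)"
    using s1 s2 cV(2) by (auto simp: xc_sup xc_inf yc_sup yc_inf Q_def)
  have "\<pi> (c - 1) \<le> \<pi> (Suc c)" using \<open>c < N\<close> by (intro path_mono[OF \<pi>]) auto
  moreover have "rk ?g = c" using g path_rk[OF \<pi>, of c] \<open>c < N\<close> by (simp add: rk_def)
  ultimately have "c \<in> descents \<pi>"
    unfolding descents_def using cV(1) \<open>c < N\<close> g(2) by (auto intro!: exI[of _ ?g] simp: le_infI1)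
  from comp[OF this] cV(2) show False by (auto simp: Q_def le_iff_coords)
qed

text \<open>Extend \<open>S\<close> to a maximal chain. It cannot skip a rank, since
  \<open>unit_step\<close> would supply an element in the gap that is comparable with the whole
  chain.\<close>

lemma path_through_chain:
  assumes "\<And>\<alpha> \<beta>. \<alpha> \<in> S \<Longrightarrow> \<beta> \<in> S \<Longrightarrow> \<alpha> \<le> \<beta> \<or> \<beta> \<le> \<alpha>"
  obtains \<pi> where "\<pi> \<in> lattice_paths" "\<And>\<alpha>. \<alpha> \<in> S \<Longrightarrow> \<pi> (rk \<alpha>) = \<alpha>"
proof -
  define ch where "ch T \<longleftrightarrow> S \<subseteq> T \<and> (\<forall>\<alpha>\<in>T. \<forall>\<beta>\<in>T. \<alpha> \<le> \<beta> \<or> \<beta> \<le> \<alpha>)" for T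
  have "finite {T. ch T}" "{T. ch T} \<noteq> {}" using assms by (auto simp: ch_def)
  then obtain T where T: "ch T" "\<And>U. ch U \<Longrightarrow> T \<subseteq> U \<Longrightarrow> U = T"
    using finite_has_maximal[of "{T. ch T}"] by blast
  have memT: "\<gamma> \<in> T" if "\<And>\<beta>. \<beta> \<in> T \<Longrightarrow> \<gamma> \<le> \<beta> \<or> \<beta> \<le> \<gamma>" for \<gamma>
    using T(2)[of "insert \<gamma> T"] T(1) that by (auto simp: ch_def)
  have ex: "\<exists>\<alpha>\<in>T. rk \<alpha> = i" if "i \<le> N" for i
    using that
  proof (induction i)
    case 0
    show ?case using memT[of least_element] rk_least by auto
  next
    case (Suc i)
    then obtain \<alpha> where \<alpha>: "\<alpha> \<in> T" "rk \<alpha> = i" by auto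
    \<comment> \<open>The greatest element guarantees that \<open>T\<close> continues above
      \<alpha>.\<close>
    obtain \<tau> where \<tau>: "\<And>\<alpha>. \<alpha> \<le> \<tau>" "rk \<tau> = N" using greatest_exists by blast
    have "\<tau> \<in> T" by (rule memT) (use \<tau> in auto)
    then obtain \<beta> where \<beta>: "\<beta> \<in> T" "i < rk \<beta>" "\<And>\<gamma>. \<gamma> \<in> T \<Longrightarrow> i < rk \<gamma> \<Longrightarrow> rk \<beta> \<le> rk \<gamma>"
      using ex_has_least_nat[of "\<lambda>\<beta>. \<beta> \<in> T \<and> i < rk \<beta>" \<tau> rk] Suc(2) \<tau>(2) by auto
    have cmp: "\<gamma> \<le> \<delta>" if "\<gamma> \<in> T" "\<delta> \<in> T" "rk \<gamma> \<le> rk \<delta>" for \<gamma> \<delta>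
      using T(1) that by (intro comparable_rk_le) (auto simp: ch_def)
    have "\<alpha> < \<beta>" using cmp[OF \<alpha>(1) \<beta>(1)] \<alpha>(2) \<beta>(2) by (auto simp: less_le)
    then obtain \<gamma> where \<gamma>: "\<alpha> < \<gamma>" "\<gamma> \<le> \<beta>" "rk \<gamma> = Suc (rk \<alpha>)" by (rule unit_step)
    have "\<gamma> \<in> T"
    proof (rule memT)
      fix \<delta> assume \<delta>: "\<delta> \<in> T"
      show "\<gamma> \<le> \<delta> \<or> \<delta> \<le> \<gamma>"
      proof (cases "rk \<delta> \<le> i")
        case True
        then have "\<delta> \<le> \<alpha>" using cmp[OF \<delta> \<alpha>(1)] \<alpha>(2) by simp
        then show ?thesis using \<gamma>(1) by auto
      next
        case False
        then have "\<beta> \<le> \<delta>" using cmp[OF \<beta>(1) \<delta>] \<beta>(3)[OF \<delta>] by simp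
        then show ?thesis using \<gamma>(2) by auto
      qed
    qed
    then show ?case using \<gamma>(3) \<alpha>(2) by auto
  qed
  define \<pi> where "\<pi> = (\<lambda>i\<in>{..N}. SOME \<alpha>. \<alpha> \<in> T \<and> rk \<alpha> = i)"
  have \<pi>: "\<pi> i \<in> T \<and> rk (\<pi> i) = i" if "i \<le> N" for i
    using someI_ex[of "\<lambda>\<alpha>. \<alpha> \<in> T \<and> rk \<alpha> = i"] ex[OF that] that by (auto simp: \<pi>_def)
  have cmp: "\<gamma> \<le> \<delta>" if "\<gamma> \<in> T" "\<delta> \<in> T" "rk \<gamma> \<le> rk \<delta>" for \<gamma> \<delta>
    using T(1) that by (intro comparable_rk_le) (auto simp: ch_def)
  show thesis
  proof (rule that)
    have "\<pi> \<in> {..N} \<rightarrow>\<^sub>E UNIV" by (simp add: \<pi>_def)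
    then show "\<pi> \<in> lattice_paths"
      using \<pi> by (auto simp: lattice_paths_def intro!: cmp)
    fix \<alpha> assume "\<alpha> \<in> S"
    then have "\<alpha> \<in> T" using T(1) by (auto simp: ch_def)
    then show "\<pi> (rk \<alpha>) = \<alpha>"
      using \<pi>[OF rk_le_N, of \<alpha>] by (intro order_antisym cmp) auto
  qed
qed

text \<open>Among the paths through \<open>S\<close>, one with least sum of second coordinates is
  taken: flipping it at a descent outside \<open>S\<close> would decrease this sum.\<close>

lemma lowest_path_through_chain:
  assumes "\<And>\<alpha> \<beta>. \<alpha> \<in> S \<Longrightarrow> \<beta> \<in> S \<Longrightarrow> \<alpha> \<le> \<beta> \<or> \<beta> \<le> \<alpha>"
  obtains \<pi> where "\<pi> \<in> lattice_paths" "\<And>\<alpha>. \<alpha> \<in> S \<Longrightarrow> \<pi> (rk \<alpha>) = \<alpha>" "\<And>i. i \<in> descents \<pi> \<Longrightarrow> \<pi> i \<in> S"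
proof -
  let ?P = "\<lambda>\<pi>. \<pi> \<in> lattice_paths \<and> (\<forall>\<alpha>\<in>S. \<pi> (rk \<alpha>) = \<alpha>)"
  let ?h = "\<lambda>\<pi>. \<Sum>i\<le>N. yc (\<pi> i)"
  obtain \<pi>0 where "\<pi>0 \<in> lattice_paths" "\<And>\<alpha>. \<alpha> \<in> S \<Longrightarrow> \<pi>0 (rk \<alpha>) = \<alpha>"
    using path_through_chain[of S] assms by metis
  then have "?P \<pi>0" by blast
  then obtain \<pi> where \<pi>: "?P \<pi>" "\<And>\<rho>. ?P \<rho> \<Longrightarrow> ?h \<pi> \<le> ?h \<rho>"
    using ex_has_least_nat[of ?P \<pi>0 ?h] by blast
  have path: "\<pi> \<in> lattice_paths" using \<pi>(1) by blast
  have "\<pi> i \<in> S" if i: "i \<in> descents \<pi>" for i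
  proof (rule ccontr)
    assume nS: "\<pi> i \<notin> S"
    obtain \<gamma> where \<gamma>: "0 < i" "i < N" "\<pi> (i - 1) \<le> \<gamma>" "\<gamma> \<le> \<pi> (Suc i)" "rk \<gamma> = i" "yc \<gamma> < yc (\<pi> i)"
      using i by (auto simp: descents_def)
    let ?r = "\<pi>(i := \<gamma>)"
    have "?r j \<le> ?r (Suc j)" if "j < N" for j
      using path_Suc[OF path that] \<gamma>(3,4) by (cases "j = i"; cases "Suc j = i") auto
    then have "?r \<in> lattice_paths"
      using path \<gamma>(2,5) by (auto simp: lattice_paths_def PiE_def extensional_def)
    moreover have "?r (rk \<alpha>) = \<alpha>" if "\<alpha> \<in> S" for \<alpha>
      using \<pi>(1) that nS by auto
    ultimately have "?h \<pi> \<le> ?h ?r" by (intro \<pi>(2)) blast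
    moreover have "?h ?r < ?h \<pi>"
      by (rule sum_strict_mono_ex1) (use \<gamma> in \<open>auto intro!: bexI[of _ i]\<close>)
    ultimately show False by simp
  qed
  then show thesis using \<pi>(1) that by blast
qed

lemma path_comparable:
  assumes "\<pi> \<in> lattice_paths" "i \<le> N" "j \<le> N"
  shows "\<pi> i \<le> \<pi> j \<or> \<pi> j \<le> \<pi> i"
  using path_mono[OF assms(1)] assms(2,3) by (metis nat_le_linear)

lemma descent_less_N: "i \<in> descents \<pi> \<Longrightarrow> i < N"
  by (simp add: descents_def)

text \<open>The corners of one path lie in \<open>S\<close> and therefore on the other path, so they
  are comparable with all its elements. Thus \<open>path_lowest\<close> applies in both
  directions.\<close>

lemma lowest_path_unique:
  assumes "\<pi> \<in> lattice_paths" "\<rho> \<in> lattice_paths"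
    and "\<And>\<alpha>. \<alpha> \<in> S \<Longrightarrow> \<pi> (rk \<alpha>) = \<alpha>" "\<And>i. i \<in> descents \<pi> \<Longrightarrow> \<pi> i \<in> S"
    and "\<And>\<alpha>. \<alpha> \<in> S \<Longrightarrow> \<rho> (rk \<alpha>) = \<alpha>" "\<And>i. i \<in> descents \<rho> \<Longrightarrow> \<rho> i \<in> S"
  shows "\<pi> = \<rho>"
proof (rule path_extensionality[OF assms(1,2)])
  fix i assume i: "i \<le> N"
  have *: "yc (\<mu> i) \<le> yc (\<nu> i)"
    if \<mu>: "\<mu> \<in> lattice_paths" and \<nu>: "\<nu> \<in> lattice_paths"
      and "\<And>i. i \<in> descents \<mu> \<Longrightarrow> \<mu> i \<in> S" "\<And>\<alpha>. \<alpha> \<in> S \<Longrightarrow> \<nu> (rk \<alpha>) = \<alpha>" for \<mu> \<nu>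
  proof -
    have "\<nu> i \<le> \<mu> k \<or> \<mu> k \<le> \<nu> i" if "k \<in> descents \<mu>" for k
      using path_comparable[OF \<nu> i rk_le_N, of "\<mu> k"] that(1) \<open>\<And>i. i \<in> descents \<mu> \<Longrightarrow> \<mu> i \<in> S\<close>[OF that]
        \<open>\<And>\<alpha>. \<alpha> \<in> S \<Longrightarrow> \<nu> (rk \<alpha>) = \<alpha>\<close>[of "\<mu> k"] by auto
    then show ?thesis using path_lowest[OF \<mu>, of "\<nu> i"] path_rk[OF \<nu> i] by simp
  qed
  show "yc (\<pi> i) = yc (\<rho> i)"
    using *[of \<pi> \<rho>] *[of \<rho> \<pi>] assms by (simp add: order_antisym)
qed

end

section \<open>A free basis of the Hibi ring indexed by lattice paths\<close>

context two_chains
begin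

section \<open>Multiplying out rank sums and corners\<close>

abbreviation path_index where "path_index \<equiv> expvecs (Suc N) \<times> lattice_paths"

definition multiplicity_at :: "(nat \<Rightarrow>\<^sub>0 nat) \<Rightarrow> (nat \<Rightarrow> 'a) \<Rightarrow> nat \<Rightarrow> nat" where
  "multiplicity_at u \<pi> i = lookup u i + (if i \<in> descents \<pi> then 1 else 0)"

text \<open>One slot for each linear factor of \<open>path_elem u \<pi>\<close>; the first component
  is the rank of that factor.\<close>

definition slots :: "(nat \<Rightarrow>\<^sub>0 nat) \<Rightarrow> (nat \<Rightarrow> 'a) \<Rightarrow> (nat \<times> nat) set" where
  "slots u \<pi> = (SIGMA i:{..N}. {..<multiplicity_at u \<pi> i})"

text \<open>The slots with \<open>l < lookup u i\<close> come from the power of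
  \<open>rank_sum i\<close>. The slot \<open>l = lookup u i\<close>, present only at a descent, is
  occupied by the corner.\<close>

definition choices :: "(nat \<Rightarrow>\<^sub>0 nat) \<Rightarrow> (nat \<Rightarrow> 'a) \<Rightarrow> nat \<times> nat \<Rightarrow> 'a set" where
  "choices u \<pi> = (\<lambda>(i, l). if l = lookup u i then {\<pi> i} else {\<alpha>. rk \<alpha> = i})"

definition selection_mset :: "(nat \<Rightarrow>\<^sub>0 nat) \<Rightarrow> (nat \<Rightarrow> 'a) \<Rightarrow> (nat \<times> nat \<Rightarrow> 'a) \<Rightarrow> 'a multiset" where
  "selection_mset u \<pi> g = image_mset g (mset_set (slots u \<pi>))"

text \<open>The leading term of the product, in which every slot takes the element of the
  path.\<close>

definition path_mset :: "(nat \<Rightarrow>\<^sub>0 nat) \<Rightarrow> (nat \<Rightarrow> 'a) \<Rightarrow> 'a multiset" where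
  "path_mset u \<pi> = selection_mset u \<pi> (\<lambda>k. \<pi> (fst k))"

definition rank_sum :: "nat \<Rightarrow> ('a, 'k::field) hibi_ring" where
  "rank_sum i = (\<Sum>\<alpha> | rk \<alpha> = i. hibi_elem \<alpha>)"

definition descent_monom :: "(nat \<Rightarrow> 'a) \<Rightarrow> ('a, 'k::field) hibi_ring" where
  "descent_monom \<pi> = hibi_monom (image_mset \<pi> (mset_set (descents \<pi>)))"

abbreviation path_elem :: "(nat \<Rightarrow>\<^sub>0 nat) \<Rightarrow> (nat \<Rightarrow> 'a) \<Rightarrow> ('a, 'k::field) hibi_ring" where
  "path_elem u \<pi> \<equiv> power_product rank_sum u * descent_monom \<pi>"

lemma finite_slots [simp]: "finite (slots u \<pi>)"
  by (simp add: slots_def)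

lemma hibi_monom_image: "hibi_monom (image_mset g (mset_set K)) = (\<Prod>k\<in>K. hibi_elem (g k))"
  by (simp add: hibi_monom_def prod_unfold_prod_mset image_mset.compositionality o_def)

lemma basis_expand:
  assumes "u \<in> expvecs (Suc N)"
  shows "path_elem u \<pi> =
    (\<Sum>g\<in>PiE (slots u \<pi>) (choices u \<pi>). hibi_monom (selection_mset u \<pi> g) :: ('a, 'k::field) hibi_ring)"
proof -
  have *: "(\<Prod>l<multiplicity_at u \<pi> i. \<Sum>\<alpha>\<in>choices u \<pi> (i, l). hibi_elem \<alpha>) =
      rank_sum i ^ lookup u i * (if i \<in> descents \<pi> then hibi_elem (\<pi> i) else 1 :: ('a, 'k) hibi_ring)" for i
  proof -
    have "(\<Prod>l<lookup u i. \<Sum>\<alpha>\<in>choices u \<pi> (i, l). hibi_elem \<alpha>) =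
        (rank_sum i ^ lookup u i :: ('a, 'k) hibi_ring)"
      by (simp add: choices_def rank_sum_def)
    then show ?thesis by (simp add: multiplicity_at_def) (simp add: choices_def)
  qed
  have "power_product rank_sum u = (\<Prod>i\<le>N. rank_sum i ^ lookup u i :: ('a, 'k) hibi_ring)"
    by (rule power_product_superset) (use assms in \<open>auto simp: expvecs_def less_Suc_eq_le subset_iff\<close>)
  moreover have "descent_monom \<pi> = (\<Prod>i\<le>N. if i \<in> descents \<pi> then hibi_elem (\<pi> i) else 1 :: ('a, 'k) hibi_ring)"
    unfolding descent_monom_def hibi_monom_image
    by (rule prod.mono_neutral_cong_left) (auto dest: descent_less_N)
  ultimately have "path_elem u \<pi> =
      (\<Prod>i\<le>N. \<Prod>l<multiplicity_at u \<pi> i. \<Sum>\<alpha>\<in>choices u \<pi> (i, l). hibi_elem \<alpha> :: ('a, 'k) hibi_ring)"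
    by (simp add: * prod.distrib)
  also have "\<dots> = (\<Prod>k\<in>slots u \<pi>. \<Sum>\<alpha>\<in>choices u \<pi> k. hibi_elem \<alpha>)"
    unfolding slots_def by (subst prod.Sigma) auto
  also have "\<dots> = (\<Sum>g\<in>PiE (slots u \<pi>) (choices u \<pi>). \<Prod>k\<in>slots u \<pi>. hibi_elem (g k))"
    by (rule prod_sum_PiE) auto
  finally show ?thesis by (simp add: selection_mset_def hibi_monom_image)
qed

section \<open>The numerical weight that singles out the leading term\<close>

abbreviation JJ :: "('a \<times> 'a) set" where "JJ \<equiv> join_irreducibles \<times> join_irreducibles"

text \<open>For the weight of a chain this is the sum of squared ranks: the entries above
  \<open>p\<close> and those above \<open>q\<close> are nested, so the smaller number counts the
  entries above both.\<close>

definition nesting :: "('a \<Rightarrow> nat) \<Rightarrow> nat" where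
  "nesting v = (\<Sum>(p, q)\<in>JJ. min (v p) (v q))"

definition yc_weight :: "('a \<Rightarrow> nat) \<Rightarrow> nat" where
  "yc_weight v = (\<Sum>q\<in>C2. v q)"

text \<open>Encodes a lexicographic comparison in one number: for the weight \<open>v\<close> of a
  monomial, \<open>yc_weight v\<close> is at most \<open>v least_element * N\<close>, one less than
  the factor of \<open>nesting v\<close>.\<close>

definition total_weight :: "('a \<Rightarrow> nat) \<Rightarrow> nat" where
  "total_weight v = nesting v * Suc (v least_element * N) + yc_weight v"

lemma hibi_weight_image:
  "p \<in> join_irreducibles \<Longrightarrow> finite K \<Longrightarrow>
    hibi_weight (image_mset g (mset_set K)) p = card {k \<in> K. p \<le> (g k :: 'a)}"
  by (simp add: hibi_weight_def join_primes_eq filter_mset_image_mset)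

lemma yc_weight_image:
  assumes "finite K"
  shows "yc_weight (hibi_weight (image_mset g (mset_set K))) = (\<Sum>k\<in>K. yc (g k))"
proof -
  have "yc_weight (hibi_weight (image_mset g (mset_set K))) = (\<Sum>q\<in>C2. card {k \<in> K. q \<le> g k})"
    unfolding yc_weight_def
  proof (rule sum.cong[OF refl])
    fix q assume "q \<in> C2"
    then have "q \<in> join_irreducibles" using Un_chains by blast
    with assms show "hibi_weight (image_mset g (mset_set K)) q = card {k \<in> K. q \<le> g k}"
      by (simp add: hibi_weight_image)
  qed
  also have "\<dots> = (\<Sum>q\<in>C2. \<Sum>k\<in>K. if q \<le> g k then 1 else 0)"
    using assms by (intro sum.cong) (auto simp: sum.If_cases Int_def)
  also have "\<dots> = (\<Sum>k\<in>K. \<Sum>q\<in>C2. if q \<le> g k then 1 else 0)" by (rule sum.swap)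
  also have "\<dots> = (\<Sum>k\<in>K. yc (g k))"
    unfolding yc_def by (intro sum.cong) (auto simp: sum.If_cases Int_def)
  finally show ?thesis .
qed

text \<open>The square of a rank counts pairs of join-irreducibles below the element; the two
  summations are then exchanged.\<close>

lemma sum_rk_squared:
  assumes "finite K"
  shows "(\<Sum>k\<in>K. (rk (g k))\<^sup>2) =
    (\<Sum>(p, q)\<in>JJ. card {k \<in> K. p \<le> g k \<and> q \<le> g k})"
proof -
  have "(rk \<alpha>)\<^sup>2 = (\<Sum>(p, q)\<in>JJ. if p \<le> \<alpha> \<and> q \<le> \<alpha> then 1 else 0)" for \<alpha>
  proof -
    have "(rk \<alpha>)\<^sup>2 = card ({p \<in> join_irreducibles. p \<le> \<alpha>} \<times> {p \<in> join_irreducibles. p \<le> \<alpha>})"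
      by (simp add: rk_eq_card power2_eq_square)
    also have "{p \<in> join_irreducibles. p \<le> \<alpha>} \<times> {p \<in> join_irreducibles. p \<le> \<alpha>} =
        {x \<in> JJ. fst x \<le> \<alpha> \<and> snd x \<le> \<alpha>}" by auto
    also have "card \<dots> = (\<Sum>x\<in>JJ. if fst x \<le> \<alpha> \<and> snd x \<le> \<alpha> then 1 else 0)"
      by (simp add: sum.If_cases Int_def)
    finally show ?thesis by (simp add: split_def)
  qed
  then have "(\<Sum>k\<in>K. (rk (g k))\<^sup>2) =
      (\<Sum>k\<in>K. \<Sum>(p, q)\<in>JJ. if p \<le> g k \<and> q \<le> g k then 1 else 0)" by simp
  also have "\<dots> = (\<Sum>(p, q)\<in>JJ. \<Sum>k\<in>K. if p \<le> g k \<and> q \<le> g k then 1 else 0)"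
    by (subst sum.swap) (simp add: split_def)
  also have "\<dots> = (\<Sum>(p, q)\<in>JJ. card {k \<in> K. p \<le> g k \<and> q \<le> g k})"
    using assms by (intro sum.cong) (auto simp: sum.If_cases Int_def)
  finally show ?thesis .
qed

lemma nesting_image:
  "finite K \<Longrightarrow> nesting (hibi_weight (image_mset g (mset_set K))) =
    (\<Sum>(p, q)\<in>JJ. min (card {k \<in> K. p \<le> g k}) (card {k \<in> K. q \<le> g k}))"
  unfolding nesting_def by (intro sum.cong) (auto simp: hibi_weight_image)

lemma card_both_le_min:
  assumes "finite K"
  shows "card {k \<in> K. P k \<and> Q k} \<le> min (card {k \<in> K. P k}) (card {k \<in> K. Q k})"
  using assms by (auto intro!: card_mono)

lemma sum_rk_squared_le_nesting:
  assumes "finite K"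
  shows "(\<Sum>k\<in>K. (rk (g k))\<^sup>2) \<le> nesting (hibi_weight (image_mset g (mset_set K)))"
  unfolding sum_rk_squared[OF assms] nesting_image[OF assms]
  using card_both_le_min[OF assms] by (auto intro!: sum_mono)

lemma nesting_chain:
  assumes "finite K" "\<And>k l. k \<in> K \<Longrightarrow> l \<in> K \<Longrightarrow> g k \<le> g l \<or> g l \<le> g k"
  shows "nesting (hibi_weight (image_mset g (mset_set K))) = (\<Sum>k\<in>K. (rk (g k))\<^sup>2)"
  unfolding sum_rk_squared[OF assms(1)] nesting_image[OF assms(1)]
proof (rule sum.cong[OF refl], clarify)
  fix p q :: 'a
  have "{k \<in> K. p \<le> g k \<and> q \<le> g k} = {k \<in> K. p \<le> g k} \<inter> {k \<in> K. q \<le> g k}" by auto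
  moreover have "{k \<in> K. p \<le> g k} \<subseteq> {k \<in> K. q \<le> g k} \<or> {k \<in> K. q \<le> g k} \<subseteq> {k \<in> K. p \<le> g k}"
  proof (rule ccontr)
    assume "\<not> ?thesis"
    then obtain k l where "k \<in> K" "p \<le> g k" "\<not> q \<le> g k" "l \<in> K" "q \<le> g l" "\<not> p \<le> g l" by blast
    then show False using assms(2)[of k l] by (meson order_trans)
  qed
  ultimately show "min (card {k \<in> K. p \<le> g k}) (card {k \<in> K. q \<le> g k}) = card {k \<in> K. p \<le> g k \<and> q \<le> g k}"
    using assms(1) by (simp add: card_Int_nested)
qed

text \<open>If \<open>g k\<close> and \<open>g l\<close> are incomparable, choose a join-irreducible
  \<open>p\<close> below the first only and \<open>q\<close> below the second only: the inequality
  is strict at \<open>(p, q)\<close>.\<close>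

lemma nesting_eq_imp_chain:
  assumes "finite K" "nesting (hibi_weight (image_mset g (mset_set K))) \<le> (\<Sum>k\<in>K. (rk (g k))\<^sup>2)"
    "k \<in> K" "l \<in> K"
  shows "g k \<le> g l \<or> g l \<le> g k"
proof (rule ccontr)
  assume incomp: "\<not> ?thesis"
  have "\<exists>p\<in>join_irreducibles. p \<le> \<alpha> \<and> \<not> p \<le> \<beta>" if "\<not> \<alpha> \<le> \<beta>" for \<alpha> \<beta> :: 'a
  proof (rule ccontr)
    assume *: "\<not> ?thesis"
    have "\<alpha> \<le> \<beta>" by (rule join_primes_dense) (use * in \<open>auto simp: join_primes_eq\<close>)
    with that show False ..
  qed
  then obtain p q where p: "p \<in> join_irreducibles" "p \<le> g k" "\<not> p \<le> g l"
    and q: "q \<in> join_irreducibles" "q \<le> g l" "\<not> q \<le> g k"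
    using incomp by metis
  have "card {k \<in> K. p \<le> g k \<and> q \<le> g k} < card {k \<in> K. p \<le> g k}"
    "card {k \<in> K. p \<le> g k \<and> q \<le> g k} < card {k \<in> K. q \<le> g k}"
    using assms(1,3,4) p q by (auto intro!: psubset_card_mono)
  then have "(\<Sum>(p, q)\<in>JJ. card {k \<in> K. p \<le> g k \<and> q \<le> g k})
      < (\<Sum>(p, q)\<in>JJ. min (card {k \<in> K. p \<le> g k}) (card {k \<in> K. q \<le> g k}))"
    using card_both_le_min[OF assms(1)] p q
    by (intro sum_strict_mono_ex1) (auto intro!: bexI[of _ "(p, q)"])
  then show False
    using assms(2) unfolding sum_rk_squared[OF assms(1)] nesting_image[OF assms(1)] by simp
qed

lemma yc_le_N: "yc \<alpha> \<le> N"
  using rk_le_N[of \<alpha>] by (simp add: rk_def)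

lemma slots_iff: "(i, l) \<in> slots u \<pi> \<longleftrightarrow> i \<le> N \<and> l < multiplicity_at u \<pi> i"
  by (auto simp: slots_def)

text \<open>All selections have the same ranks. If \<open>nesting\<close> does not grow, the
  selection is a chain containing the corners of \<pi>, and \<open>path_lowest\<close> compares it
  with the path slot by slot. Otherwise the growth by at least one outweighs the whole
  \<open>yc_weight\<close> of the leading term.\<close>

lemma total_weight_selection:
  assumes \<pi>: "\<pi> \<in> lattice_paths" and g: "g \<in> PiE (slots u \<pi>) (choices u \<pi>)"
    and ne: "g \<noteq> restrict (\<lambda>k. \<pi> (fst k)) (slots u \<pi>)"
  shows "total_weight (hibi_weight (path_mset u \<pi>)) < total_weight (hibi_weight (selection_mset u \<pi> g))"
proof -
  let ?K = "slots u \<pi>" and ?g0 = "\<lambda>k :: nat \<times> nat. \<pi> (fst k)"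
  let ?v = "hibi_weight (path_mset u \<pi>)" and ?w = "hibi_weight (selection_mset u \<pi> g)"
  note mset_defs = path_mset_def selection_mset_def
  have g_in: "g k \<in> choices u \<pi> k" if "k \<in> ?K" for k using g that by auto
  have rkg: "rk (g k) = fst k" if "k \<in> ?K" for k
    using g_in[OF that] that path_rk[OF \<pi>] by (auto simp: choices_def slots_iff split: if_splits)
  have rk0: "rk (?g0 k) = fst k" if "k \<in> ?K" for k
    using that path_rk[OF \<pi>] by (cases k) (auto simp: slots_iff)
  have n0: "nesting ?v = (\<Sum>k\<in>?K. (fst k)\<^sup>2)"
  proof -
    have "nesting ?v = (\<Sum>k\<in>?K. (rk (?g0 k))\<^sup>2)"
      unfolding mset_defs by (intro nesting_chain path_comparable[OF \<pi>]) (auto simp: slots_iff)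
    then show ?thesis by (simp add: rk0)
  qed
  have ng: "(\<Sum>k\<in>?K. (fst k)\<^sup>2) \<le> nesting ?w"
    using sum_rk_squared_le_nesting[OF finite_slots, of g u \<pi>] rkg by (simp add: mset_defs)
  have size: "?v least_element = card ?K" "?w least_element = card ?K"
    by (simp_all add: mset_defs)
  have yv: "yc_weight ?v = (\<Sum>k\<in>?K. yc (?g0 k))" and yw: "yc_weight ?w = (\<Sum>k\<in>?K. yc (g k))"
    unfolding mset_defs by (simp_all add: yc_weight_image)
  show ?thesis
  proof (cases "nesting ?w \<le> nesting ?v")
    case True
    with n0 have "nesting ?w \<le> (\<Sum>k\<in>?K. (rk (g k))\<^sup>2)" by (simp add: rkg)
    then have chain: "g k \<le> g l \<or> g l \<le> g k" if "k \<in> ?K" "l \<in> ?K" for k l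
      using nesting_eq_imp_chain[OF finite_slots, of g u \<pi> k l] that by (simp add: mset_defs)
    have le: "yc (?g0 k) \<le> yc (g k)" if k: "k \<in> ?K" for k
    proof -
      have "g k \<le> \<pi> i \<or> \<pi> i \<le> g k" if i: "i \<in> descents \<pi>" for i
      proof -
        \<comment> \<open>The corner at \<open>i\<close> sits in the slot where the choice is
          forced, so every selection contains it.\<close>
        have l: "(i, lookup u i) \<in> ?K"
          using i descent_less_N[OF i] by (simp add: slots_iff multiplicity_at_def)
        from g_in[OF l] have "g (i, lookup u i) = \<pi> i" by (simp add: choices_def)
        with chain[OF k l] show ?thesis by simp
      qed
      from path_lowest[OF \<pi> this] show ?thesis by (simp add: rkg[OF k])
    qed
    obtain k where k: "k \<in> ?K" "g k \<noteq> ?g0 k"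
      using ne g by (metis (no_types, lifting) PiE_restrict restrict_ext)
    then have "yc (g k) \<noteq> yc (?g0 k)" using rk_yc_eqI rkg rk0 by metis
    then have "yc_weight ?v < yc_weight ?w"
      unfolding yv yw using le k by (intro sum_strict_mono_ex1) (auto intro!: bexI[of _ k] simp: order.strict_iff_order)
    moreover have "nesting ?v = nesting ?w" using True n0 ng by simp
    ultimately show ?thesis unfolding total_weight_def size by simp
  next
    case False
    have "yc_weight ?v \<le> card ?K * N"
      unfolding yv using sum_bounded_above[of ?K "\<lambda>k. yc (?g0 k)" N] yc_le_N by simp
    then have "total_weight ?v < nesting ?v * Suc (card ?K * N) + Suc (card ?K * N)"
      unfolding total_weight_def size by simp
    also have "\<dots> = Suc (nesting ?v) * Suc (card ?K * N)" by simp
    also have "\<dots> \<le> nesting ?w * Suc (card ?K * N)"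
      using False by (intro mult_le_mono1) simp
    also have "\<dots> \<le> total_weight ?w" unfolding total_weight_def size by simp
    finally show ?thesis .
  qed
qed

section \<open>Unitriangularity and the resulting basis\<close>

lemma size_path_mset: "size (selection_mset u \<pi> g) = size (path_mset u \<pi>)"
  by (simp add: path_mset_def selection_mset_def)

lemma basis_triangular:
  assumes "u \<in> expvecs (Suc N)" "\<pi> \<in> lattice_paths"
  obtains G where "finite G"
    "path_elem u \<pi> = hibi_monom (path_mset u \<pi>) +
       (\<Sum>g\<in>G. hibi_monom (selection_mset u \<pi> g) :: ('a, 'k::field) hibi_ring)"
    "\<And>g. g \<in> G \<Longrightarrow>
       total_weight (hibi_weight (path_mset u \<pi>)) < total_weight (hibi_weight (selection_mset u \<pi> g))"
proof -
  let ?g0 = "restrict (\<lambda>k. \<pi> (fst k)) (slots u \<pi>)" and ?P = "PiE (slots u \<pi>) (choices u \<pi>)"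
  have fin: "finite ?P" by (rule finite_PiE) auto
  have g0: "?g0 \<in> ?P"
    using path_rk[OF assms(2)] by (auto simp: choices_def slots_iff)
  have "selection_mset u \<pi> ?g0 = path_mset u \<pi>"
    unfolding path_mset_def selection_mset_def by (rule image_mset_cong) simp
  with basis_expand[OF assms(1), of \<pi>] fin g0
  have "path_elem u \<pi> = hibi_monom (path_mset u \<pi>) +
       (\<Sum>g\<in>?P - {?g0}. hibi_monom (selection_mset u \<pi> g) :: ('a, 'k) hibi_ring)"
    by (simp add: sum.remove)
  with fin total_weight_selection[OF assms(2)] show thesis
    by (intro that[of "?P - {?g0}"]) auto
qed

text \<open>A crude bound in terms of the number of factors, which is the same for all terms of an
  expansion; it makes upward induction on \<open>total_weight\<close> possible.\<close>

lemma total_weight_bound: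
  "total_weight (hibi_weight Z) \<le> N * N * size Z * Suc (size Z * N) + N * size Z"
proof -
  have le: "hibi_weight Z p \<le> size Z" for p
    by (simp add: hibi_weight_def size_filter_mset_lesseq)
  have "nesting (hibi_weight Z) \<le> (\<Sum>x\<in>JJ. size Z)"
    unfolding nesting_def split_def by (rule sum_mono) (simp add: min_le_iff_disj le)
  then have 1: "nesting (hibi_weight Z) \<le> N * N * size Z"
    by (simp add: N_def)
  have "yc_weight (hibi_weight Z) \<le> (\<Sum>q\<in>C2. size Z)"
    unfolding yc_weight_def using le by (intro sum_mono)
  also have "\<dots> = card C2 * size Z" by simp
  also have "\<dots> \<le> N * size Z"
    unfolding N_def using Un_chains by (intro mult_le_mono1 card_mono) auto
  finally show ?thesis
    unfolding total_weight_def hibi_weight_least using 1 by (intro add_mono mult_le_mono1)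
qed

lemma count_path_mset:
  assumes "\<pi> \<in> lattice_paths" "i \<le> N"
  shows "count (path_mset u \<pi>) (\<pi> i) = multiplicity_at u \<pi> i"
proof -
  have inj: "\<pi> j = \<pi> i \<longleftrightarrow> j = i" if "j \<le> N" for j
    using path_rk[OF assms(1)] assms(2) that by metis
  have "{k \<in> slots u \<pi>. \<pi> (fst k) = \<pi> i} = {i} \<times> {..<multiplicity_at u \<pi> i}"
    using assms(2) inj by (auto simp: slots_iff)
  moreover have "count (path_mset u \<pi>) (\<pi> i) = (\<Sum>k | k \<in> slots u \<pi> \<and> \<pi> (fst k) = \<pi> i. 1)"
    unfolding path_mset_def selection_mset_def count_image_mset'
    by (rule sum.cong) auto
  ultimately show ?thesis by simp
qed

lemma set_path_mset: "set_mset (path_mset u \<pi>) = {\<pi> i | i. i \<le> N \<and> 0 < multiplicity_at u \<pi> i}"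
proof -
  have "set_mset (path_mset u \<pi>) = (\<lambda>k. \<pi> (fst k)) ` slots u \<pi>"
    by (simp add: path_mset_def selection_mset_def)
  also have "\<dots> = {\<pi> i | i. i \<le> N \<and> 0 < multiplicity_at u \<pi> i}"
    by (force simp: slots_def)
  finally show ?thesis .
qed

lemma chain_path_mset:
  assumes "\<pi> \<in> lattice_paths"
  shows "chain_mset (path_mset u \<pi>)"
  using path_comparable[OF assms] by (auto simp: chain_mset_def set_path_mset)

text \<open>The path is recovered as the lowest one through the support of the multiset, and then
  \<open>u\<close> from the multiplicities.\<close>

lemma path_mset_inj:
  assumes "u \<in> expvecs (Suc N)" "\<pi> \<in> lattice_paths" "w \<in> expvecs (Suc N)" "\<rho> \<in> lattice_paths"
    and eq: "path_mset u \<pi> = path_mset w \<rho>"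
  shows "u = w \<and> \<pi> = \<rho>"
proof
  let ?S = "set_mset (path_mset u \<pi>)"
  have *: "\<mu> (rk \<alpha>) = \<alpha>" if "\<mu> \<in> lattice_paths" "\<alpha> \<in># path_mset t \<mu>" for \<mu> \<alpha> t
    using that path_rk[OF that(1)] by (auto simp: set_path_mset)
  have **: "\<mu> i \<in># path_mset t \<mu>" if "i \<in> descents \<mu>" for \<mu> i t
    using descent_less_N[OF that] that by (auto simp: set_path_mset multiplicity_at_def intro!: exI[of _ i])
  show \<pi>\<rho>: "\<pi> = \<rho>"
    by (rule lowest_path_unique[OF assms(2,4), of ?S])
       (use *[OF assms(2), of _ u] *[OF assms(4), of _ w] **[of _ \<pi> u] **[of _ \<rho> w] eq in auto)
  show "u = w"
  proof (rule poly_mapping_eqI)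
    fix i
    show "lookup u i = lookup w i"
    proof (cases "i \<le> N")
      case True
      then show ?thesis
        using count_path_mset[OF assms(2) True, of u] count_path_mset[OF assms(4) True, of w] eq \<pi>\<rho>
        by (simp add: multiplicity_at_def)
    next
      case False
      then have "i \<notin> keys u" "i \<notin> keys w"
        using assms(1,3) by (auto simp: expvecs_def)
      then show ?thesis by (simp add: in_keys_iff)
    qed
  qed
qed

lemma path_mset_surj:
  assumes "chain_mset Z"
  obtains u \<pi> where "u \<in> expvecs (Suc N)" "\<pi> \<in> lattice_paths" "path_mset u \<pi> = Z"
proof -
  obtain \<pi> where \<pi>: "\<pi> \<in> lattice_paths" "\<And>\<alpha>. \<alpha> \<in># Z \<Longrightarrow> \<pi> (rk \<alpha>) = \<alpha>" "\<And>i. i \<in> descents \<pi> \<Longrightarrow> \<pi> i \<in># Z"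
    using lowest_path_through_chain[of "set_mset Z"] assms by (auto simp: chain_mset_def)
  \<comment> \<open>The truncated subtraction is exact: a descent of the chosen path lies in
    \<open>Z\<close> and so has positive multiplicity.\<close>
  define u where "u = (\<Sum>i\<in>{..N}. single i (count Z (\<pi> i) - (if i \<in> descents \<pi> then 1 else 0)))"
  have lu: "lookup u i = (if i \<le> N then count Z (\<pi> i) - (if i \<in> descents \<pi> then 1 else 0) else 0)" for i
    by (simp add: u_def lookup_sum_single)
  have "u \<in> expvecs (Suc N)"
    unfolding expvecs_def by (auto simp: in_keys_iff lu split: if_splits)
  moreover have "path_mset u \<pi> = Z"
  proof (rule multiset_eqI)
    fix \<alpha>
    have m: "multiplicity_at u \<pi> i = count Z (\<pi> i)" if "i \<le> N" for i
      using that \<pi>(3)[of i] by (auto simp: multiplicity_at_def lu Suc_le_eq simp flip: count_greater_zero_iff)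
    show "count (path_mset u \<pi>) \<alpha> = count Z \<alpha>"
    proof (cases "\<pi> (rk \<alpha>) = \<alpha>")
      case True
      then show ?thesis using count_path_mset[OF \<pi>(1) rk_le_N, of u \<alpha>] m[OF rk_le_N, of \<alpha>] by simp
    next
      case False
      then have "\<alpha> \<notin># Z" "\<alpha> \<notin># path_mset u \<pi>"
        using \<pi>(2) path_rk[OF \<pi>(1)] by (auto simp: set_path_mset)
      then show ?thesis by (simp add: not_in_iff)
    qed
  qed
  ultimately show thesis using \<pi>(1) that by blast
qed

text \<open>Distinct indices have distinct leading weights and all further terms are larger. In a
  relation, the leading monomial of an index of least \<open>total_weight\<close> with nonzero
  coefficient cannot be cancelled.\<close>

lemma basis_independent:
  "linear_families.independent_family (hibi_scale :: 'k::field \<Rightarrow> ('a, 'k) hibi_ring \<Rightarrow> _)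
     (\<lambda>(u, \<pi>). path_elem u \<pi>) (path_index)"
proof -
  interpret graded_algebra "hibi_scale :: 'k \<Rightarrow> ('a, 'k) hibi_ring \<Rightarrow> _" hibi_component
    by (rule graded_algebra_hibi)
  let ?I = "path_index"
  let ?f = "\<lambda>(u, \<pi>). path_elem u \<pi> :: ('a, 'k) hibi_ring"
  let ?hw = "\<lambda>(u, \<pi>). hibi_weight (path_mset u \<pi>)"
  have coeff: "hibi_coeff (?hw i) (?f j) = (if j = i then 1 else 0)"
    if "i \<in> ?I" "j \<in> ?I" "total_weight (?hw i) \<le> total_weight (?hw j)" for i j
  proof -
    obtain u \<pi> w \<rho> where ij: "i = (u, \<pi>)" "j = (w, \<rho>)" by (cases i; cases j)
    then have mem: "u \<in> expvecs (Suc N)" "\<pi> \<in> lattice_paths" "w \<in> expvecs (Suc N)" "\<rho> \<in> lattice_paths"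
      using that by auto
    obtain G where G: "finite G"
      "path_elem w \<rho> = hibi_monom (path_mset w \<rho>) +
         (\<Sum>g\<in>G. hibi_monom (selection_mset w \<rho> g) :: ('a, 'k) hibi_ring)"
      "\<And>g. g \<in> G \<Longrightarrow>
         total_weight (hibi_weight (path_mset w \<rho>)) < total_weight (hibi_weight (selection_mset w \<rho> g))"
      by (rule basis_triangular[OF mem(3,4)]) blast
    have cm: "hibi_coeff v (hibi_monom Z :: ('a, 'k) hibi_ring) = (if hibi_weight Z = v then 1 else 0)" for v Z
      using hibi_coeff_monom[of v "1 :: 'k" Z] by simp
    have "hibi_coeff (hibi_weight (path_mset u \<pi>)) (\<Sum>g\<in>G. hibi_monom (selection_mset w \<rho> g) :: ('a, 'k) hibi_ring) = 0"
      unfolding hibi_coeff_sum cm using G(3) that(3) ij by (intro sum.neutral) force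
    moreover have "hibi_weight (path_mset w \<rho>) = hibi_weight (path_mset u \<pi>) \<longleftrightarrow> j = i"
    proof
      assume "hibi_weight (path_mset w \<rho>) = hibi_weight (path_mset u \<pi>)"
      then have "path_mset w \<rho> = path_mset u \<pi>"
        by (rule chain_mset_eqI[OF chain_path_mset[OF mem(4)] chain_path_mset[OF mem(2)]])
      from path_mset_inj[OF mem this[symmetric]] show "j = i" by (simp add: ij)
    qed (simp add: ij)
    ultimately show ?thesis by (simp add: ij G(2) hibi_coeff_add cm)
  qed
  show ?thesis
    unfolding independent_family_def
  proof (intro allI impI, rule ccontr)
    fix F and c :: "_ \<Rightarrow> 'k"
    assume F: "finite F" "F \<subseteq> ?I" "(\<Sum>i\<in>F. hibi_scale (c i) (?f i)) = 0" "\<not> (\<forall>i\<in>F. c i = 0)"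
    then obtain i where i: "i \<in> F" "c i \<noteq> 0"
      "\<And>j. j \<in> F \<Longrightarrow> c j \<noteq> 0 \<Longrightarrow> total_weight (?hw i) \<le> total_weight (?hw j)"
      using ex_has_least_nat[of "\<lambda>i. i \<in> F \<and> c i \<noteq> 0" _ "\<lambda>i. total_weight (?hw i)"] by blast
    have "0 = hibi_coeff (?hw i) (\<Sum>i\<in>F. hibi_scale (c i) (?f i))" by (simp only: F(3) hibi_coeff_zero)
    also have "\<dots> = (\<Sum>j\<in>F. c j * hibi_coeff (?hw i) (?f j))"
      by (simp only: hibi_coeff_sum hibi_coeff_scale)
    also have "\<dots> = (\<Sum>j\<in>F. if j = i then c i else 0)"
    proof (rule sum.cong[OF refl])
      fix j assume j: "j \<in> F"
      show "c j * hibi_coeff (?hw i) (?f j) = (if j = i then c i else 0)"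
      proof (cases "c j = 0")
        case False
        have "hibi_coeff (?hw i) (?f j) = (if j = i then 1 else 0)"
          by (rule coeff) (use F(2) i(1) j i(3)[OF j False] in blast)+
        then show ?thesis by (simp only: if_distrib mult_1_right mult_zero_right cong: if_cong) auto
      qed (use i(2) in auto)
    qed
    also have "\<dots> = c i" using F(1) i(1) by simp
    finally show False using i(2) by simp
  qed
qed

text \<open>The triangular expansion is solved for its leading monomial; the remaining terms have
  the same size and larger \<open>total_weight\<close>, so the distance to the bound
  decreases.\<close>

lemma basis_spans:
  "module.span (hibi_scale :: 'k::field \<Rightarrow> ('a, 'k) hibi_ring \<Rightarrow> _)
     ((\<lambda>(u, \<pi>). path_elem u \<pi>) ` (path_index)) = UNIV"
proof -
  interpret graded_algebra "hibi_scale :: 'k \<Rightarrow> ('a, 'k) hibi_ring \<Rightarrow> _" hibi_component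
    by (rule graded_algebra_hibi)
  let ?I = "path_index"
  let ?f = "\<lambda>(u, \<pi>). path_elem u \<pi> :: ('a, 'k) hibi_ring"
  define bound where "bound s = N * N * s * Suc (s * N) + N * s" for s
  have mono: "hibi_monom Z \<in> span (?f ` ?I)" for Z
  proof (induction "bound (size Z) - total_weight (hibi_weight Z)" arbitrary: Z rule: less_induct)
    case less
    obtain Z' where Z': "chain_mset Z'" "hibi_weight Z = hibi_weight Z'"
      "(hibi_monom Z :: ('a, 'k) hibi_ring) = hibi_monom Z'"
      using hibi_monom_chain[of Z] by blast
    obtain u \<pi> where u: "u \<in> expvecs (Suc N)" "\<pi> \<in> lattice_paths" "path_mset u \<pi> = Z'"
      using path_mset_surj[OF Z'(1)] .
    obtain G where G: "finite G"
      "path_elem u \<pi> = hibi_monom (path_mset u \<pi>) +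
         (\<Sum>g\<in>G. hibi_monom (selection_mset u \<pi> g) :: ('a, 'k) hibi_ring)"
      "\<And>g. g \<in> G \<Longrightarrow>
         total_weight (hibi_weight (path_mset u \<pi>)) < total_weight (hibi_weight (selection_mset u \<pi> g))"
      by (rule basis_triangular[OF u(1,2)]) blast
    have size: "size Z' = size Z" using Z'(2) by (metis hibi_weight_least)
    have "hibi_monom (selection_mset u \<pi> g) \<in> span (?f ` ?I)" if g: "g \<in> G" for g
    proof (rule less.hyps)
      have s: "size (selection_mset u \<pi> g) = size Z" using size_path_mset[of u \<pi> g] u(3) size by simp
      have "total_weight (hibi_weight (selection_mset u \<pi> g)) \<le> bound (size Z)"
        using total_weight_bound[of "selection_mset u \<pi> g"] by (simp add: s bound_def)
      then show "bound (size (selection_mset u \<pi> g)) - total_weight (hibi_weight (selection_mset u \<pi> g))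
          < bound (size Z) - total_weight (hibi_weight Z)"
        using G(3)[OF g] u(3) Z'(2) by (simp add: s)
    qed
    then have "(\<Sum>g\<in>G. hibi_monom (selection_mset u \<pi> g)) \<in> span (?f ` ?I)" by (rule span_sum)
    moreover have "path_elem u \<pi> \<in> span (?f ` ?I)"
      using u by (intro span_base) force
    moreover have "(hibi_monom Z :: ('a, 'k) hibi_ring) = path_elem u \<pi> -
        (\<Sum>g\<in>G. hibi_monom (selection_mset u \<pi> g))"
      using G(2) Z'(3) u(3) by simp
    ultimately show ?case by (simp only: span_diff)
  qed
  have "r \<in> span (?f ` ?I)" for r
  proof -
    obtain F where "r = (\<Sum>Z\<in>F. hibi_scale (hibi_coeff (hibi_weight Z) r) (hibi_monom Z))"
      by (rule hibi_expand[of r])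
    then show ?thesis using mono by (metis (no_types, lifting) span_scale span_sum)
  qed
  then show ?thesis by auto
qed

text \<open>Read off from independence at exponent vector 0. The basis has to be a set of ring
  elements, and injectivity allows passing back to paths.\<close>

lemma inj_descent_monom:
  "inj_on (descent_monom :: _ \<Rightarrow> ('a, 'k::field) hibi_ring) lattice_paths"
proof -
  interpret graded_algebra "hibi_scale :: 'k \<Rightarrow> ('a, 'k) hibi_ring \<Rightarrow> _" hibi_component
    by (rule graded_algebra_hibi)
  show ?thesis
  proof (rule inj_onI)
    fix \<pi> \<rho> assume *: "\<pi> \<in> lattice_paths" "\<rho> \<in> lattice_paths"
      "(descent_monom \<pi> :: ('a, 'k) hibi_ring) = descent_monom \<rho>"
    have "(0 :: nat \<Rightarrow>\<^sub>0 nat, \<pi>) = (0, \<rho>)"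
      by (rule inj_onD[OF independent_family_inj_on[OF basis_independent]]) (use * in auto)
    then show "\<pi> = \<rho>" by simp
  qed
qed

text \<open>The parameters are the \<open>Suc N\<close> rank sums, all of degree 1, one for each
  rank from 0 to \<open>N\<close>. A basis element gets its degree from the path that it
  determines.\<close>

lemma normalized_hibi:
  "normalized_algebra (hibi_scale :: 'k::field \<Rightarrow> ('a, 'k) hibi_ring \<Rightarrow> _) hibi_component (Suc N) (\<lambda>_. 1)
     rank_sum (descent_monom ` lattice_paths)
     (\<lambda>b. int (card (descents (inv_into lattice_paths (descent_monom :: _ \<Rightarrow> ('a, 'k) hibi_ring) b))))"
  (is "normalized_algebra _ _ _ _ _ ?B ?deg")
proof -
  interpret graded_algebra "hibi_scale :: 'k \<Rightarrow> ('a, 'k) hibi_ring \<Rightarrow> _" hibi_component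
    by (rule graded_algebra_hibi)
  have elem: "(hibi_elem \<alpha> :: ('a, 'k) hibi_ring) \<in> hibi_component 1" for \<alpha>
    using hibi_monom_component[of "{#\<alpha>#}"] by (simp add: hibi_monom_simps)
  interpret parametrized_algebra "hibi_scale :: 'k \<Rightarrow> ('a, 'k) hibi_ring \<Rightarrow> _" hibi_component "Suc N" "\<lambda>_. 1" rank_sum
    by unfold_locales (auto simp: rank_sum_def intro!: subspace_sum[OF component_subspace] elem)
  show ?thesis
  proof (rule normalized_algebraI)
    show "finite ?B" using finite_lattice_paths by simp
  next
    fix b assume "b \<in> ?B"
    then obtain \<pi> where \<pi>: "\<pi> \<in> lattice_paths" "b = descent_monom \<pi>" by blast
    have "descent_monom \<pi> \<in> (hibi_component (int (card (descents \<pi>))) :: ('a, 'k) hibi_ring set)"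
      using hibi_monom_component[of "image_mset \<pi> (mset_set (descents \<pi>))"] by (simp add: descent_monom_def)
    then show "b \<in> hibi_component (?deg b)"
      using \<pi> by (simp add: inv_into_f_f[OF inj_descent_monom])
  next
    show "independent_family (\<lambda>(u, b). power_product rank_sum u * b) (expvecs (Suc N) \<times> ?B)"
      unfolding independent_family_def
    proof (intro allI impI ballI)
      fix F and c :: "_ \<Rightarrow> 'k" and t
      assume F: "finite F" "F \<subseteq> expvecs (Suc N) \<times> ?B"
        "(\<Sum>i\<in>F. hibi_scale (c i) (case i of (u, b) \<Rightarrow> power_product rank_sum u * b)) = 0" "t \<in> F"
      let ?m = "map_prod id (descent_monom :: _ \<Rightarrow> ('a, 'k) hibi_ring)"
      have inj: "inj_on ?m (path_index)"
        using inj_descent_monom by (auto simp: inj_on_def)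
      have "?m ` (path_index) = expvecs (Suc N) \<times> ?B" by force
      then have "F \<subseteq> ?m ` (path_index)" using F(2) by (simp only:)
      then obtain F' where F': "F' \<subseteq> path_index" "F = ?m ` F'"
        by (rule subset_imageE)
      have inj': "inj_on ?m F'" by (rule inj_on_subset[OF inj F'(1)])
      have fin: "finite F'" using F(1) finite_image_iff[OF inj'] F'(2) by simp
      have "(\<Sum>i\<in>F'. hibi_scale (c (?m i)) (case i of (u, \<pi>) \<Rightarrow> path_elem u \<pi>)) = 0"
        using F(3) by (simp add: F'(2) sum.reindex[OF inj'] split_def)
      from independent_familyD[OF basis_independent fin F'(1) this]
      show "c t = 0" using F(4) F'(2) by auto
    qed
  next
    have "(\<lambda>(u, b). power_product rank_sum u * b) ` (expvecs (Suc N) \<times> ?B) =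
        (\<lambda>(u, \<pi>). path_elem u \<pi> :: ('a, 'k) hibi_ring) `
          (path_index)" by force
    then show "span ((\<lambda>(u, b). power_product rank_sum u * b) ` (expvecs (Suc N) \<times> ?B)) = UNIV"
      using basis_spans[where 'k = 'k] by simp
  qed
qed

text \<open>The top degree is the largest number of descents of a path, so \<open>Btop\<close>
  corresponds to the paths attaining it.\<close>

lemma pseudo_Gorenstein_hibi_iff:
  "pseudo_Gorenstein (hibi_scale :: 'k::field \<Rightarrow> ('a, 'k) hibi_ring \<Rightarrow> _) hibi_component \<longleftrightarrow>
     (\<exists>!\<pi>. \<pi> \<in> lattice_paths \<and> (\<forall>\<rho>\<in>lattice_paths. card (descents \<rho>) \<le> card (descents \<pi>)))"
proof -
  interpret normalized_algebra "hibi_scale :: 'k \<Rightarrow> ('a, 'k) hibi_ring \<Rightarrow> _" hibi_component "Suc N" "\<lambda>_. 1"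
    rank_sum "descent_monom ` lattice_paths"
    "\<lambda>b. int (card (descents (inv_into lattice_paths (descent_monom :: _ \<Rightarrow> ('a, 'k) hibi_ring) b)))"
    by (rule normalized_hibi)
  let ?M = "{\<pi> \<in> lattice_paths. \<forall>\<rho>\<in>lattice_paths. card (descents \<rho>) \<le> card (descents \<pi>)}"
  let ?D = "\<lambda>\<pi>. int (card (descents \<pi>))"
  have inv: "inv_into lattice_paths (descent_monom :: _ \<Rightarrow> ('a, 'k) hibi_ring) (descent_monom \<pi>) = \<pi>"
    if "\<pi> \<in> lattice_paths" for \<pi> using that by (rule inv_into_f_f[OF inj_descent_monom])
  have top: "topdeg = Max (?D ` lattice_paths)"
    unfolding topdeg_def image_image by (rule arg_cong[where f = Max], rule image_cong) (simp_all add: inv)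
  have "(?D \<pi> = topdeg) \<longleftrightarrow> (\<forall>\<rho>\<in>lattice_paths. card (descents \<rho>) \<le> card (descents \<pi>))"
    if "\<pi> \<in> lattice_paths" for \<pi>
  proof -
    have "topdeg = ?D \<pi> \<longleftrightarrow> (\<forall>x\<in>?D ` lattice_paths. x \<le> ?D \<pi>)"
      unfolding top using that finite_lattice_paths by (subst Max_eq_iff) auto
    then show ?thesis by auto
  qed
  then have "Btop = descent_monom ` ?M"
    unfolding Btop_def by (auto simp: inv)
  moreover have "card (descent_monom ` ?M :: ('a, 'k) hibi_ring set) = card ?M"
    by (rule card_image, rule inj_on_subset[OF inj_descent_monom]) auto
  ultimately have "card Btop = card ?M" by simp
  then show ?thesis
    unfolding pseudo_Gorenstein_iff by (simp add: card_1_singleton_iff Ex1_def set_eq_iff) blast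
qed

end

section \<open>Descents and incomparable pairs\<close>

text \<open>A pair stands for the two elements whose order of entry is exchanged when a corner of a
  path is flipped; this is the shape of the set of all such pairs of one path.\<close>

definition crossing_set :: "'a::order set \<Rightarrow> 'a set \<Rightarrow> ('a \<times> 'a) set \<Rightarrow> bool" where
  "crossing_set C D M \<longleftrightarrow> M \<subseteq> C \<times> D \<and>
     (\<forall>(x, y)\<in>M. \<not> x \<le> y \<and> \<not> y \<le> x) \<and>
     (\<forall>s\<in>M. \<forall>t\<in>M. s \<noteq> t \<longrightarrow> fst s < fst t \<and> snd s < snd t \<or> fst t < fst s \<and> snd t < snd s)"

lemma ex1_iff_via_inj:
  assumes "inj_on f A" "\<And>x. P x \<longleftrightarrow> x \<in> A \<and> Q (f x)" "\<And>y. Q y \<Longrightarrow> \<exists>x. x \<in> A \<and> y = f x"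
  shows "(\<exists>!x. P x) \<longleftrightarrow> (\<exists>!y. Q y)"
proof
  assume "\<exists>!x. P x"
  then show "\<exists>!y. Q y" using assms(2,3) by metis
next
  assume "\<exists>!y. Q y"
  then show "\<exists>!x. P x" using assms by (metis inj_onD)
qed

context two_chains
begin

text \<open>Birkhoff's correspondence: the join of \<open>I\<close> represents the down-set
  generated by \<open>I\<close> among the join-irreducibles.\<close>

lemma ideal_element:
  fixes I :: "'a set"
  obtains \<alpha> :: 'a where "\<And>p. p \<in> join_irreducibles \<Longrightarrow> p \<le> \<alpha> \<longleftrightarrow> (\<exists>q\<in>I. p \<le> q)"
proof -
  have "\<exists>\<alpha> :: 'a. \<forall>p\<in>join_irreducibles. p \<le> \<alpha> \<longleftrightarrow> (\<exists>q\<in>I. p \<le> q)"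
    if "finite I" for I :: "'a set"
    using that
  proof (induction I)
    case empty
    have "\<not> p \<le> least_element" if "p \<in> join_irreducibles" for p :: 'a
      using that rk_least by (auto simp: rk_eq_card)
    then show ?case by auto
  next
    case (insert a I)
    then obtain \<alpha> :: 'a where "\<forall>p\<in>join_irreducibles. p \<le> \<alpha> \<longleftrightarrow> (\<exists>q\<in>I. p \<le> q)" by blast
    then show ?case
      by (intro exI[of _ "sup a \<alpha>"]) (auto simp: join_irreducible_le_sup)
  qed
  from this[of I] show thesis using that by auto
qed

text \<open>The element reached by a path just after \<open>y\<close> has been added and just before
  \<open>x\<close> is added.\<close>

definition corner_of :: "'a \<Rightarrow> 'a \<Rightarrow> 'a \<Rightarrow> bool" where
  "corner_of x y \<alpha> \<longleftrightarrow> (\<forall>p\<in>C1. p \<le> \<alpha> \<longleftrightarrow> p < x) \<and> (\<forall>p\<in>C2. p \<le> \<alpha> \<longleftrightarrow> p \<le> y)"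

lemma chain1_not_le: "x \<in> C1 \<Longrightarrow> y \<in> C1 \<Longrightarrow> \<not> x \<le> y \<longleftrightarrow> y < x"
  using chain1[of x y] by auto

lemma chain2_not_le: "x \<in> C2 \<Longrightarrow> y \<in> C2 \<Longrightarrow> \<not> x \<le> y \<longleftrightarrow> y < x"
  using chain2[of x y] by auto

lemma le_via_chains:
  assumes "\<And>p. p \<in> C1 \<Longrightarrow> p \<le> \<alpha> \<Longrightarrow> p \<le> \<beta>" "\<And>p. p \<in> C2 \<Longrightarrow> p \<le> \<alpha> \<Longrightarrow> p \<le> \<beta>"
  shows "\<alpha> \<le> \<beta>"
proof (rule join_primes_dense)
  fix p assume "p \<in> join_primes" "p \<le> \<alpha>"
  then consider "p = least_element" | "p \<in> C1" | "p \<in> C2"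
    using Un_chains by (auto simp: join_primes_eq)
  then show "p \<le> \<beta>" using assms \<open>p \<le> \<alpha>\<close> by cases auto
qed

lemma corner_of_unique: "corner_of x y \<alpha> \<Longrightarrow> corner_of x y \<beta> \<Longrightarrow> \<alpha> = \<beta>"
  by (intro order_antisym; rule le_via_chains) (auto simp: corner_of_def)

text \<open>The corner determines \<open>x\<close> as the first element of \<open>C1\<close> not
  below it and \<open>y\<close> as the last element of \<open>C2\<close> below it.\<close>

lemma corner_of_inj:
  assumes "x \<in> C1" "x' \<in> C1" "y \<in> C2" "y' \<in> C2" "corner_of x y \<alpha>" "corner_of x' y' \<alpha>"
  shows "x = x' \<and> y = y'"
proof
  have "\<not> x < x'" "\<not> x' < x" using assms unfolding corner_of_def by blast+
  then show "x = x'" using chain1[OF assms(1,2)] by (auto simp: less_le)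
  have "y \<le> y'" "y' \<le> y" using assms unfolding corner_of_def by blast+
  then show "y = y'" by simp
qed

text \<open>The flags \<open>a\<close>, \<open>b\<close> select a corner of the lattice square in which the pair is crossed.\<close>

lemma square_exists:
  assumes "x \<in> C1" "y \<in> C2" "\<not> x \<le> y" "\<not> y \<le> x"
  obtains \<alpha> where "\<And>p. p \<in> C1 \<Longrightarrow> p \<le> \<alpha> \<longleftrightarrow> p < x \<or> a \<and> p = x"
    "\<And>p. p \<in> C2 \<Longrightarrow> p \<le> \<alpha> \<longleftrightarrow> p < y \<or> b \<and> p = y"
proof -
  define I where "I = {p \<in> C1. p < x \<or> a \<and> p = x} \<union> {p \<in> C2. p < y \<or> b \<and> p = y}"
  obtain \<alpha> :: 'a where \<alpha>: "\<And>p. p \<in> join_irreducibles \<Longrightarrow> p \<le> \<alpha> \<longleftrightarrow> (\<exists>q\<in>I. p \<le> q)"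
    using ideal_element[of I] by blast
  have 1: "p < x \<or> a \<and> p = x" if p: "p \<in> C1" "p \<le> q" "q \<in> I" for p q
  proof (cases "q \<in> C1")
    case True
    then have "q \<notin> C2" using disjoint_chains by blast
    with p(2,3) show ?thesis by (auto simp: I_def)
  next
    case False
    then have "q \<le> y" using p(3) by (auto simp: I_def)
    then have "\<not> x \<le> p" using p(2) assms(3) by (meson order_trans)
    then show ?thesis using chain1[OF p(1) assms(1)] by auto
  qed
  have 2: "p < y \<or> b \<and> p = y" if p: "p \<in> C2" "p \<le> q" "q \<in> I" for p q
  proof (cases "q \<in> C2")
    case True
    then have "q \<notin> C1" using disjoint_chains by blast
    with p(2,3) show ?thesis by (auto simp: I_def)
  next
    case False
    then have "q \<le> x" using p(3) by (auto simp: I_def)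
    then have "\<not> y \<le> p" using p(2) assms(4) by (meson order_trans)
    then show ?thesis using chain2[OF p(1) assms(2)] by auto
  qed
  show thesis
  proof (rule that)
    show "p \<le> \<alpha> \<longleftrightarrow> p < x \<or> a \<and> p = x" if "p \<in> C1" for p
      using \<alpha>[of p] 1[OF that] that Un_chains by (auto simp: I_def)
    show "p \<le> \<alpha> \<longleftrightarrow> p < y \<or> b \<and> p = y" if "p \<in> C2" for p
      using \<alpha>[of p] 2[OF that] that Un_chains by (auto simp: I_def)
  qed
qed

text \<open>Here \<open>y\<close> is added by the step to \<open>\<pi> i\<close> and
  \<open>x\<close> by the next one. The opposite corner \<gamma> lies above \<open>x\<close> but not
  above \<open>y\<close>, while \<open>\<pi> i\<close> lies above \<open>y\<close> but not above
  \<open>x\<close>; this excludes both comparabilities.\<close>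

lemma descent_corner:
  assumes \<pi>: "\<pi> \<in> lattice_paths" and i: "i \<in> descents \<pi>"
  obtains x y where "x \<in> C1" "y \<in> C2" "corner_of x y (\<pi> i)" "x \<le> \<pi> (Suc i)" "\<not> y \<le> \<pi> (i - 1)"
    "\<not> x \<le> y" "\<not> y \<le> x"
proof -
  obtain \<gamma> where \<gamma>: "0 < i" "i < N" "\<pi> (i - 1) \<le> \<gamma>" "\<gamma> \<le> \<pi> (Suc i)" "rk \<gamma> = i" "yc \<gamma> < yc (\<pi> i)"
    using i by (auto simp: descents_def)
  have s1: "yc (\<pi> i) = Suc (yc (\<pi> (i - 1)))" "xc (\<pi> i) = xc (\<pi> (i - 1))"
    using path_step[OF \<pi>, of "i - 1"] \<gamma> by (auto simp: le_iff_coords)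
  have rki: "rk (\<pi> i) = i" using path_rk[OF \<pi>] \<gamma>(2) by simp
  have s2: "xc (\<pi> (Suc i)) = Suc (xc (\<pi> i))" "yc (\<pi> (Suc i)) = yc (\<pi> i)"
    using path_step[OF \<pi> \<gamma>(2)] \<gamma> rki by (auto simp: le_iff_coords rk_def)
  have \<gamma>c: "xc \<gamma> = xc (\<pi> (Suc i))" "yc \<gamma> = yc (\<pi> (i - 1))"
    using \<gamma>(3-6) s1 s2 rki by (auto simp: le_iff_coords rk_def)
  have le: "\<pi> (i - 1) \<le> \<pi> i" "\<pi> i \<le> \<pi> (Suc i)"
    using \<gamma>(1,2) by (auto intro!: path_mono[OF \<pi>])
  have ins: "\<exists>z. z \<in> B \<and> z \<notin> A \<and> B = insert z A" if "A \<subseteq> B" "finite B" "card B = Suc (card A)" for A B :: "'a set"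
  proof -
    have "card (B - A) = 1" using that by (simp add: card_Diff_subset finite_subset)
    then obtain z where "B - A = {z}" by (metis card_1_singletonE)
    then show ?thesis using that(1) by blast
  qed
  obtain x where x: "x \<in> C1" "x \<le> \<pi> (Suc i)" "\<not> x \<le> \<pi> i"
    "{p \<in> C1. p \<le> \<pi> (Suc i)} = insert x {p \<in> C1. p \<le> \<pi> i}"
    using ins[of "{p \<in> C1. p \<le> \<pi> i}" "{p \<in> C1. p \<le> \<pi> (Suc i)}"] s2(1) le(2)
    by (auto simp: xc_def intro: order_trans)
  obtain y where y: "y \<in> C2" "y \<le> \<pi> i" "\<not> y \<le> \<pi> (i - 1)"
    "{p \<in> C2. p \<le> \<pi> i} = insert y {p \<in> C2. p \<le> \<pi> (i - 1)}"
    using ins[of "{p \<in> C2. p \<le> \<pi> (i - 1)}" "{p \<in> C2. p \<le> \<pi> i}"] s1(1) le(1)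
    by (auto simp: yc_def intro: order_trans)
  have "corner_of x y (\<pi> i)"
    unfolding corner_of_def
  proof (intro conjI ballI iffI)
    fix p assume p: "p \<in> C1"
    show "p < x" if "p \<le> \<pi> i"
      using chain1_not_le[OF x(1) p] that x(3) by (meson order_trans)
    show "p \<le> \<pi> i" if "p < x"
    proof -
      have "p \<in> {p \<in> C1. p \<le> \<pi> (Suc i)}" using p that x(2) by auto
      then show ?thesis unfolding x(4) using that by auto
    qed
  next
    fix p assume p: "p \<in> C2"
    show "p \<le> \<pi> i" if "p \<le> y" using that y(2) by (rule order_trans)
    show "p \<le> y" if "p \<le> \<pi> i"
    proof -
      have "p \<in> insert y {p \<in> C2. p \<le> \<pi> (i - 1)}" using p that y(4) by blast
      then show ?thesis using chain2[OF p y(1)] y(3) by (auto intro: order_trans)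
    qed
  qed
  moreover have "x \<le> \<gamma>"
  proof -
    have "{p \<in> C1. p \<le> \<gamma>} = {p \<in> C1. p \<le> \<pi> (Suc i)}"
      by (rule card_subset_eq) (use \<gamma>(4) \<gamma>c(1) in \<open>auto simp: xc_def intro: order_trans\<close>)
    then show ?thesis using x(1,2) by blast
  qed
  moreover have "\<not> y \<le> \<gamma>"
  proof -
    have "{p \<in> C2. p \<le> \<pi> (i - 1)} = {p \<in> C2. p \<le> \<gamma>}"
      by (rule card_subset_eq) (use \<gamma>(3) \<gamma>c(2) in \<open>auto simp: yc_def intro: order_trans\<close>)
    then show ?thesis using y(1,3) by blast
  qed
  moreover have "\<not> x \<le> y" using x(3) y(2) by (meson order_trans)
  ultimately show thesis using x y by (intro that[of x y]) (auto intro: order_trans)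
qed

definition crossings :: "(nat \<Rightarrow> 'a) \<Rightarrow> ('a \<times> 'a) set" where
  "crossings \<pi> = {(x, y). x \<in> C1 \<and> y \<in> C2 \<and> (\<exists>i\<in>descents \<pi>. corner_of x y (\<pi> i))}"

text \<open>Ranks make the indices of a path recoverable from its elements, so a corner belongs to a
  single descent.\<close>

lemma card_crossings:
  assumes \<pi>: "\<pi> \<in> lattice_paths"
  shows "card (crossings \<pi>) = card (descents \<pi>)"
proof (rule bij_betw_same_card)
  define f where "f = (\<lambda>(x, y). THE i. i \<in> descents \<pi> \<and> corner_of x y (\<pi> i))"
  have inj: "i = j" if "i \<in> descents \<pi>" "j \<in> descents \<pi>" "\<pi> i = \<pi> j" for i j
    using path_rk[OF \<pi>, of i] path_rk[OF \<pi>, of j] descent_less_N that by (metis less_imp_le)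
  have f: "f (x, y) = i" if "i \<in> descents \<pi>" "corner_of x y (\<pi> i)" for x y i
    unfolding f_def prod.case using that inj corner_of_unique by (intro the_equality) blast+
  show "bij_betw f (crossings \<pi>) (descents \<pi>)"
    unfolding bij_betw_def
  proof (intro conjI inj_onI set_eqI iffI)
    fix s t assume "s \<in> crossings \<pi>" "t \<in> crossings \<pi>" "f s = f t"
    then show "s = t" using f corner_of_inj by (auto simp: crossings_def)
  next
    fix i assume "i \<in> f ` crossings \<pi>"
    then show "i \<in> descents \<pi>" using f by (auto simp: crossings_def)
  next
    fix i assume i: "i \<in> descents \<pi>"
    from descent_corner[OF \<pi> i] obtain x y where "x \<in> C1" "y \<in> C2" "corner_of x y (\<pi> i)" by metis
    then show "i \<in> f ` crossings \<pi>" using f i by (intro image_eqI[of _ _ "(x, y)"]) (auto simp: crossings_def)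
  qed
qed

lemma crossing_corner:
  assumes \<pi>: "\<pi> \<in> lattice_paths" and i: "i \<in> descents \<pi>" and xy: "x \<in> C1" "y \<in> C2" "corner_of x y (\<pi> i)"
  shows "x \<le> \<pi> (Suc i)" "\<not> x \<le> \<pi> i" "y \<le> \<pi> i" "\<not> y \<le> \<pi> (i - 1)" "\<not> x \<le> y" "\<not> y \<le> x"
proof -
  obtain x' y' where *: "x' \<in> C1" "y' \<in> C2" "corner_of x' y' (\<pi> i)" "x' \<le> \<pi> (Suc i)" "\<not> y' \<le> \<pi> (i - 1)"
    "\<not> x' \<le> y'" "\<not> y' \<le> x'" by (rule descent_corner[OF \<pi> i])
  then have "x = x'" "y = y'" using corner_of_inj[OF xy(1) *(1) xy(2) *(2) xy(3) *(3)] by auto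
  with * show "x \<le> \<pi> (Suc i)" "\<not> x \<le> \<pi> i" "y \<le> \<pi> i" "\<not> y \<le> \<pi> (i - 1)" "\<not> x \<le> y" "\<not> y \<le> x"
    by (auto simp: corner_of_def)
qed

text \<open>For descents \<open>i < j\<close>, the element of \<open>C1\<close> for \<open>i\<close>
  is already below \<open>\<pi> j\<close>, where that for \<open>j\<close> is still missing; the
  elements of \<open>C2\<close> are separated in the same way by
  \<open>\<pi> (j - 1)\<close>.\<close>

lemma crossing_set_crossings:
  assumes \<pi>: "\<pi> \<in> lattice_paths"
  shows "crossing_set C1 C2 (crossings \<pi>)"
  unfolding crossing_set_def
proof (intro conjI ballI impI)
  show "crossings \<pi> \<subseteq> C1 \<times> C2" by (auto simp: crossings_def)
  show "case s of (x, y) \<Rightarrow> \<not> x \<le> y \<and> \<not> y \<le> x" if "s \<in> crossings \<pi>" for s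
    using that crossing_corner[OF \<pi>] by (auto simp: crossings_def)
  fix s t assume st: "s \<in> crossings \<pi>" "t \<in> crossings \<pi>" "s \<noteq> t"
  obtain i x y where s: "s = (x, y)" "x \<in> C1" "y \<in> C2" "i \<in> descents \<pi>" "corner_of x y (\<pi> i)"
    using st(1) by (auto simp: crossings_def)
  obtain j x' y' where t: "t = (x', y')" "x' \<in> C1" "y' \<in> C2" "j \<in> descents \<pi>" "corner_of x' y' (\<pi> j)"
    using st(2) by (auto simp: crossings_def)
  have less: "x < x' \<and> y < y'" if "i < j" "x \<in> C1" "y \<in> C2" "x' \<in> C1" "y' \<in> C2"
    "i \<in> descents \<pi>" "corner_of x y (\<pi> i)" "j \<in> descents \<pi>" "corner_of x' y' (\<pi> j)" for i j x y x' y'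
  proof
    have j: "j < N" using that(8) by (rule descent_less_N)
    have "x \<le> \<pi> j"
      using crossing_corner(1)[OF \<pi> that(6,2,3,7)] path_mono[OF \<pi>, of "Suc i" j] that(1) j by (auto intro: order_trans)
    then have "\<not> x' \<le> x" using crossing_corner(2)[OF \<pi> that(8,4,5,9)] by (meson order_trans)
    then show "x < x'" using chain1_not_le that(2,4) by blast
    have "y \<le> \<pi> (j - 1)"
      using crossing_corner(3)[OF \<pi> that(6,2,3,7)] path_mono[OF \<pi>, of i "j - 1"] that(1) j by (auto intro: order_trans)
    then have "\<not> y' \<le> y" using crossing_corner(4)[OF \<pi> that(8,4,5,9)] by (meson order_trans)
    then show "y < y'" using chain2_not_le that(3,5) by blast
  qed
  have "i \<noteq> j" using st(3) s t corner_of_inj by blast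
  then consider "i < j" | "j < i" by linarith
  then show "fst s < fst t \<and> snd s < snd t \<or> fst t < fst s \<and> snd t < snd s"
  proof cases
    case 1
    then show ?thesis using less[OF 1 s(2,3) t(2,3) s(4,5) t(4,5)] s(1) t(1) by simp
  next
    case 2
    then show ?thesis using less[OF 2 t(2,3) s(2,3) t(4,5) s(4,5)] s(1) t(1) by simp
  qed
qed

text \<open>Equal crossings mean equal corner elements, and a path is the lowest one through its
  corners.\<close>

lemma inj_crossings: "inj_on crossings lattice_paths"
proof (rule inj_onI)
  fix \<pi> \<rho> assume \<pi>: "\<pi> \<in> lattice_paths" and \<rho>: "\<rho> \<in> lattice_paths" and eq: "crossings \<pi> = crossings \<rho>"
  have sub: "\<mu> ` descents \<mu> \<subseteq> \<nu> ` descents \<nu>"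
    if \<mu>: "\<mu> \<in> lattice_paths" and "crossings \<mu> = crossings \<nu>" for \<mu> \<nu>
  proof
    fix \<alpha> assume "\<alpha> \<in> \<mu> ` descents \<mu>"
    then obtain i where i: "i \<in> descents \<mu>" "\<alpha> = \<mu> i" by blast
    from descent_corner[OF \<mu> i(1)] obtain x y where xy: "x \<in> C1" "y \<in> C2" "corner_of x y (\<mu> i)" by metis
    then have "(x, y) \<in> crossings \<mu>" using i(1) by (auto simp: crossings_def)
    then have "(x, y) \<in> crossings \<nu>" using that(2) by simp
    then obtain j where "j \<in> descents \<nu>" "corner_of x y (\<nu> j)" by (auto simp: crossings_def)
    then show "\<alpha> \<in> \<nu> ` descents \<nu>" using corner_of_unique xy(3) i(2) by blast
  qed
  have same: "\<pi> ` descents \<pi> = \<rho> ` descents \<rho>" using sub[OF \<pi> eq] sub[OF \<rho> eq[symmetric]] by blast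
  have on: "\<mu> (rk \<alpha>) = \<alpha>" if "\<mu> \<in> lattice_paths" "\<alpha> \<in> \<mu> ` descents \<mu>" for \<mu> \<alpha>
    using that path_rk[OF that(1)] descent_less_N by (auto simp: less_imp_le)
  show "\<pi> = \<rho>"
    by (rule lowest_path_unique[OF \<pi> \<rho>, of "\<pi> ` descents \<pi>"]) (use on \<pi> \<rho> same in auto)
qed

text \<open>The candidate is the lowest path through the corners prescribed by \<open>M\<close>,
  which has no other descents. Each prescribed corner is a descent because the path must also pass
  through its neighbours \<open>lo\<close> and \<open>hi\<close>.\<close>

lemma crossings_surj:
  assumes M: "crossing_set C1 C2 M"
  obtains \<pi> where "\<pi> \<in> lattice_paths" "crossings \<pi> = M"
proof -
  have MC: "x \<in> C1" "y \<in> C2" "\<not> x \<le> y" "\<not> y \<le> x" if "(x, y) \<in> M" for x y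
    using M that by (auto simp: crossing_set_def)
  have Mless: "x < x' \<and> y < y' \<or> x = x' \<and> y = y' \<or> x' < x \<and> y' < y" if "(x, y) \<in> M" "(x', y') \<in> M" for x y x' y'
    using M that unfolding crossing_set_def by (metis fst_conv snd_conv prod.inject)
  have corner_ex: "\<exists>\<alpha>. corner_of x y \<alpha>" if "(x, y) \<in> M" for x y
    using square_exists[OF MC[OF that], of False True] unfolding corner_of_def
    by (metis le_less)
  define c where "c = (\<lambda>(x, y). SOME \<alpha>. corner_of x y \<alpha>)"
  have c: "corner_of x y (c (x, y))" if "(x, y) \<in> M" for x y
    using someI_ex[OF corner_ex[OF that]] by (simp add: c_def)
  have c1: "p \<le> c (x, y) \<longleftrightarrow> p < x" if "(x, y) \<in> M" "p \<in> C1" for x y p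
    using c[OF that(1)] that(2) by (auto simp: corner_of_def)
  have c2: "p \<le> c (x, y) \<longleftrightarrow> p \<le> y" if "(x, y) \<in> M" "p \<in> C2" for x y p
    using c[OF that(1)] that(2) by (auto simp: corner_of_def)
  have cmono: "c (x, y) \<le> c (x', y')" if "(x, y) \<in> M" "(x', y') \<in> M" "x \<le> x'" "y \<le> y'" for x y x' y'
    by (rule le_via_chains) (use that c1 c2 in auto)
  have chain: "\<alpha> \<le> \<beta> \<or> \<beta> \<le> \<alpha>" if "\<alpha> \<in> c ` M" "\<beta> \<in> c ` M" for \<alpha> \<beta>
  proof -
    obtain x y x' y' where *: "(x, y) \<in> M" "\<alpha> = c (x, y)" "(x', y') \<in> M" "\<beta> = c (x', y')"
      using \<open>\<alpha> \<in> c ` M\<close> \<open>\<beta> \<in> c ` M\<close> by auto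
    then show ?thesis using Mless[OF *(1,3)] * by (auto intro: cmono less_imp_le)
  qed
  obtain \<pi> where \<pi>: "\<pi> \<in> lattice_paths" "\<And>\<alpha>. \<alpha> \<in> c ` M \<Longrightarrow> \<pi> (rk \<alpha>) = \<alpha>" "\<And>i. i \<in> descents \<pi> \<Longrightarrow> \<pi> i \<in> c ` M"
    using lowest_path_through_chain[of "c ` M"] chain by blast
  have "crossings \<pi> = M"
  proof (intro equalityI subrelI)
    fix x y assume "(x, y) \<in> crossings \<pi>"
    then obtain i where i: "x \<in> C1" "y \<in> C2" "i \<in> descents \<pi>" "corner_of x y (\<pi> i)" by (auto simp: crossings_def)
    obtain x' y' where xy': "(x', y') \<in> M" "\<pi> i = c (x', y')" using \<pi>(3)[OF i(3)] by auto
    then have "x = x' \<and> y = y'"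
      using corner_of_inj[OF i(1) MC(1)[OF xy'(1)] i(2) MC(2)[OF xy'(1)] i(4)] c[OF xy'(1)] by simp
    with xy'(1) show "(x, y) \<in> M" by simp
  next
    fix x y assume xy: "(x, y) \<in> M"
    note mem = MC[OF xy]
    define i where "i = rk (c (x, y))"
    have \<pi>i: "\<pi> i = c (x, y)" using \<pi>(2) xy by (auto simp: i_def)
    \<comment> \<open>Besides \<open>c (x, y)\<close>, the remaining vertices of the square in which
      \<open>x\<close> and \<open>y\<close> are added: bottom \<open>lo\<close>, top
      \<open>hi\<close>, and the flipped corner \<open>fl\<close>.\<close>
    obtain lo where lo: "\<And>p. p \<in> C1 \<Longrightarrow> p \<le> lo \<longleftrightarrow> p < x" "\<And>p. p \<in> C2 \<Longrightarrow> p \<le> lo \<longleftrightarrow> p < y"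
      using square_exists[OF mem, of False False] by auto
    obtain hi where hi: "\<And>p. p \<in> C1 \<Longrightarrow> p \<le> hi \<longleftrightarrow> p \<le> x" "\<And>p. p \<in> C2 \<Longrightarrow> p \<le> hi \<longleftrightarrow> p \<le> y"
      using square_exists[OF mem, of True True] by (auto simp: le_less)
    obtain fl where fl: "\<And>p. p \<in> C1 \<Longrightarrow> p \<le> fl \<longleftrightarrow> p \<le> x" "\<And>p. p \<in> C2 \<Longrightarrow> p \<le> fl \<longleftrightarrow> p < y"
      using square_exists[OF mem, of True False] by (auto simp: le_less)
    have le: "lo \<le> c (x, y)" "c (x, y) \<le> hi" "lo \<le> fl" "fl \<le> hi"
      by (rule le_via_chains; use lo hi fl c1[OF xy] c2[OF xy] in auto)+
    have X: "{p \<in> C1. p \<le> x} = insert x {p \<in> C1. p < x}" and Y: "{p \<in> C2. p \<le> y} = insert y {p \<in> C2. p < y}"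
      using mem by auto
    have coords: "xc (c (x, y)) = card {p \<in> C1. p < x}" "yc (c (x, y)) = Suc (card {p \<in> C2. p < y})"
      "xc lo = card {p \<in> C1. p < x}" "yc lo = card {p \<in> C2. p < y}"
      "xc hi = Suc (card {p \<in> C1. p < x})" "yc hi = Suc (card {p \<in> C2. p < y})"
      "xc fl = Suc (card {p \<in> C1. p < x})" "yc fl = card {p \<in> C2. p < y}"
      unfolding xc_def yc_def using c1[OF xy] c2[OF xy] lo hi fl X Y by (simp_all cong: conj_cong)
    have rks: "Suc (rk lo) = i" "rk hi = Suc i" "rk fl = i" by (simp_all add: i_def rk_def coords)
    have iN: "i < N" using rk_le_N[of hi] rks by simp
    have comp: "lo \<le> c t \<or> c t \<le> lo" "hi \<le> c t \<or> c t \<le> hi" if "t \<in> M" for t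
    proof -
      obtain x' y' where t: "t = (x', y')" "(x', y') \<in> M" using \<open>t \<in> M\<close> by (cases t) auto
      consider "x < x'" "y < y'" | "x = x'" "y = y'" | "x' < x" "y' < y" using Mless[OF xy t(2)] by blast
      then have "(lo \<le> c t \<or> c t \<le> lo) \<and> (hi \<le> c t \<or> c t \<le> hi)"
      proof cases
        case 1
        have "hi \<le> c (x', y')" by (rule le_via_chains) (use hi c1[OF t(2)] c2[OF t(2)] 1 in auto)
        moreover have "lo \<le> hi" using le by (meson order_trans)
        ultimately show ?thesis using t(1) by (auto intro: order_trans)
      next
        case 2
        then show ?thesis using le t(1) by simp
      next
        case 3
        have "c (x', y') \<le> lo" by (rule le_via_chains) (use lo c1[OF t(2)] c2[OF t(2)] 3 in auto)
        moreover have "lo \<le> hi" using le by (meson order_trans)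
        ultimately show ?thesis using t(1) by (auto intro: order_trans)
      qed
      then show "lo \<le> c t \<or> c t \<le> lo" "hi \<le> c t \<or> c t \<le> hi" by auto
    qed
    have comp': "lo \<le> \<pi> j \<or> \<pi> j \<le> lo" "hi \<le> \<pi> j \<or> \<pi> j \<le> hi" if j: "j \<in> descents \<pi>" for j
    proof -
      obtain t where t: "t \<in> M" "\<pi> j = c t" using \<pi>(3)[OF j] by auto
      show "lo \<le> \<pi> j \<or> \<pi> j \<le> lo" "hi \<le> \<pi> j \<or> \<pi> j \<le> hi"
        using comp[OF t(1)] by (simp_all only: t(2))
    qed
    \<comment> \<open>Both \<open>lo\<close> and \<open>hi\<close> are comparable with all descents,
      so the path does not pass above them. As it takes single steps through
      \<open>c (x, y)\<close>, it has no other possible neighbours there.\<close>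
    have low: "yc (\<pi> (rk lo)) \<le> yc lo" "yc (\<pi> (rk hi)) \<le> yc hi"
      using path_lowest[OF \<pi>(1) comp'(1)] path_lowest[OF \<pi>(1) comp'(2)] by simp_all
    have "yc (\<pi> (rk lo)) = yc lo"
      using low(1) path_step[OF \<pi>(1), of "rk lo"] iN rks(1) \<pi>i coords by auto
    then have "\<pi> (rk lo) = lo" using path_rk[OF \<pi>(1) rk_le_N] by (intro rk_yc_eqI) auto
    then have lo': "\<pi> (i - 1) = lo" using rks(1) by auto
    have "yc (\<pi> (Suc i)) = yc hi"
      using low(2) path_step[OF \<pi>(1) iN] rks(2) \<pi>i coords by auto
    then have hi': "\<pi> (Suc i) = hi" using path_rk[OF \<pi>(1), of "Suc i"] iN rks(2) by (intro rk_yc_eqI) auto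
    have "i \<in> descents \<pi>"
      unfolding descents_def using iN rks le lo' hi' \<pi>i coords by (auto intro!: exI[of _ fl])
    then show "(x, y) \<in> crossings \<pi>"
      using mem c[OF xy] \<pi>i by (auto simp: crossings_def intro!: bexI[of _ i])
  qed
  then show thesis using \<pi>(1) that by blast
qed

lemma ex1_max_descents_iff:
  "(\<exists>!\<pi>. \<pi> \<in> lattice_paths \<and> (\<forall>\<rho>\<in>lattice_paths. card (descents \<rho>) \<le> card (descents \<pi>))) \<longleftrightarrow>
   (\<exists>!M. crossing_set C1 C2 M \<and> (\<forall>M'. crossing_set C1 C2 M' \<longrightarrow> card M' \<le> card M))"
  (is "(\<exists>!\<pi>. ?P \<pi>) \<longleftrightarrow> (\<exists>!M. ?Q M)")
proof -
  have PQ: "?P \<pi> \<longleftrightarrow> \<pi> \<in> lattice_paths \<and> ?Q (crossings \<pi>)" for \<pi>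
  proof (cases "\<pi> \<in> lattice_paths")
    case True
    have "(\<forall>\<rho>\<in>lattice_paths. card (descents \<rho>) \<le> card (descents \<pi>)) \<longleftrightarrow>
      (\<forall>M'. crossing_set C1 C2 M' \<longrightarrow> card M' \<le> card (descents \<pi>))"
    proof (intro iffI ballI allI impI)
      fix M' assume *: "\<forall>\<rho>\<in>lattice_paths. card (descents \<rho>) \<le> card (descents \<pi>)" "crossing_set C1 C2 M'"
      obtain \<rho> where "\<rho> \<in> lattice_paths" "crossings \<rho> = M'" by (rule crossings_surj[OF *(2)])
      then show "card M' \<le> card (descents \<pi>)" using *(1) card_crossings[of \<rho>] by simp
    next
      fix \<rho> assume *: "\<forall>M'. crossing_set C1 C2 M' \<longrightarrow> card M' \<le> card (descents \<pi>)" "\<rho> \<in> lattice_paths"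
      then show "card (descents \<rho>) \<le> card (descents \<pi>)"
        using crossing_set_crossings[OF *(2)] card_crossings[OF *(2)] by metis
    qed
    then show ?thesis using True crossing_set_crossings[OF True] by (simp add: card_crossings[OF True])
  qed simp
  have surj: "\<exists>\<pi>. \<pi> \<in> lattice_paths \<and> M = crossings \<pi>" if "?Q M" for M
    using crossings_surj[of M] that by metis
  show ?thesis
    using PQ surj by (rule ex1_iff_via_inj[OF inj_crossings])
qed

end

section \<open>Unique maximal sets of incomparable pairs\<close>

lemma crossing_set_converse: "crossing_set C D M \<Longrightarrow> crossing_set D C (prod.swap ` M)"
  by (force simp: crossing_set_def)

lemma crossing_setI:
  assumes "M \<subseteq> C \<times> D" "\<And>x y. (x, y) \<in> M \<Longrightarrow> \<not> x \<le> y \<and> \<not> y \<le> x"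
    "\<And>x y x' y'. (x, y) \<in> M \<Longrightarrow> (x', y') \<in> M \<Longrightarrow> (x, y) \<noteq> (x', y') \<Longrightarrow>
       x < x' \<and> y < y' \<or> x' < x \<and> y' < y"
  shows "crossing_set C D M"
  unfolding crossing_set_def
proof (intro conjI ballI impI)
  show "case s of (x, y) \<Rightarrow> \<not> x \<le> y \<and> \<not> y \<le> x" if "s \<in> M" for s
    using assms(2) that by (cases s) auto
  show "fst s < fst t \<and> snd s < snd t \<or> fst t < fst s \<and> snd t < snd s"
    if "s \<in> M" "t \<in> M" "s \<noteq> t" for s t
    using assms(3)[of "fst s" "snd s" "fst t" "snd t"] that by (simp add: prod_eq_iff)
qed (rule assms(1))

lemma crossing_setD:
  assumes "crossing_set C D M"
  shows "M \<subseteq> C \<times> D" "(x, y) \<in> M \<Longrightarrow> \<not> x \<le> y" "(x, y) \<in> M \<Longrightarrow> \<not> y \<le> x"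
    "(x, y) \<in> M \<Longrightarrow> (x', y') \<in> M \<Longrightarrow> (x, y) \<noteq> (x', y') \<Longrightarrow> x < x' \<and> y < y' \<or> x' < x \<and> y' < y"
  using assms unfolding crossing_set_def by fastforce+

lemma crossing_set_inj:
  assumes "crossing_set C D M"
  shows "inj_on fst M" "inj_on snd M"
  using crossing_setD(4)[OF assms] by (force simp: inj_on_def)+

text \<open>An uncovered \<open>x\<close> with an incomparable \<open>y\<close> either extends \<open>M\<close> by \<open>(x, y)\<close> or can
  replace the partner of the nearest covered element of its chain.\<close>

lemma unique_max_crossing_set_covers:
  fixes C D :: "'a::order set"
  assumes fin: "finite C" "finite D" and C: "\<And>x y. x \<in> C \<Longrightarrow> y \<in> C \<Longrightarrow> x \<le> y \<or> y \<le> x"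
    and D: "\<And>x y. x \<in> D \<Longrightarrow> y \<in> D \<Longrightarrow> x \<le> y \<or> y \<le> x"
    and M: "crossing_set C D M" and max: "\<And>M'. crossing_set C D M' \<Longrightarrow> card M' \<le> card M"
    and uniq: "\<And>M'. crossing_set C D M' \<Longrightarrow> card M' = card M \<Longrightarrow> M' = M"
    and xy: "x \<in> C" "y \<in> D" "\<not> x \<le> y" "\<not> y \<le> x"
  shows "x \<in> fst ` M"
proof (rule ccontr)
  assume x: "x \<notin> fst ` M"
  have finM: "finite M" by (rule finite_subset[OF crossing_setD(1)[OF M]]) (use fin in simp)
  have memC: "a \<in> C" "b \<in> D" "a \<noteq> x" if "(a, b) \<in> M" for a b
    using crossing_setD(1)[OF M] that x by force+
  \<comment> \<open>Replacing \<open>a\<close> by \<open>x\<close> in one pair preserves the size,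
    and \<open>near\<close> keeps the new pair in order with the others. As \<open>x\<close> was
    uncovered, this contradicts uniqueness.\<close>
  have swap: False
    if t: "(a, b) \<in> M" "\<not> x \<le> b" "\<not> b \<le> x" and near: "\<And>a' b'. (a', b') \<in> M \<Longrightarrow> (a', b') \<noteq> (a, b) \<Longrightarrow>
      a' < x \<and> b' < b \<or> x < a' \<and> b < b'" for a b
  proof -
    let ?E = "insert (x, b) (M - {(a, b)})"
    have "crossing_set C D ?E"
      by (rule crossing_setI) (use memC xy(1) t crossing_setD(1-3)[OF M] crossing_setD(4)[OF M] near in blast)+
    moreover have "card ?E = card M"
      using finM t(1) x by (subst card_insert_disjoint) (force simp: card_Suc_Diff1 simp del: card_Diff_insert)+
    ultimately have "?E = M" by (rule uniq)
    then show False using x by force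
  qed
  \<comment> \<open>Either \<open>(x, y)\<close> is in order with all pairs, or some pair obstructs
    it by being lower on the side of \<open>x\<close> and not on the side of \<open>y\<close>, or
    the reverse.\<close>
  consider (below) a b where "(a, b) \<in> M" "a < x" "y \<le> b"
    | (above) a b where "(a, b) \<in> M" "x < a" "b \<le> y"
    | (free) "\<And>a b. (a, b) \<in> M \<Longrightarrow> a < x \<and> b < y \<or> x < a \<and> y < b"
  proof -
    have "a < x \<and> b < y \<or> x < a \<and> y < b"
      if ab: "(a, b) \<in> M" and nb: "\<not> (a < x \<and> y \<le> b)" and na: "\<not> (x < a \<and> b \<le> y)" for a b
      using C[OF xy(1) memC(1)[OF ab]] D[OF xy(2) memC(2)[OF ab]] memC(3)[OF ab] nb na
      by (auto simp: le_less)
    note * = this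
    show thesis
    proof (cases "(\<exists>a b. (a, b) \<in> M \<and> a < x \<and> y \<le> b) \<or> (\<exists>a b. (a, b) \<in> M \<and> x < a \<and> b \<le> y)")
      case True
      then show thesis using below above by (elim disjE exE conjE)
    next
      case False
      show thesis
      proof (rule free)
        fix a b assume ab: "(a, b) \<in> M"
        show "a < x \<and> b < y \<or> x < a \<and> y < b"
          by (rule *[OF ab]) (use False ab in blast)+
      qed
    qed
  qed
  then show False
  proof cases
    case below
    let ?S = "{k \<in> fst ` M. k < x}"
    have "finite ?S" "?S \<noteq> {}" using finM below by force+
    from finite_has_maximal[OF this] obtain m where m: "m \<in> ?S" "\<And>k. k \<in> ?S \<Longrightarrow> m \<le> k \<Longrightarrow> m = k" by blast
    then obtain n where mn: "(m, n) \<in> M" "m < x" by force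
    have mx: "k \<le> m" if "(k, l) \<in> M" "k < x" for k l
      using m(2)[of k] C[OF memC(1)[OF mn(1)] memC(1)[OF that(1)]] that by force
    \<comment> \<open>The nearest pair below \<open>x\<close> is not lower than the obstructing one,
      so \<open>n\<close> lies above \<open>y\<close> and cannot be below \<open>x\<close>; and
      \<open>x \<le> n\<close> would make \<open>m\<close> and \<open>n\<close> comparable.\<close>
    have "b \<le> n" using crossing_setD(4)[OF M below(1) mn(1)] mx[OF below(1,2)] by fastforce
    then have "\<not> n \<le> x" using below(3) xy(4) by (meson order_trans)
    moreover have "\<not> x \<le> n" using crossing_setD(2)[OF M mn(1)] mn(2) by (meson less_imp_le order_trans)
    moreover have "a' < x \<and> b' < n \<or> x < a' \<and> n < b'" if "(a', b') \<in> M" "(a', b') \<noteq> (m, n)" for a' b'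
      using crossing_setD(4)[OF M that(1) mn(1) that(2)] mn(2) mx[OF that(1)]
        C[OF xy(1) memC(1)[OF that(1)]] memC(3)[OF that(1)] by (auto simp: le_less)
    ultimately show False using swap[OF mn(1)] by blast
  next
    case above
    let ?S = "{k \<in> fst ` M. x < k}"
    have "finite ?S" "?S \<noteq> {}" using finM above by force+
    from finite_has_minimal[OF this] obtain m where m: "m \<in> ?S" "\<And>k. k \<in> ?S \<Longrightarrow> k \<le> m \<Longrightarrow> m = k" by blast
    then obtain n where mn: "(m, n) \<in> M" "x < m" by force
    have mx: "m \<le> k" if "(k, l) \<in> M" "x < k" for k l
      using m(2)[of k] C[OF memC(1)[OF mn(1)] memC(1)[OF that(1)]] that by force
    have "n \<le> b" using crossing_setD(4)[OF M above(1) mn(1)] mx[OF above(1,2)] by fastforce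
    then have "\<not> x \<le> n" using above(3) xy(3) by (meson order_trans)
    moreover have "\<not> n \<le> x" using crossing_setD(3)[OF M mn(1)] mn(2) by (meson less_imp_le order_trans)
    moreover have "a' < x \<and> b' < n \<or> x < a' \<and> n < b'" if "(a', b') \<in> M" "(a', b') \<noteq> (m, n)" for a' b'
      using crossing_setD(4)[OF M that(1) mn(1) that(2)] mn(2) mx[OF that(1)]
        C[OF xy(1) memC(1)[OF that(1)]] memC(3)[OF that(1)] by (auto simp: le_less)
    ultimately show False using swap[OF mn(1)] by blast
  next
    case free
    have "crossing_set C D (insert (x, y) M)"
      by (rule crossing_setI) (use xy crossing_setD(1-3)[OF M] crossing_setD(4)[OF M] free in blast)+
    moreover have "(x, y) \<notin> M" using x by force
    ultimately show False using max[of "insert (x, y) M"] finM by simp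
  qed
qed

text \<open>In a chain the longest chain descending from \<open>z\<close> is its whole down-set,
  whose length is the number of elements strictly below \<open>z\<close>.\<close>

lemma height_in_chain:
  fixes C :: "'a::{finite, order} set"
  assumes C: "\<And>x y. x \<in> C \<Longrightarrow> y \<in> C \<Longrightarrow> x \<le> y \<or> y \<le> x" and z: "z \<in> C"
  shows "height_in C z = card {p \<in> C. p < z}"
  unfolding height_in_def
proof (rule Max_eqI)
  let ?H = "{chain_length D | D. pred_on.chain C (<) D \<and> z \<in> D \<and> (\<forall>y\<in>D. y \<le> z)}"
  show "finite ?H" by simp
  have eq: "{p \<in> C. p \<le> z} = insert z {p \<in> C. p < z}" using z by auto
  have len: "chain_length {p \<in> C. p \<le> z} = card {p \<in> C. p < z}"
    unfolding chain_length_def eq by simp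
  have "pred_on.chain C (<) {p \<in> C. p \<le> z}"
    using C by (auto simp: pred_on.chain_def le_less)
  then show "card {p \<in> C. p < z} \<in> ?H" using len z by force
  fix h assume "h \<in> ?H"
  then obtain D where D: "h = chain_length D" "pred_on.chain C (<) D" "\<forall>y\<in>D. y \<le> z" by blast
  then have "D \<subseteq> {p \<in> C. p \<le> z}" by (auto simp: pred_on.chain_def)
  then have "card D \<le> card {p \<in> C. p \<le> z}" by (intro card_mono) auto
  then show "h \<le> card {p \<in> C. p < z}" unfolding D(1) len[symmetric] chain_length_def by simp
qed

text \<open>Both components order the pairs in the same way. When both chains are covered, the two
  elements of a pair therefore have equal heights.\<close>

lemma card_before_in_crossing_set:
  assumes M: "crossing_set C D M" and t: "t \<in> M"
  shows "card {p \<in> fst ` M. p < fst t} = card {s \<in> M. fst s < fst t}"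
    "card {p \<in> snd ` M. p < snd t} = card {s \<in> M. fst s < fst t}"
proof -
  have "{p \<in> fst ` M. p < fst t} = fst ` {s \<in> M. fst s < fst t}" by auto
  then show "card {p \<in> fst ` M. p < fst t} = card {s \<in> M. fst s < fst t}"
    by (simp only:) (rule card_image, rule inj_on_subset[OF crossing_set_inj(1)[OF M]], auto)
  have "snd s < snd t \<longleftrightarrow> fst s < fst t" if "s \<in> M" for s
    using crossing_setD(4)[OF M, of "fst s" "snd s" "fst t" "snd t"] that t by (cases "s = t") auto
  then have "{p \<in> snd ` M. p < snd t} = snd ` {s \<in> M. fst s < fst t}" by auto
  then show "card {p \<in> snd ` M. p < snd t} = card {s \<in> M. fst s < fst t}"
    by (simp only:) (rule card_image, rule inj_on_subset[OF crossing_set_inj(2)[OF M]], auto)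
qed

text \<open>Otherwise \<open>x\<close> could be added to the chain. This supplies every element of
  one chain with an incomparable partner in the other.\<close>

lemma maxchain_insert:
  assumes "pred_on.maxchain Q (<) C" "x \<in> Q" "x \<notin> C"
  shows "\<exists>y\<in>C. \<not> x \<le> y \<and> \<not> y \<le> (x :: 'a::order)"
proof (rule ccontr)
  assume *: "\<not> ?thesis"
  have "pred_on.chain Q (<) C" using assms(1) by (simp add: pred_on.maxchain_def)
  then have "pred_on.chain Q (<) (insert x C)"
    using * assms(2) by (auto simp: pred_on.chain_def le_less)
  then show False using assms(1,3) unfolding pred_on.maxchain_def by blast
qed

lemma maxchain_total:
  assumes "pred_on.maxchain Q (<) C" "x \<in> C" "y \<in> C"
  shows "x \<le> y \<or> y \<le> (x :: 'a::order)"
  using assms by (auto simp: pred_on.maxchain_def pred_on.chain_def le_less)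

section \<open>Levels, regularity, and the unique maximal set\<close>

locale canonical_pair =
  fixes C1 C2 :: "'a::{finite, distrib_lattice} set"
  assumes canonical: "canonical_decomposition {C1, C2}" and distinct: "C1 \<noteq> C2"
begin

lemma maxchains: "pred_on.maxchain join_irreducibles (<) C1" "pred_on.maxchain join_irreducibles (<) C2"
  using canonical by (auto simp: canonical_decomposition_def)

lemma chains_partition: "C1 \<union> C2 = join_irreducibles" "C1 \<inter> C2 = {}" "C1 \<noteq> {}" "C2 \<noteq> {}"
  using canonical distinct
  by (auto simp: canonical_decomposition_def partition_on_def pairwise_def disjnt_def)

sublocale two_chains C1 C2
  by unfold_locales (use chains_partition maxchain_total[OF maxchains(1)] maxchain_total[OF maxchains(2)] in auto)

text \<open>Along a crossing set covering both chains the elements of each pair lie on a common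
  level, and every canonical decomposition has exactly one element of each level on either
  of its chains.\<close>

definition before :: "('a \<times> 'a) set \<Rightarrow> 'a \<Rightarrow> ('a \<times> 'a) set" where
  "before M p = {s \<in> M. fst s < p \<or> snd s < p}"

text \<open>A pair \<open>s\<close> later than \<open>t\<close> cannot contribute, even across the
  chains: \<open>fst s < snd t\<close> with \<open>fst t < fst s\<close> would make the components
  of \<open>t\<close> comparable.\<close>

lemma before_pair:
  assumes M: "crossing_set C1 C2 M" and t: "t \<in> M" and p: "p = fst t \<or> p = snd t"
  shows "before M p = {s \<in> M. fst s < fst t}"
proof -
  have "fst s < p \<or> snd s < p \<longleftrightarrow> fst s < fst t" if s: "s \<in> M" for s
  proof (cases "s = t")
    case True
    then show ?thesis using p crossing_setD(2,3)[OF M, of "fst t" "snd t"] t by auto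
  next
    case False
    then consider "fst s < fst t" "snd s < snd t" | "fst t < fst s" "snd t < snd s"
      using crossing_setD(4)[OF M, of "fst s" "snd s" "fst t" "snd t"] s t by (auto simp: prod_eq_iff)
    then show ?thesis
    proof cases
      case 1
      then show ?thesis using p by auto
    next
      case 2
      have "\<not> fst s < p"
        using p 2 crossing_setD(2)[OF M, of "fst t" "snd t"] t by (auto dest: less_trans less_imp_le)
      moreover have "\<not> snd s < p"
        using p 2 crossing_setD(3)[OF M, of "fst t" "snd t"] t by (auto dest: less_trans less_imp_le)
      ultimately show ?thesis using 2 by auto
    qed
  qed
  then show ?thesis by (auto simp: before_def)
qed

text \<open>The pair containing \<open>p\<close> lies before \<open>q\<close> but not before
  \<open>p\<close>. So the size of \<open>before M p\<close> is a strictly increasing level on all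
  join-irreducibles.\<close>

lemma before_strict_mono:
  assumes M: "crossing_set C1 C2 M" and cover: "fst ` M = C1" "snd ` M = C2"
    and p: "p \<in> join_irreducibles" and q: "q \<in> join_irreducibles" and "p < q"
  shows "before M p \<subset> before M q"
proof -
  have "\<exists>t\<in>M. p = fst t \<or> p = snd t" using p unfolding chains_partition(1)[symmetric] cover[symmetric] by auto
  then obtain t where t: "t \<in> M" "p = fst t \<or> p = snd t" by blast
  have "t \<in> before M q" using t \<open>p < q\<close> by (auto simp: before_def)
  moreover have "t \<notin> before M p" using before_pair[OF M t] by auto
  moreover have "before M p \<subseteq> before M q"
    using \<open>p < q\<close> by (auto simp: before_def intro: less_trans)
  ultimately show ?thesis by blast
qed

lemma covering_imp_regular:
  assumes M: "crossing_set C1 C2 M" and cover: "fst ` M = C1" "snd ` M = C2"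
  shows "regular_lattice TYPE('a)"
  unfolding regular_lattice_def
proof (intro conjI allI impI ballI)
  show "hyper_planar TYPE('a)" using canonical by (auto simp: hyper_planar_def)
  fix \<C> :: "'a set set" and C D x y
  assume can: "canonical_decomposition \<C>" and CD: "C \<in> \<C>" "D \<in> \<C>" and xy: "x \<in> C" "y \<in> D" "x < y"
  let ?P = "join_irreducibles :: 'a set"
  have max: "pred_on.maxchain ?P (<) E" if "E \<in> \<C>" for E
    using can that by (auto simp: canonical_decomposition_def)
  have part: "\<Union>\<C> = ?P" "disjoint \<C>" "{} \<notin> \<C>"
    using can by (auto simp: canonical_decomposition_def partition_on_def)
  have in_block: "\<exists>E\<in>\<C>. p \<in> E" if "p \<in> ?P" for p using that part(1) by blast
  have disj: "E = F" if "E \<in> \<C>" "F \<in> \<C>" "p \<in> E" "p \<in> F" for E F p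
    using part(2) that unfolding pairwise_def disjnt_def by blast
  have sub: "E \<subseteq> ?P" if "E \<in> \<C>" for E using can that
    by (auto simp: canonical_decomposition_def partition_on_def)
  have finM: "finite M" by simp
  have "M \<noteq> {}" using cover chains_partition(3) by auto
  \<comment> \<open>The lowest pair: every other pair exceeds it in both components.\<close>
  then obtain t0 where t0: "t0 \<in> M" "\<And>t. t \<in> M \<Longrightarrow> card (before M (fst t0)) \<le> card (before M (fst t))"
    using ex_has_least_nat[of "\<lambda>t. t \<in> M" _ "\<lambda>t. card (before M (fst t))"] by blast
  have t0_less: "fst t0 < fst t \<and> snd t0 < snd t" if "t \<in> M" "t \<noteq> t0" for t
  proof -
    have "\<not> fst t < fst t0"
    proof
      assume "fst t < fst t0"
      then have "before M (fst t) \<subset> before M (fst t0)"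
        using that t0(1) cover chains_partition(1) by (intro before_strict_mono[OF M cover]) auto
      then have "card (before M (fst t)) < card (before M (fst t0))"
        by (intro psubset_card_mono finite)
      with t0(2)[OF that(1)] show False by simp
    qed
    then show ?thesis
      using crossing_setD(4)[OF M, of "fst t" "snd t" "fst t0" "snd t0"] that t0(1) by (auto simp: prod_eq_iff)
  qed
  have pair: "\<exists>t\<in>M. p = fst t \<or> p = snd t" if "p \<in> ?P" for p
    using that unfolding chains_partition(1)[symmetric] cover[symmetric] by auto
  have mem: "fst t \<in> ?P" "snd t \<in> ?P" if "t \<in> M" for t
    using that cover chains_partition(1) by auto
  have not_both: "\<not> (fst t \<in> E \<and> snd t \<in> E)" if "t \<in> M" "E \<in> \<C>" for t E
    using crossing_setD(2,3)[OF M, of "fst t" "snd t"] maxchain_total[OF max[OF that(2)]] that(1) by auto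
  \<comment> \<open>A block avoiding both elements of \<open>t0\<close> could be extended downwards
    by one of them. As blocks are disjoint, there are thus at most two.\<close>
  have bottom: "fst t0 \<in> E \<or> snd t0 \<in> E" if E: "E \<in> \<C>" for E
  proof (rule ccontr)
    assume no: "\<not> ?thesis"
    have "E \<noteq> {}" using part(3) E by blast
    then obtain z where z: "z \<in> E" "\<And>w. w \<in> E \<Longrightarrow> w \<le> z \<Longrightarrow> z = w"
      using finite_has_minimal[of E] by auto
    have zle: "z \<le> w" if "w \<in> E" for w using maxchain_total[OF max[OF E] z(1) that] z(2)[OF that] by auto
    obtain t where t: "t \<in> M" "z = fst t \<or> z = snd t" using pair z(1) sub[OF E] by blast
    have "t \<noteq> t0" using t z(1) no by auto
    then have "fst t0 < z \<or> snd t0 < z" using t0_less[OF t(1)] t(2) by auto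
    then obtain b where b: "b = fst t0 \<or> b = snd t0" "b < z" by blast
    have "b \<in> ?P" "b \<notin> E" using b no mem[OF t0(1)] by auto
    from maxchain_insert[OF max[OF E] this] show False using b(2) zle by (meson less_imp_le order_trans)
  qed
  obtain A where A: "A \<in> \<C>" "fst t0 \<in> A"
    using in_block[OF mem(1)[OF t0(1)]] by blast
  obtain B where B: "B \<in> \<C>" "snd t0 \<in> B"
    using in_block[OF mem(2)[OF t0(1)]] by blast
  have AB: "E = A \<or> E = B" if "E \<in> \<C>" for E
    using bottom[OF that] disj A B that by metis
  \<comment> \<open>The elements of a pair are incomparable, so they lie in different blocks, and
    these are all the blocks.\<close>
  have one: "fst t \<in> E \<longleftrightarrow> snd t \<notin> E" if t: "t \<in> M" and E: "E \<in> \<C>" for t E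
  proof -
    obtain F G where F: "F \<in> \<C>" "fst t \<in> F" and G: "G \<in> \<C>" "snd t \<in> G"
      using in_block[OF mem(1)[OF t]] in_block[OF mem(2)[OF t]] by blast
    have "F \<noteq> G" using not_both[OF t F(1)] F(2) G(2) by auto
    then have "E = F \<or> E = G" using AB[OF E] AB[OF F(1)] AB[OF G(1)] by auto
    then show ?thesis using not_both[OF t E] F(2) G(2) by auto
  qed
  have height: "height_in E z = card (before M z)" if E: "E \<in> \<C>" and z: "z \<in> E" for E z
  proof -
    \<comment> \<open>Selects from each pair its unique element in \<open>E\<close>; this carries
      the pairs before \<open>z\<close> bijectively to the elements of \<open>E\<close> below
      \<open>z\<close>.\<close>
    define f where "f t = (if fst t \<in> E then fst t else snd t)" for t :: "'a \<times> 'a"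
    have fE: "f t \<in> E" "f t = fst t \<or> f t = snd t" if "t \<in> M" for t
      using one[OF that E] by (auto simp: f_def)
    have before_f: "before M (f t) = {s \<in> M. fst s < fst t}" if "t \<in> M" for t
      using before_pair[OF M that] fE(2)[OF that] by blast
    obtain tz where tz: "tz \<in> M" "f tz = z"
    proof -
      obtain t where "t \<in> M" "z = fst t \<or> z = snd t" using pair z sub[OF E] by blast
      then show thesis using one[OF _ E, of t] z that[of t] by (auto simp: f_def)
    qed
    have inj: "inj_on f M"
    proof (rule inj_onI)
      fix s t assume st: "s \<in> M" "t \<in> M" "f s = f t"
      show "s = t"
      proof (rule ccontr)
        assume "s \<noteq> t"
        then consider "fst s < fst t" | "fst t < fst s"
          using crossing_setD(4)[OF M, of "fst s" "snd s" "fst t" "snd t"] st by (auto simp: prod_eq_iff)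
        then show False
          using before_f[OF st(1)] before_f[OF st(2)] st by cases auto
      qed
    qed
    have "{p \<in> E. p < z} = f ` before M z"
    proof (intro equalityI subsetI)
      fix p assume p: "p \<in> {p \<in> E. p < z}"
      then obtain t where t: "t \<in> M" "p = fst t \<or> p = snd t" using pair sub[OF E] by blast
      then have "p = f t" using one[OF t(1) E] p by (auto simp: f_def)
      moreover have "t \<in> before M z" using t p by (auto simp: before_def)
      ultimately show "p \<in> f ` before M z" by blast
    next
      fix p assume "p \<in> f ` before M z"
      then obtain t where t: "t \<in> before M z" "p = f t" by blast
      then have tM: "t \<in> M" by (simp add: before_def)
      have tt: "fst t < fst tz" using t(1) before_f[OF tz(1)] tz(2) by auto
      have "\<not> z \<le> p"
      proof
        assume "z \<le> p"
        then have "before M z \<subseteq> before M p" by (auto simp: before_def intro: less_le_trans)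
        with t tt before_f[OF tM] show False by auto
      qed
      then have "p < z" using maxchain_total[OF max[OF E] z fE(1)[OF tM]] t(2) by auto
      then show "p \<in> {p \<in> E. p < z}" using fE(1)[OF tM] t(2) by auto
    qed
    moreover have "inj_on f (before M z)" by (rule inj_on_subset[OF inj]) (auto simp: before_def)
    ultimately have "card {p \<in> E. p < z} = card (before M z)" by (simp add: card_image)
    then show ?thesis using height_in_chain[OF maxchain_total[OF max[OF E]] z] by simp
  qed
  have "before M x \<subset> before M y"
    using xy sub[OF CD(1)] sub[OF CD(2)] by (intro before_strict_mono[OF M cover]) auto
  then have "card (before M x) < card (before M y)" by (intro psubset_card_mono finite)
  then show "height_in C x < height_in D y" using height[OF CD(1) xy(1)] height[OF CD(2) xy(2)] by simp
qed

lemma card_before_strict_mono: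
  assumes "x \<in> C" "x < y"
  shows "card {p \<in> C. p < x} < card {p \<in> C. p < (y :: 'a)}"
  using assms by (intro psubset_card_mono) (auto intro: less_trans)

text \<open>Uniqueness forces both chains to be covered, by the exchange argument for
  \<open>M\<close> and for its mirror image. Conversely, pairing elements of equal height attains
  the largest possible size, and any set of that size covers both chains and hence pairs equal
  heights.\<close>

lemma unique_max_crossing_set_iff:
  "(\<exists>!M. crossing_set C1 C2 M \<and> (\<forall>M'. crossing_set C1 C2 M' \<longrightarrow> card M' \<le> card M)) \<longleftrightarrow>
   regular_lattice TYPE('a) \<and> chain_length C1 = chain_length C2"
proof
  assume "\<exists>!M. crossing_set C1 C2 M \<and> (\<forall>M'. crossing_set C1 C2 M' \<longrightarrow> card M' \<le> card M)"
  then obtain M where M: "crossing_set C1 C2 M" and max: "\<And>M'. crossing_set C1 C2 M' \<Longrightarrow> card M' \<le> card M"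
    and uniq: "\<And>M'. crossing_set C1 C2 M' \<Longrightarrow> card M' = card M \<Longrightarrow> M' = M"
    unfolding Ex1_def by (metis (no_types, lifting))
  have "C1 \<subseteq> fst ` M"
  proof
    fix x assume x: "x \<in> C1"
    obtain y where y: "y \<in> C2" "\<not> x \<le> y" "\<not> y \<le> x"
      using maxchain_insert[OF maxchains(2), of x] x chains_partition by blast
    show "x \<in> fst ` M"
      by (rule unique_max_crossing_set_covers[OF _ _ chain1 chain2 M max uniq x y]) auto
  qed
  then have cover1: "fst ` M = C1" using crossing_setD(1)[OF M] by auto
  have "C2 \<subseteq> fst ` prod.swap ` M"
  proof
    fix y assume y: "y \<in> C2"
    obtain x where x: "x \<in> C1" "\<not> y \<le> x" "\<not> x \<le> y"
      using maxchain_insert[OF maxchains(1), of y] y chains_partition by blast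
    have card_swap: "card (prod.swap ` N) = card N" for N :: "('a \<times> 'a) set"
      by (rule card_image) simp
    have swap_swap: "prod.swap ` prod.swap ` N = N" for N :: "('a \<times> 'a) set" by (simp add: image_image)
    show "y \<in> fst ` prod.swap ` M"
    proof (rule unique_max_crossing_set_covers[OF _ _ chain2 chain1 crossing_set_converse[OF M] _ _ y x])
      fix M' assume "crossing_set C2 C1 M'"
      from crossing_set_converse[OF this] have M': "crossing_set C1 C2 (prod.swap ` M')" .
      from max[OF M'] show "card M' \<le> card (prod.swap ` M)" by (simp only: card_swap)
      assume "card M' = card (prod.swap ` M)"
      then have "prod.swap ` M' = M" by (intro uniq[OF M']) (simp only: card_swap)
      then show "M' = prod.swap ` M" using swap_swap by metis
    qed auto
  qed
  then have cover2: "snd ` M = C2" using crossing_setD(1)[OF M] by (auto simp: image_image)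
  have "card C1 = card C2"
    using card_image[OF crossing_set_inj(1)[OF M]] card_image[OF crossing_set_inj(2)[OF M]] cover1 cover2 by simp
  then show "regular_lattice TYPE('a) \<and> chain_length C1 = chain_length C2"
    using covering_imp_regular[OF M cover1 cover2] by (simp add: chain_length_def)
next
  assume "regular_lattice TYPE('a) \<and> chain_length C1 = chain_length C2"
  then have reg: "regular_lattice TYPE('a)" and len: "card C1 - 1 = card C2 - 1"
    by (simp_all add: chain_length_def)
  \<comment> \<open>Nonemptiness turns equality of the truncated lengths into equality of
    cardinalities.\<close>
  have pos: "card C1 > 0" "card C2 > 0" using chains_partition(3,4) by (simp_all add: card_gt_0_iff)
  with len have card_eq: "card C1 = card C2" by simp
  define h where "h C z = card {p \<in> C. p < z}" for C and z :: 'a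
  have h1: "height_in C1 x = h C1 x" if "x \<in> C1" for x
    unfolding h_def by (rule height_in_chain) (use chain1 that in auto)
  have h2: "height_in C2 x = h C2 x" if "x \<in> C2" for x
    unfolding h_def by (rule height_in_chain) (use chain2 that in auto)
  \<comment> \<open>Regularity for the given decomposition excludes comparable elements of equal
    height in the two chains.\<close>
  have cross: "h C1 x \<noteq> h C2 y \<or> \<not> x \<le> y \<and> \<not> y \<le> x" if "x \<in> C1" "y \<in> C2" for x y
  proof -
    have "x \<noteq> y" using that chains_partition(2) by auto
    moreover have "x < y \<Longrightarrow> height_in C1 x < height_in C2 y" "y < x \<Longrightarrow> height_in C2 y < height_in C1 x"
      using reg canonical that unfolding regular_lattice_def by blast+
    ultimately show ?thesis using h1 h2 that by (auto simp: le_less)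
  qed
  have hmono: "h C x < h C y" if "x \<in> C" "x < y" for C x y
    unfolding h_def by (rule card_before_strict_mono[OF that])
  have bij: "bij_betw (h C) C {..<card C}" if "\<And>x y. x \<in> C \<Longrightarrow> y \<in> C \<Longrightarrow> x \<le> y \<or> y \<le> x" for C
  proof -
    have "inj_on (h C) C"
    proof (rule inj_onI)
      fix x y assume "x \<in> C" "y \<in> C" "h C x = h C y"
      then show "x = y" using that[of x y] hmono[of x C y] hmono[of y C x] by (auto simp: le_less)
    qed
    moreover have "h C ` C \<subseteq> {..<card C}"
    proof
      fix k assume "k \<in> h C ` C"
      then obtain x where x: "x \<in> C" "k = card {p \<in> C. p < x}" by (auto simp: h_def)
      have "card {p \<in> C. p < x} < card C" using x(1) by (intro psubset_card_mono) auto
      then show "k \<in> {..<card C}" using x(2) by simp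
    qed
    ultimately show ?thesis
      unfolding bij_betw_def by (simp add: card_image card_subset_eq)
  qed
  note b1 = bij[of C1, OF chain1] and b2 = bij[of C2, OF chain2]
  define M0 where "M0 = {(x, y). x \<in> C1 \<and> y \<in> C2 \<and> h C1 x = h C2 y}"
  have inj1: "x = x'" if "x \<in> C1" "x' \<in> C1" "h C1 x = h C1 x'" for x x'
    using b1 that by (auto simp: bij_betw_def inj_on_def)
  have inj2: "x = x'" if "x \<in> C2" "x' \<in> C2" "h C2 x = h C2 x'" for x x'
    using b2 that by (auto simp: bij_betw_def inj_on_def)
  have M0: "crossing_set C1 C2 M0"
  proof (rule crossing_setI)
    fix x y x' y' assume "(x, y) \<in> M0" "(x', y') \<in> M0" and ne: "(x, y) \<noteq> (x', y')"
    then have *: "x \<in> C1" "y \<in> C2" "x' \<in> C1" "y' \<in> C2" "h C1 x = h C2 y" "h C1 x' = h C2 y'"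
      by (auto simp: M0_def)
    have "h C1 x \<noteq> h C1 x'" using ne inj1[OF *(1,3)] inj2[OF *(2,4)] * by auto
    then show "x < x' \<and> y < y' \<or> x' < x \<and> y' < y"
      using chain1[OF *(1,3)] chain2[OF *(2,4)] hmono[of x C1 x'] hmono[of x' C1 x] hmono[of y C2 y'] hmono[of y' C2 y] *
      by (auto simp: le_less)
  qed (use cross in \<open>auto simp: M0_def\<close>)
  have "fst ` M0 = C1"
  proof -
    have "\<exists>y\<in>C2. h C1 x = h C2 y" if "x \<in> C1" for x
      using b1 b2 that card_eq by (metis bij_betw_iff_bijections)
    then show ?thesis by (force simp: M0_def)
  qed
  then have card0: "card M0 = card C1" using card_image[OF crossing_set_inj(1)[OF M0]] by simp
  have le: "card M \<le> card M0" if M: "crossing_set C1 C2 M" for M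
    unfolding card0 using crossing_setD(1)[OF M] by (intro card_inj_on_le[OF crossing_set_inj(1)[OF M]]) auto
  show "\<exists>!M. crossing_set C1 C2 M \<and> (\<forall>M'. crossing_set C1 C2 M' \<longrightarrow> card M' \<le> card M)"
  proof (rule ex1I[of _ M0])
    show "crossing_set C1 C2 M0 \<and> (\<forall>M'. crossing_set C1 C2 M' \<longrightarrow> card M' \<le> card M0)" using M0 le by blast
    fix M assume *: "crossing_set C1 C2 M \<and> (\<forall>M'. crossing_set C1 C2 M' \<longrightarrow> card M' \<le> card M)"
    then have M: "crossing_set C1 C2 M" by blast
    have cM: "card M = card M0" using * le[OF M] M0 by (simp add: order_antisym)
    have f: "fst ` M = C1"
      by (rule card_subset_eq) (use crossing_setD(1)[OF M] card_image[OF crossing_set_inj(1)[OF M]] cM card0 in auto)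
    have s: "snd ` M = C2"
      by (rule card_subset_eq) (use crossing_setD(1)[OF M] card_image[OF crossing_set_inj(2)[OF M]] cM card0 card_eq in auto)
    \<comment> \<open>With both chains covered, either height is the number of earlier
      pairs.\<close>
    have "h C1 x = h C2 y" if "(x, y) \<in> M" for x y
      using card_before_in_crossing_set[OF M that] f s by (simp add: h_def)
    then have "M \<subseteq> M0" using crossing_setD(1)[OF M] by (auto simp: M0_def)
    then show "M = M0" using cM by (intro card_subset_eq) auto
  qed
qed

end

theorem theorem3p5:
  fixes C1 C2 :: "'a::{finite, distrib_lattice} set"
  assumes "simple_planar TYPE('a)"
    and "canonical_decomposition {C1, C2}" and "C1 \<noteq> C2"
  shows "pseudo_Gorenstein
           (hibi_scale :: 'k::field \<Rightarrow> ('a, 'k) hibi_ring \<Rightarrow> ('a, 'k) hibi_ring)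
           hibi_component
         \<longleftrightarrow> regular_lattice TYPE('a) \<and> chain_length C1 = chain_length C2"
proof -
  interpret canonical_pair C1 C2 by unfold_locales (use assms in auto)
  show ?thesis
    unfolding pseudo_Gorenstein_hibi_iff ex1_max_descents_iff by (rule unique_max_crossing_set_iff)
qed

end
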